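(* Let $T$ be a finite tree, $\vec T$ any orientation of $T$, and $\mathbf{T}$ the poset on $V(T)$ with $u\le v$ iff $\vec T$ contains a directed path from $v$ to $u$ (so that $\vec T$ is its Hasse diagram). Then $\mathbf{J}(\mathbf{T})$ is an irreducible matchable distributive lattice.
   Context: For a finite poset $\mathbf{P}$, $\mathbf{J}(\mathbf{P})$ is the set of order ideals (down-sets) of $\mathbf{P}$ ordered by inclusion. A finite distributive lattice is irreducible if it is not isomorphic to a direct product of two or more lattices each with more than one element. For a plane bipartite graph $G$ with a fixed proper white/black coloring: a 1-factor is a perfect matching, $\mathcal{M}(G)$ the set of them; for $M\in\mathcal{M}(G)$ a cycle is $M$-alternating if its edges alternate in/out of $M$, and proper if each of its edges in $M$ goes from white to black end-vertex along the clockwise orientation of the cycle. $\vec Z(G)$ has vertex set $\mathcal{M}(G)$ and an arc $M_1\to M_2$ when $M_1\oplus M_2$ bounds an inner face and is a proper $M_1$-alternating cycle; $\mathbf{M}(G)$ is the poset on $\mathcal{M}(G)$ with $M_1\preceq M_2$ iff there is a directed path from $M_2$ to $M_1$. A finite distributive lattice $\mathbf{L}$ is a matchable distributive lattice (MDL) if $\mathbf{L}\cong\mathbf{M}(G)$ for some plane bipartite graph $G$. *)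

theory Defs
  imports "HOL-Complex_Analysis.Complex_Analysis" "HOL-Algebra.Lattice"
begin

section \<open>Posets and lattices\<close>

text \<open>Posets and lattices are HOL-Algebra order structures (type \<open>gorder\<close>) with explicit carriers
  and genuine equality in the field \<open>eq\<close>.\<close>

definition order_isomorphic :: "'a gorder \<Rightarrow> 'b gorder \<Rightarrow> bool" where
  "order_isomorphic L K \<longleftrightarrow>
     (\<exists>f. bij_betw f (carrier L) (carrier K) \<and> order_emb L K f)"

definition finite_distributive_lattice :: "'a gorder \<Rightarrow> bool" where
  "finite_distributive_lattice L \<longleftrightarrow>
     Lattice.lattice L \<and> finite (carrier L) \<and> carrier L \<noteq> {} \<and>
     (\<forall>x\<in>carrier L. \<forall>y\<in>carrier L. \<forall>z\<in>carrier L.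
        x \<sqinter>\<^bsub>L\<^esub> (y \<squnion>\<^bsub>L\<^esub> z) = (x \<sqinter>\<^bsub>L\<^esub> y) \<squnion>\<^bsub>L\<^esub> (x \<sqinter>\<^bsub>L\<^esub> z))"

definition direct_product :: "'i set \<Rightarrow> ('i \<Rightarrow> 'b gorder) \<Rightarrow> ('i \<Rightarrow> 'b) gorder" where
  "direct_product I K =
     \<lparr>carrier = (\<Pi>\<^sub>E i\<in>I. carrier (K i)), eq = (=),
      le = (\<lambda>x y. \<forall>i\<in>I. x i \<sqsubseteq>\<^bsub>K i\<^esub> y i)\<rparr>"

text \<open>The factors of a putative decomposition need an element type; it is the first argument, and
  leaving it a type variable in a theorem excludes factors over every type.\<close>

definition irreducible_lattice :: "'b itself \<Rightarrow> 'a gorder \<Rightarrow> bool" where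
  "irreducible_lattice (_ :: 'b itself) L \<longleftrightarrow>
     \<not> (\<exists>(n::nat) (K :: nat \<Rightarrow> 'b gorder).
          2 \<le> n \<and>
          (\<forall>i<n. Lattice.lattice (K i) \<and> (\<exists>x\<in>carrier (K i). \<exists>y\<in>carrier (K i). x \<noteq> y)) \<and>
          order_isomorphic L (direct_product {..<n} K))"

definition order_ideals :: "'a gorder \<Rightarrow> 'a set set" where
  "order_ideals P =
     {I. I \<subseteq> carrier P \<and> (\<forall>x\<in>I. \<forall>y\<in>carrier P. y \<sqsubseteq>\<^bsub>P\<^esub> x \<longrightarrow> y \<in> I)}"

definition ideal_lattice :: "'a gorder \<Rightarrow> 'a set gorder" where
  "ideal_lattice P = \<lparr>carrier = order_ideals P, eq = (=), le = (\<subseteq>)\<rparr>"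

text \<open>The order on the vertices of a digraph in which \<open>u\<close> is below \<open>v\<close> iff \<open>u\<close> can be reached
  from \<open>v\<close>.\<close>

definition reach_poset :: "'a set \<Rightarrow> ('a \<times> 'a) set \<Rightarrow> 'a gorder" where
  "reach_poset V A = \<lparr>carrier = V, eq = (=), le = (\<lambda>u v. (v, u) \<in> A\<^sup>*)\<rparr>"


section \<open>Finite simple graphs\<close>

definition finite_graph :: "'a set \<Rightarrow> 'a set set \<Rightarrow> bool" where
  "finite_graph V E \<longleftrightarrow> finite V \<and> (\<forall>e\<in>E. e \<subseteq> V \<and> card e = 2)"

text \<open>A cycle is given by the cyclic list of its vertices; this fixes a start vertex and a
  direction of traversal.\<close>

definition cyc_edge :: "'a list \<Rightarrow> nat \<Rightarrow> 'a set" where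
  "cyc_edge vs i = {vs ! (i mod length vs), vs ! (Suc i mod length vs)}"

definition cyc_edges :: "'a list \<Rightarrow> 'a set set" where
  "cyc_edges vs = cyc_edge vs ` {..<length vs}"

definition is_cycle :: "'a set set \<Rightarrow> 'a list \<Rightarrow> bool" where
  "is_cycle E vs \<longleftrightarrow> 3 \<le> length vs \<and> distinct vs \<and> cyc_edges vs \<subseteq> E"

definition finite_tree :: "'a set \<Rightarrow> 'a set set \<Rightarrow> bool" where
  "finite_tree V E \<longleftrightarrow>
     finite_graph V E \<and> V \<noteq> {} \<and>
     (\<forall>u\<in>V. \<forall>v\<in>V. (u, v) \<in> {(x, y). {x, y} \<in> E}\<^sup>*) \<and>
     (\<nexists>vs. is_cycle E vs)"

definition is_orientation :: "'a set set \<Rightarrow> ('a \<times> 'a) set \<Rightarrow> bool" where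
  "is_orientation E A \<longleftrightarrow>
     A \<subseteq> {(u, v). {u, v} \<in> E} \<and>
     (\<forall>u v. {u, v} \<in> E \<longrightarrow> ((u, v) \<in> A) \<noteq> ((v, u) \<in> A))"

definition perfect_matchings :: "'a set \<Rightarrow> 'a set set \<Rightarrow> 'a set set set" where
  "perfect_matchings V E = {M. M \<subseteq> E \<and> (\<forall>v\<in>V. \<exists>!e. e \<in> M \<and> v \<in> e)}"

text \<open>\<open>W\<close> is the set of white vertices.\<close>

definition proper_two_colouring :: "'a set \<Rightarrow> 'a set set \<Rightarrow> 'a set \<Rightarrow> bool" where
  "proper_two_colouring V E W \<longleftrightarrow> W \<subseteq> V \<and> (\<forall>e\<in>E. \<exists>w\<in>W. \<exists>b\<in>V - W. e = {w, b})"

definition alternating :: "'a set set \<Rightarrow> 'a list \<Rightarrow> bool" where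
  "alternating M vs \<longleftrightarrow>
     (\<forall>i<length vs. (cyc_edge vs i \<in> M) \<noteq> (cyc_edge vs (Suc i) \<in> M))"


section \<open>Plane graphs\<close>

text \<open>A plane graph has points of the plane as vertices, and \<open>D e\<close> is the arc that represents the
  edge \<open>e\<close>.\<close>

definition plane_graph ::
    "complex set \<Rightarrow> complex set set \<Rightarrow> (complex set \<Rightarrow> complex set) \<Rightarrow> bool" where
  "plane_graph V E D \<longleftrightarrow>
     finite_graph V E \<and>
     (\<forall>e\<in>E. (\<exists>g. arc g \<and> path_image g = D e \<and> {pathstart g, pathfinish g} = e) \<and>
             D e \<inter> V = e) \<and>
     (\<forall>e\<in>E. \<forall>e'\<in>E. e \<noteq> e' \<longrightarrow> D e \<inter> D e' \<subseteq> e \<inter> e')"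

definition inner_faces ::
    "complex set \<Rightarrow> complex set set \<Rightarrow> (complex set \<Rightarrow> complex set) \<Rightarrow> complex set set" where
  "inner_faces V E D = {F \<in> components (- (V \<union> \<Union> (D ` E))). bounded F}"

text \<open>The vertex list \<open>vs\<close> runs clockwise around its cycle: the simple closed curve that follows
  the arcs of the cycle in the order of \<open>vs\<close> has winding number \<open>-1\<close> around the points it
  encloses. The curve passes \<open>vs ! i\<close> at time \<open>t i\<close>.\<close>

definition clockwise :: "(complex set \<Rightarrow> complex set) \<Rightarrow> complex list \<Rightarrow> bool" where
  "clockwise D vs \<longleftrightarrow>
     (\<exists>p (t :: nat \<Rightarrow> real).
        simple_path p \<and> pathfinish p = pathstart p \<and>
        t 0 = 0 \<and> t (length vs) = 1 \<and>
        (\<forall>i<length vs. t i < t (Suc i) \<and> p (t i) = vs ! i \<and>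
                       p ` {t i..t (Suc i)} = D (cyc_edge vs i)) \<and>
        (\<forall>z\<in>inside (path_image p). winding_number p z = -1))"

text \<open>For \<open>vs\<close> listed clockwise.\<close>

definition proper_cycle :: "complex set \<Rightarrow> complex set set \<Rightarrow> complex list \<Rightarrow> bool" where
  "proper_cycle W M vs \<longleftrightarrow>
     (\<forall>i<length vs. cyc_edge vs i \<in> M \<longrightarrow>
        vs ! i \<in> W \<and> vs ! (Suc i mod length vs) \<notin> W)"

text \<open>The arcs of the directed Z-transformation graph on the perfect matchings.\<close>

definition z_arcs ::
    "complex set \<Rightarrow> complex set set \<Rightarrow> (complex set \<Rightarrow> complex set) \<Rightarrow> complex set
       \<Rightarrow> (complex set set \<times> complex set set) set" where
  "z_arcs V E D W =
     {(M1, M2). M1 \<in> perfect_matchings V E \<and> M2 \<in> perfect_matchings V E \<and>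
        (\<exists>vs. is_cycle E vs \<and> clockwise D vs \<and>
              cyc_edges vs = (M1 - M2) \<union> (M2 - M1) \<and>
              (\<exists>F\<in>inner_faces V E D. frontier F = \<Union> (D ` cyc_edges vs)) \<and>
              alternating M1 vs \<and> proper_cycle W M1 vs)}"

definition matching_poset ::
    "complex set \<Rightarrow> complex set set \<Rightarrow> (complex set \<Rightarrow> complex set) \<Rightarrow> complex set
       \<Rightarrow> complex set set gorder" where
  "matching_poset V E D W = reach_poset (perfect_matchings V E) (z_arcs V E D W)"

definition matchable_distributive_lattice :: "'a gorder \<Rightarrow> bool" where
  "matchable_distributive_lattice L \<longleftrightarrow>
     finite_distributive_lattice L \<and>
     (\<exists>V E D W. plane_graph V E D \<and> proper_two_colouring V E W \<and>
                order_isomorphic L (matching_poset V E D W))"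


section \<open>An oriented tree is the Hasse diagram of its reachability order\<close>

lemma rtrancl_distinct_path:
  assumes "(x, y) \<in> A\<^sup>*"
  shows "\<exists>vs. vs \<noteq> [] \<and> hd vs = x \<and> last vs = y \<and> distinct vs \<and>
              (\<forall>i. Suc i < length vs \<longrightarrow> (vs ! i, vs ! Suc i) \<in> A)"
  using assms
proof (induction rule: rtrancl_induct)
  case base
  show ?case by (intro exI[of _ "[x]"]) auto
next
  case (step y z)
  then obtain vs where vs: "vs \<noteq> []" "hd vs = x" "last vs = y" "distinct vs"
      "\<And>i. Suc i < length vs \<Longrightarrow> (vs ! i, vs ! Suc i) \<in> A" by blast
  show ?case
  proof (cases "z \<in> set vs")
    case True
    then obtain k where k: "k < length vs" "vs ! k = z" by (auto simp: in_set_conv_nth)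
    have "last (take (Suc k) vs) = z" using k by (simp add: take_Suc_conv_app_nth)
    then show ?thesis using vs k
      by (intro exI[of _ "take (Suc k) vs"]) auto
  next
    case False
    have "((vs @ [z]) ! i, (vs @ [z]) ! Suc i) \<in> A" if "Suc i < length (vs @ [z])" for i
    proof (cases "Suc i < length vs")
      case True
      then show ?thesis using vs(5)[of i] by (simp add: nth_append)
    next
      case F: False
      then have "Suc i = length vs" using that by simp
      moreover from this have "vs ! i = y" using vs(1,3)
        by (metis diff_Suc_1 last_conv_nth)
      ultimately show ?thesis using step.hyps(2) by (simp add: nth_append)
    qed
    then show ?thesis using vs False by (intro exI[of _ "vs @ [z]"]) auto
  qed
qed

lemma is_cycleI_path:
  assumes "3 \<le> length vs" "distinct vs"
    and "\<And>i. Suc i < length vs \<Longrightarrow> {vs ! i, vs ! Suc i} \<in> E"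
    and "{last vs, hd vs} \<in> E"
  shows "is_cycle E vs"
proof -
  have "cyc_edge vs i \<in> E" if "i < length vs" for i
  proof (cases "Suc i < length vs")
    case True
    then show ?thesis using assms(3)[of i] by (simp add: cyc_edge_def)
  next
    case False
    then have "Suc i = length vs" using that by simp
    moreover have "vs \<noteq> []" using assms(1) by auto
    ultimately show ?thesis using assms(4) that
      by (metis cyc_edge_def diff_Suc_1 hd_conv_nth last_conv_nth mod_less mod_self)
  qed
  then show ?thesis using assms by (auto simp: is_cycle_def cyc_edges_def)
qed

context
  fixes V :: "'a set" and E A
  assumes tree: "finite_tree V E" and orient: "is_orientation E A"
begin

lemma orientation_edge: "(u, v) \<in> A \<Longrightarrow> {u, v} \<in> E"
  using orient by (auto simp: is_orientation_def)

lemma orientation_ends: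
  assumes "(u, v) \<in> A"
  shows "u \<in> V" "v \<in> V" "u \<noteq> v"
proof -
  have "{u, v} \<subseteq> V" "card {u, v} = 2"
    using tree orientation_edge[OF assms] unfolding finite_tree_def finite_graph_def by blast+
  then show "u \<in> V" "v \<in> V" "u \<noteq> v" by auto
qed

lemma orientation_no_long_path:
  assumes "{y, x} \<in> E" "vs \<noteq> []" "hd vs = x" "last vs = y" "distinct vs"
    "\<And>i. Suc i < length vs \<Longrightarrow> (vs ! i, vs ! Suc i) \<in> A"
  shows "length vs < 3"
proof (rule ccontr)
  assume "\<not> length vs < 3"
  then have "is_cycle E vs" using assms orientation_edge by (intro is_cycleI_path) auto
  then show False using tree by (auto simp: finite_tree_def)
qed

lemma orientation_acyclic: "(x, x) \<notin> A\<^sup>+"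
proof
  assume "(x, x) \<in> A\<^sup>+"
  then obtain y where y: "(x, y) \<in> A" "(y, x) \<in> A\<^sup>*" by (meson tranclD)
  obtain vs where vs: "vs \<noteq> []" "hd vs = y" "last vs = x" "distinct vs"
      "\<And>i. Suc i < length vs \<Longrightarrow> (vs ! i, vs ! Suc i) \<in> A"
    using rtrancl_distinct_path[OF y(2)] by blast
  have "length vs < 3"
    using orientation_no_long_path[of x y vs] vs orientation_edge[OF y(1)] by blast
  moreover have "length vs \<noteq> 1"
    using vs(2,3) orientation_ends(3)[OF y(1)] by (auto simp: length_Suc_conv)
  moreover have "length vs \<noteq> 0" using vs(1) by simp
  ultimately have len: "length vs = 2" by linarith
  then have "(y, x) \<in> A" using vs(5)[of 0] vs(1-3)
    by (simp add: hd_conv_nth last_conv_nth)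
  then show False using orient y(1) orientation_edge[OF y(1)]
    by (auto simp: is_orientation_def)
qed

lemma partial_order_reach_poset_tree: "partial_order (reach_poset V A)"
proof
  fix x y
  assume "x \<sqsubseteq>\<^bsub>reach_poset V A\<^esub> y" "y \<sqsubseteq>\<^bsub>reach_poset V A\<^esub> x"
  then have "(x, y) \<in> A\<^sup>*" "(y, x) \<in> A\<^sup>*" by (auto simp: reach_poset_def)
  then have "x = y" using orientation_acyclic
    by (metis rtranclD rtrancl_trancl_trancl)
  then show "x .=\<^bsub>reach_poset V A\<^esub> y" by (simp add: reach_poset_def)
qed (auto simp: reach_poset_def)

lemma hasse_diagram_tree:
  "(u, v) \<in> A \<longleftrightarrow>
     u \<in> V \<and> v \<in> V \<and> v \<sqsubset>\<^bsub>reach_poset V A\<^esub> u \<and>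
     \<not> (\<exists>w\<in>V. v \<sqsubset>\<^bsub>reach_poset V A\<^esub> w \<and> w \<sqsubset>\<^bsub>reach_poset V A\<^esub> u)"
proof -
  have less: "x \<sqsubset>\<^bsub>reach_poset V A\<^esub> y \<longleftrightarrow> (y, x) \<in> A\<^sup>+" for x y
    using orientation_acyclic by (auto simp: lless_def reach_poset_def rtrancl_eq_or_trancl)
  have nobetween: False if uv: "(u, v) \<in> A" and uw: "(u, w) \<in> A\<^sup>+" and wv: "(w, v) \<in> A\<^sup>+" for w
  proof -
    obtain u' where u': "(u, u') \<in> A" "(u', w) \<in> A\<^sup>*" using uw by (meson tranclD)
    then have u'v: "(u', v) \<in> A\<^sup>+" using wv by (meson rtrancl_trancl_trancl)
    obtain vs where vs: "vs \<noteq> []" "hd vs = u'" "last vs = v" "distinct vs"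
      "\<And>i. Suc i < length vs \<Longrightarrow> (vs ! i, vs ! Suc i) \<in> A"
      using rtrancl_distinct_path[OF trancl_into_rtrancl[OF u'v]] by blast
    have reach: "(u', vs ! i) \<in> A\<^sup>*" if "i < length vs" for i
      using that
    proof (induction i)
      case 0
      then show ?case using vs(1,2) by (simp add: hd_conv_nth)
    next
      case (Suc i)
      then show ?case using vs(5)[of i] by (meson Suc_lessD rtrancl.rtrancl_into_rtrancl)
    qed
    have "u \<notin> set vs"
    proof
      assume "u \<in> set vs"
      then have "(u', u) \<in> A\<^sup>*" using reach by (auto simp: in_set_conv_nth)
      then show False using u'(1) orientation_acyclic by (meson rtrancl_into_trancl2)
    qed
    moreover have "((u # vs) ! i, (u # vs) ! Suc i) \<in> A" if "Suc i < length (u # vs)" for i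
      using that vs(1,2,5) u'(1) by (cases i) (auto simp: hd_conv_nth)
    moreover have "{v, u} \<in> E" using orientation_edge[OF uv] by (simp add: insert_commute)
    ultimately have "length (u # vs) < 3"
      using vs by (intro orientation_no_long_path[of v u]) auto
    then have "length vs = 1" using vs(1) by (cases vs) auto
    then have "u' = v" using vs(2,3) by (auto simp: length_Suc_conv)
    then show False using u'v orientation_acyclic by blast
  qed
  show ?thesis
  proof
    assume "(u, v) \<in> A"
    then show "u \<in> V \<and> v \<in> V \<and> v \<sqsubset>\<^bsub>reach_poset V A\<^esub> u \<and>
        \<not> (\<exists>w\<in>V. v \<sqsubset>\<^bsub>reach_poset V A\<^esub> w \<and> w \<sqsubset>\<^bsub>reach_poset V A\<^esub> u)"
      using nobetween orientation_ends less by blast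
  next
    assume r: "u \<in> V \<and> v \<in> V \<and> v \<sqsubset>\<^bsub>reach_poset V A\<^esub> u \<and>
        \<not> (\<exists>w\<in>V. v \<sqsubset>\<^bsub>reach_poset V A\<^esub> w \<and> w \<sqsubset>\<^bsub>reach_poset V A\<^esub> u)"
    then obtain w where w: "(u, w) \<in> A" "(w, v) \<in> A\<^sup>*" using less by (meson tranclD)
    then have "w = v"
      using r less orientation_ends(2)[OF w(1)] by (metis r_into_trancl' rtranclD)
    then show "(u, v) \<in> A" using w by simp
  qed
qed

end

end

theory Submission
  imports Defs
begin

text \<open>
  The vertices of the plane graph are points of the parabola \<open>y = x\<^sup>2\<close> and the edges are
  non-crossing chords, so that every inner face is a convex polygon. The tree is grown leaf by leaf,
  one polygon per vertex: a neighbour of \<open>u\<close> is glued as a quadrilateral (an ear) below an outer edge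
  of the polygon of \<open>u\<close>, and the colour of the right end of that edge decides whether the new vertex
  lies above or below \<open>u\<close>. An ear splits each perfect matching that uses the edge into two, which is
  how the new leaf splits the ideals. Rotating the polygon of \<open>v\<close> corresponds to adding or removing
  \<open>v\<close>. Every clockwise cycle passes an edge of the lower boundary from right to left, so arcs of the
  Z-transformation digraph can only shrink the ideal. Irreducibility holds because the tree is
  connected: a product decomposition of the ideals would split it into two closed parts.
\<close>

section \<open>Ideal lattices and oriented trees\<close>

text \<open>Two choices shape the proof. First, the abscissae carry the whole combinatorics: a chord
  is a pair of reals, non-crossing means that intervals are nested or do not overlap, and
  \<open>pt x\<close> lies above or below the line through \<open>pt a\<close> and
  \<open>pt b\<close> by the sign of \<open>(x - a) * (x - b)\<close>. A vertex placed in a gap lies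
  below the chord over that gap, so convexity never has to be restored. Second, every tree vertex
  \<open>v\<close> must keep a lower boundary edge \<open>q v\<close> of its own that records
  membership of \<open>v\<close>, although arbitrarily many leaves may be attached at
  \<open>v\<close> and each ear buries the edge under which it is glued. Therefore
  \<open>q u\<close> is first subdivided into three edges. This only rewrites the perfect matchings;
  it leaves one edge as the new \<open>q u\<close> and supplies one edge that is matched exactly
  when \<open>u\<close> is in the ideal and one that is matched exactly when it is not. With the
  edges \<open>q v\<close> at hand the inner faces need not be classified: an arc of the
  Z-transformation digraph that enlarged the ideal would contradict the colours at some
  \<open>q v\<close>, whatever face its cycle bounds.\<close>

lemma order_ideals_reach_poset:
  assumes "A \<subseteq> V \<times> V"
  shows "order_ideals (reach_poset V A) = {I. I \<subseteq> V \<and> (\<forall>(x, y)\<in>A. x \<in> I \<longrightarrow> y \<in> I)}"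
proof (intro Set.set_eqI iffI)
  fix I assume "I \<in> order_ideals (reach_poset V A)"
  then show "I \<in> {I. I \<subseteq> V \<and> (\<forall>(x, y)\<in>A. x \<in> I \<longrightarrow> y \<in> I)}"
    using assms by (fastforce simp: order_ideals_def reach_poset_def)
next
  fix I assume I: "I \<in> {I. I \<subseteq> V \<and> (\<forall>(x, y)\<in>A. x \<in> I \<longrightarrow> y \<in> I)}"
  have "y \<in> I" if "(x, y) \<in> A\<^sup>*" "x \<in> I" for x y
    using that by (induction rule: rtrancl_induct) (use I in auto)
  then show "I \<in> order_ideals (reach_poset V A)"
    using I by (auto simp: order_ideals_def reach_poset_def)
qed

lemma ideal_lattice_meet_join:
  assumes "I \<in> order_ideals P" "J \<in> order_ideals P"
  shows "greatest (ideal_lattice P) (I \<inter> J) (Lower (ideal_lattice P) {I, J})"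
    and "least (ideal_lattice P) (I \<union> J) (Upper (ideal_lattice P) {I, J})"
  using assms
  by (auto simp: greatest_def least_def Lower_def Upper_def ideal_lattice_def order_ideals_def)

lemma partial_order_ideal_lattice: "partial_order (ideal_lattice P)"
  by unfold_locales (auto simp: ideal_lattice_def)

lemma lattice_ideal_lattice: "Lattice.lattice (ideal_lattice P)"
proof -
  interpret partial_order "ideal_lattice P" by (rule partial_order_ideal_lattice)
  show ?thesis
  proof
    fix I J assume "I \<in> carrier (ideal_lattice P)" "J \<in> carrier (ideal_lattice P)"
    then have "I \<in> order_ideals P" "J \<in> order_ideals P" by (auto simp: ideal_lattice_def)
    from ideal_lattice_meet_join[OF this]
    show "\<exists>s. least (ideal_lattice P) s (Upper (ideal_lattice P) {I, J})"
      "\<exists>s. greatest (ideal_lattice P) s (Lower (ideal_lattice P) {I, J})" by blast+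
  qed
qed

lemma
  assumes "I \<in> order_ideals P" "J \<in> order_ideals P"
  shows meet_ideal_lattice: "I \<sqinter>\<^bsub>ideal_lattice P\<^esub> J = I \<inter> J"
    and join_ideal_lattice: "I \<squnion>\<^bsub>ideal_lattice P\<^esub> J = I \<union> J"
proof -
  interpret partial_order "ideal_lattice P" by (rule partial_order_ideal_lattice)
  show "I \<sqinter>\<^bsub>ideal_lattice P\<^esub> J = I \<inter> J"
    unfolding meet_def inf_def
    by (rule some_equality, rule ideal_lattice_meet_join(1)[OF assms],
        rule greatest_unique[OF _ ideal_lattice_meet_join(1)[OF assms]])
  show "I \<squnion>\<^bsub>ideal_lattice P\<^esub> J = I \<union> J"
    unfolding join_def sup_def
    by (rule some_equality, rule ideal_lattice_meet_join(2)[OF assms],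
        rule least_unique[OF _ ideal_lattice_meet_join(2)[OF assms]])
qed

lemma finite_distributive_ideal_lattice:
  assumes "finite (carrier P)"
  shows "finite_distributive_lattice (ideal_lattice P)"
proof -
  have "finite (order_ideals P)"
    using assms by (rule finite_subset[rotated, OF finite_Pow_iff[THEN iffD2]])
      (auto simp: order_ideals_def)
  moreover have "{} \<in> order_ideals P" by (auto simp: order_ideals_def)
  moreover have "I \<inter> J \<in> order_ideals P" "I \<union> J \<in> order_ideals P"
    if "I \<in> order_ideals P" "J \<in> order_ideals P" for I J
    using that by (auto simp: order_ideals_def)
  moreover have "carrier (ideal_lattice P) = order_ideals P" by (simp add: ideal_lattice_def)
  ultimately show ?thesis
    unfolding finite_distributive_lattice_def
    by (auto simp: lattice_ideal_lattice meet_ideal_lattice join_ideal_lattice)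
qed

text \<open>A product decomposition yields a complemented element other than top and bottom, namely the
  tuple that is bottom in the first coordinate and top elsewhere.\<close>

lemma irreducible_ideal_lattice:
  assumes indecomposable: "\<And>I J. \<lbrakk>I \<in> order_ideals P; J \<in> order_ideals P; I \<inter> J = {};
      I \<union> J = carrier P\<rbrakk> \<Longrightarrow> I = {} \<or> J = {}"
  shows "irreducible_lattice TYPE('b) (ideal_lattice P)"
  unfolding irreducible_lattice_def
proof
  assume "\<exists>(n::nat) (K :: nat \<Rightarrow> 'b gorder). 2 \<le> n \<and>
          (\<forall>i<n. Lattice.lattice (K i) \<and> (\<exists>x\<in>carrier (K i). \<exists>y\<in>carrier (K i). x \<noteq> y)) \<and>
          order_isomorphic (ideal_lattice P) (direct_product {..<n} K)"
  then obtain n :: nat and K :: "nat \<Rightarrow> 'b gorder" and f where n: "2 \<le> n"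
    and K: "\<And>i. i < n \<Longrightarrow> Lattice.lattice (K i)"
    and nontrivial: "\<And>i. i < n \<Longrightarrow> \<exists>x\<in>carrier (K i). \<exists>y\<in>carrier (K i). x \<noteq> y"
    and bij: "bij_betw f (order_ideals P) (\<Pi>\<^sub>E i\<in>{..<n}. carrier (K i))"
    and emb: "order_emb (ideal_lattice P) (direct_product {..<n} K) f"
    by (simp add: order_isomorphic_def ideal_lattice_def direct_product_def) blast
  let ?T = "\<Pi>\<^sub>E i\<in>{..<n}. carrier (K i)"
  have le: "I \<subseteq> J \<longleftrightarrow> (\<forall>i<n. f I i \<sqsubseteq>\<^bsub>K i\<^esub> f J i)"
    if "I \<in> order_ideals P" "J \<in> order_ideals P" for I J
    using emb that by (auto simp: order_emb_def ideal_lattice_def direct_product_def)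
  have f: "f I \<in> ?T" if "I \<in> order_ideals P" for I
    using bij that by (auto simp: bij_betw_def)
  have surj: "\<exists>I\<in>order_ideals P. f I = x" if "x \<in> ?T" for x
    using bij that by (metis bij_betw_def imageE)
  have antisym: "x = y" if "i < n" "x \<sqsubseteq>\<^bsub>K i\<^esub> y" "y \<sqsubseteq>\<^bsub>K i\<^esub> x" "x \<in> carrier (K i)" "y \<in> carrier (K i)"
    for i x y
  proof -
    interpret Lattice.lattice "K i" using K that by blast
    show ?thesis using that le_antisym by blast
  qed
  have e: "{} \<in> order_ideals P" and c: "carrier P \<in> order_ideals P"
    by (auto simp: order_ideals_def)
  define b where "b = f {}"
  define t where "t = f (carrier P)"
  have b: "b \<in> ?T" and t: "t \<in> ?T" using f e c by (auto simp: b_def t_def)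
  \<comment> \<open>The factors come without bounds. The coordinates of the images of the empty and
    the full ideal provide them, because every tuple is the image of some ideal.\<close>
  have bt: "b i \<sqsubseteq>\<^bsub>K i\<^esub> x i \<and> x i \<sqsubseteq>\<^bsub>K i\<^esub> t i" if x: "x \<in> ?T" and "i < n" for x i
  proof -
    obtain I where I: "I \<in> order_ideals P" "f I = x" using surj[OF x] by blast
    then have "I \<subseteq> carrier P" by (auto simp: order_ideals_def)
    then show ?thesis using le[OF e I(1)] le[OF I(1) c] I(2) that(2) by (auto simp: b_def t_def)
  qed
  \<comment> \<open>If both bounds of a factor agreed, antisymmetry would leave it a single element.
    Changing \<open>b\<close> in coordinate \<open>i\<close> alone brings an arbitrary element of
    the factor into a tuple.\<close>
  have bti: "b i \<noteq> t i" if i: "i < n" for i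
  proof
    assume eq: "b i = t i"
    have "x = b i" if "x \<in> carrier (K i)" for x
    proof -
      have "(\<lambda>j\<in>{..<n}. if j = i then x else b j) \<in> ?T" using b that by auto
      from bt[OF this i] show ?thesis
        using eq i that PiE_mem[OF t, of i] antisym[OF i, of x "t i"] by auto
    qed
    then show False using nontrivial[OF i] by metis
  qed
  define x where "x = (\<lambda>i\<in>{..<n}. if i = 0 then b i else t i)"
  define y where "y = (\<lambda>i\<in>{..<n}. if i = 0 then t i else b i)"
  have xy: "x \<in> ?T" "y \<in> ?T" using b t by (auto simp: x_def y_def)
  then obtain I J where I: "I \<in> order_ideals P" "f I = x" and J: "J \<in> order_ideals P" "f J = y"
    using surj by meson
  have meet: "I \<inter> J \<in> order_ideals P" and join: "I \<union> J \<in> order_ideals P"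
    using I J by (auto simp: order_ideals_def)
  \<comment> \<open>In each coordinate \<open>x\<close> or \<open>y\<close> has the value of
    \<open>b\<close>, so the image of the intersection lies below \<open>b\<close>. The union is
    treated dually.\<close>
  have "f (I \<inter> J) i \<sqsubseteq>\<^bsub>K i\<^esub> b i" if "i < n" for i
    using le[OF meet I(1)] le[OF meet J(1)] I(2) J(2) that by (cases "i = 0") (auto simp: x_def y_def)
  then have "I \<inter> J = {}" using le[OF meet e] by (auto simp: b_def)
  moreover have "t i \<sqsubseteq>\<^bsub>K i\<^esub> f (I \<union> J) i" if "i < n" for i
    using le[OF I(1) join] le[OF J(1) join] I(2) J(2) that by (cases "i = 0") (auto simp: x_def y_def)
  then have "carrier P \<subseteq> I \<union> J" using le[OF c join] by (auto simp: t_def)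
  then have "I \<union> J = carrier P" using I J by (auto simp: order_ideals_def)
  ultimately have "I = {} \<or> J = {}" using indecomposable I J by blast
  moreover have "x \<noteq> b"
  proof
    assume "x = b"
    from fun_cong[OF this, of 1] show False using bti[of 1] n by (simp add: x_def)
  qed
  moreover have "y \<noteq> b"
  proof
    assume "y = b"
    from fun_cong[OF this, of 0] show False using bti[of 0] n by (simp add: y_def)
  qed
  ultimately show False using I J by (auto simp: b_def)
qed

text \<open>Trees in the form that the drawing follows by induction. The flag \<open>down\<close>
  directs the new arc towards the old tree, which puts the leaf above its neighbour in the
  order.\<close>

inductive grown_tree :: "'a set \<Rightarrow> ('a \<times> 'a) set \<Rightarrow> bool" where
  single: "grown_tree {r} {}"
| leaf: "\<lbrakk>grown_tree V A; u \<in> V; w \<notin> V\<rbrakk> \<Longrightarrow>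
    grown_tree (insert w V) (insert (if down then (w, u) else (u, w)) A)"

lemma grown_tree_arcs: "grown_tree V A \<Longrightarrow> A \<subseteq> V \<times> V"
  by (induction rule: grown_tree.induct) auto

lemma grown_tree_connected:
  assumes "grown_tree V A" "x \<in> V" "y \<in> V"
  shows "(x, y) \<in> (A \<union> A\<inverse>)\<^sup>*"
  using assms
proof (induction arbitrary: x y rule: grown_tree.induct)
  case (leaf V A u w down)
  let ?A = "insert (if down then (w, u) else (u, w)) A"
  have sub: "(A \<union> A\<inverse>)\<^sup>* \<subseteq> (?A \<union> ?A\<inverse>)\<^sup>*" by (rule rtrancl_mono) auto
  have uw: "(u, w) \<in> (?A \<union> ?A\<inverse>)\<^sup>*" "(w, u) \<in> (?A \<union> ?A\<inverse>)\<^sup>*" by (auto split: if_splits)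
  have "(u, z) \<in> (?A \<union> ?A\<inverse>)\<^sup>* \<and> (z, u) \<in> (?A \<union> ?A\<inverse>)\<^sup>*" if "z \<in> insert w V" for z
    using that leaf.IH leaf.hyps sub uw by blast
  then show ?case using leaf.prems by (meson rtrancl_trans)
qed auto

lemma distinct_path_in_field:
  assumes "\<And>i. Suc i < length vs \<Longrightarrow> (vs ! i, vs ! Suc i) \<in> R" "R \<subseteq> V \<times> V" "vs \<noteq> []" "hd vs \<in> V"
  shows "set vs \<subseteq> V"
proof
  fix x assume "x \<in> set vs"
  then obtain i where i: "i < length vs" "x = vs ! i" by (auto simp: in_set_conv_nth)
  show "x \<in> V"
  proof (cases i)
    case 0
    then show ?thesis using i assms(3,4) by (simp add: hd_conv_nth)
  next
    case (Suc j)
    then show ?thesis using i assms(1)[of j] assms(2) by auto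
  qed
qed

text \<open>A maximal vertex set whose induced orientation is grown must be everything. Otherwise an
  edge leaves it towards a vertex with only one neighbour inside, since two such neighbours would be
  joined inside and close a cycle.\<close>

lemma finite_tree_grown:
  assumes tree: "finite_tree V E" and orient: "is_orientation E A"
  shows "grown_tree V A"
proof -
  have fin: "finite V" and ne: "V \<noteq> {}"
    and edge: "\<And>e. e \<in> E \<Longrightarrow> e \<subseteq> V \<and> card e = 2"
    and conn: "\<And>u v. u \<in> V \<Longrightarrow> v \<in> V \<Longrightarrow> (u, v) \<in> {(x, y). {x, y} \<in> E}\<^sup>*"
    and nocycle: "\<And>vs. \<not> is_cycle E vs"
    using tree by (auto simp: finite_tree_def finite_graph_def)
  let ?G = "\<lambda>S. S \<subseteq> V \<and> grown_tree S (A \<inter> S \<times> S)"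
  obtain r where r: "r \<in> V" using ne by blast
  have "(r, r) \<notin> A" using orientation_ends(3)[OF tree orient] by blast
  then have "A \<inter> {r} \<times> {r} = {}" by blast
  then have base: "?G {r}" using r grown_tree.single by fastforce
  have "finite {S. ?G S}" using fin by (rule finite_subset[rotated, OF finite_Pow_iff[THEN iffD2]]) auto
  then have "\<exists>S\<in>{S. ?G S}. \<forall>S'\<in>{S. ?G S}. S \<subseteq> S' \<longrightarrow> S = S'"
    using base by (intro finite_has_maximal) auto
  then obtain S where "S \<in> {S. ?G S}" and max': "\<forall>S'\<in>{S. ?G S}. S \<subseteq> S' \<longrightarrow> S = S'" by (elim bexE)
  then have S: "?G S" by blast
  have max: "S' = S" if "?G S'" "S \<subseteq> S'" for S'
    using max'[THEN bspec, of S'] that by simp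
  have "S \<noteq> {}" using S by (auto elim: grown_tree.cases)
  have "S = V"
  proof (rule ccontr)
    assume "S \<noteq> V"
    then obtain s v where sv: "s \<in> S" "v \<in> V - S" using S \<open>S \<noteq> {}\<close> by blast
    then have "(s, v) \<in> {(x, y). {x, y} \<in> E}\<^sup>*" using conn S by blast
    moreover have "\<exists>u\<in>S. \<exists>w. w \<notin> S \<and> {u, w} \<in> E" if "(s, x) \<in> {(x, y). {x, y} \<in> E}\<^sup>*" "x \<notin> S" for x
      using that by (induction rule: rtrancl_induct) (use sv in auto)
    ultimately obtain u w where uw: "u \<in> S" "w \<notin> S" "{u, w} \<in> E" using sv by blast
    have w: "w \<in> V" using edge uw by blast
    have unique: "u' = u" if "u' \<in> S" "{u', w} \<in> E" for u'
    proof (rule ccontr)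
      assume neq: "u' \<noteq> u"
      let ?A = "A \<inter> S \<times> S"
      have "(u, u') \<in> (?A \<union> ?A\<inverse>)\<^sup>*" using grown_tree_connected S uw that by metis
      from rtrancl_distinct_path[OF this] obtain vs where vs: "vs \<noteq> []" "hd vs = u"
        "last vs = u'" "distinct vs"
        "\<And>i. Suc i < length vs \<Longrightarrow> (vs ! i, vs ! Suc i) \<in> ?A \<union> ?A\<inverse>" by blast
      have inS: "set vs \<subseteq> S"
        using distinct_path_in_field[of vs "?A \<union> ?A\<inverse>" S] vs uw by blast
      have len: "2 \<le> length vs" using neq vs(1-3) by (cases vs; cases "tl vs") auto
      have "is_cycle E (w # vs)"
      proof (rule is_cycleI_path)
        fix i assume i: "Suc i < length (w # vs)"
        show "{(w # vs) ! i, (w # vs) ! Suc i} \<in> E"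
        proof (cases i)
          case 0
          then show ?thesis using uw(3) vs(1,2) by (simp add: hd_conv_nth insert_commute)
        next
          case (Suc j)
          then have "(vs ! j, vs ! Suc j) \<in> A \<union> A\<inverse>" using vs(5)[of j] i by auto
          then show ?thesis using Suc orientation_edge[OF tree orient]
            by (metis UnE converseD insert_commute nth_Cons_Suc)
        qed
      qed (use len vs inS uw that in auto)
      then show False using nocycle by blast
    qed
    let ?down = "(w, u) \<in> A"
    have ww: "(w, w) \<notin> A" using orientation_ends(3)[OF tree orient] by blast
    have xor: "((u, w) \<in> A) \<noteq> ((w, u) \<in> A)" using orient uw(3) by (auto simp: is_orientation_def)
    \<comment> \<open>Uniqueness of the neighbour means that the enlarged set gains exactly one
      arc.\<close>
    have "A \<inter> insert w S \<times> insert w S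
        = insert (if ?down then (w, u) else (u, w)) (A \<inter> S \<times> S)" (is "?L = ?R")
    proof (intro equalityI subsetI)
      fix a assume a: "a \<in> ?L"
      obtain x y where xy: "a = (x, y)" by fastforce
      have "{x, y} \<in> E" using a xy orientation_edge[OF tree orient] by blast
      then show "a \<in> ?R"
        using a xy ww xor unique[of x] unique[of y] by (auto simp: insert_commute)
    next
      fix a assume "a \<in> ?R"
      then show "a \<in> ?L" using xor uw by (auto split: if_splits)
    qed
    then have "?G (insert w S)" using grown_tree.leaf[of S "A \<inter> S \<times> S" u w ?down] S uw w by auto
    from max[OF this] show False using uw by blast
  qed
  moreover have "A \<inter> V \<times> V = A" using orientation_ends(1,2)[OF tree orient] by auto
  ultimately show ?thesis using S by simp
qed

text \<open>No arc joins two complementary closed sets in either direction, so connectedness puts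
  all vertices into one of them.\<close>

lemma irreducible_ideal_lattice_grown_tree:
  assumes "grown_tree V A"
  shows "irreducible_lattice TYPE('b) (ideal_lattice (reach_poset V A))"
proof (rule irreducible_ideal_lattice)
  fix I J
  assume "I \<in> order_ideals (reach_poset V A)" "J \<in> order_ideals (reach_poset V A)"
    and disj: "I \<inter> J = {}" and "I \<union> J = carrier (reach_poset V A)"
  then have un: "I \<union> J = V" and I: "\<forall>(x, y)\<in>A. x \<in> I \<longrightarrow> y \<in> I" and J: "\<forall>(x, y)\<in>A. x \<in> J \<longrightarrow> y \<in> J"
    using order_ideals_reach_poset[OF grown_tree_arcs[OF assms]] by (auto simp: reach_poset_def)
  show "I = {} \<or> J = {}"
  proof (rule ccontr)
    assume "\<not> ?thesis"
    then obtain x y where xy: "x \<in> I" "y \<in> J" by blast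
    have step: "z' \<in> I" if "z \<in> I" "(z, z') \<in> A \<union> A\<inverse>" for z z'
      using that I J un disj grown_tree_arcs[OF assms] by fastforce
    have "(x, y) \<in> (A \<union> A\<inverse>)\<^sup>*" using grown_tree_connected[OF assms] xy un by blast
    then have "y \<in> I" by (induction rule: rtrancl_induct) (use xy step in blast)+
    then show False using xy disj by blast
  qed
qed

section \<open>Closed polygonal curves\<close>

text \<open>A parametrisation with the breakpoints of \<open>clockwise\<close>. Only the image of
  each piece is prescribed and not its speed, because \<open>clockwise\<close> asks for no
  more.\<close>

definition polygonal :: "(nat \<Rightarrow> complex) \<Rightarrow> nat \<Rightarrow> (real \<Rightarrow> complex) \<Rightarrow> (nat \<Rightarrow> real) \<Rightarrow> bool" where
  "polygonal f n p t \<longleftrightarrow> path p \<and> t 0 = 0 \<and> t n = 1 \<and> p 1 = f n \<and>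
     (\<forall>i<n. t i < t (Suc i) \<and> p (t i) = f i \<and> p ` {t i..t (Suc i)} = closed_segment (f i) (f (Suc i)))"

lemma polygonalD:
  assumes "polygonal f n p t"
  shows "path p" "t 0 = 0" "t n = 1" "p 1 = f n" "0 < n"
    and "i < n \<Longrightarrow> t i < t (Suc i)" "i < n \<Longrightarrow> p (t i) = f i"
    and "i < n \<Longrightarrow> p ` {t i..t (Suc i)} = closed_segment (f i) (f (Suc i))"
  using assms by (auto simp: polygonal_def intro: Nat.gr0I)

lemma polygonal_times:
  assumes "polygonal f n p t" "i \<le> n"
  shows "0 \<le> t i" "t i \<le> 1"
proof -
  have mono: "t i \<le> t j" if "i \<le> j" "j \<le> n" for i j
    using that
  proof (induction j)
    case (Suc j)
    then show ?case using polygonalD(6)[OF assms(1), of j] by (cases "i = Suc j") auto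
  qed simp
  show "0 \<le> t i" "t i \<le> 1" using mono[of 0 i] mono[of i n] assms by (auto simp: polygonal_def)
qed

lemma polygonal_path_image:
  assumes "polygonal f n p t"
  shows "path_image p = (\<Union>i<n. closed_segment (f i) (f (Suc i)))"
proof -
  \<comment> \<open>For \<open>k = 0\<close> the union is empty; the extra point \<open>0\<close>
    makes the induction start.\<close>
  have "(\<Union>i<k. {t i..t (Suc i)}) \<union> {0} = {0..t k}" if "k \<le> n" for k
    using that
  proof (induction k)
    case 0
    then show ?case using assms by (auto simp: polygonal_def)
  next
    case (Suc k)
    then have "t k < t (Suc k)" using assms by (auto simp: polygonal_def)
    moreover have "0 \<le> t k" using polygonal_times[OF assms, of k] Suc by simp
    ultimately have "{0..t (Suc k)} = {0..t k} \<union> {t k..t (Suc k)}" by auto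
    then show ?case using Suc by (auto simp: lessThan_Suc)
  qed
  from this[of n] have "(\<Union>i<n. {t i..t (Suc i)}) \<union> {0} = {0..1}"
    using assms by (auto simp: polygonal_def)
  moreover have "0 \<in> (\<Union>i<n. {t i..t (Suc i)})"
    using polygonalD(2,5)[OF assms] polygonalD(6)[OF assms, of 0] by (intro UN_I[of 0]) auto
  ultimately have "(\<Union>i<n. {t i..t (Suc i)}) = {0..1}" by blast
  then have "path_image p = (\<Union>i<n. p ` {t i..t (Suc i)})"
    unfolding path_image_def by (metis image_UN)
  also have "\<dots> = (\<Union>i<n. closed_segment (f i) (f (Suc i)))"
    using assms by (auto simp: polygonal_def)
  finally show ?thesis .
qed

text \<open>A piece may run back and forth on its segment, but it stays in this convex set, which
  misses \<open>z\<close>. Hence it is homotopic off \<open>z\<close> to the straight path with the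
  same ends.\<close>

lemma winding_number_polygonal:
  assumes p: "polygonal f n p t" and z: "z \<notin> path_image p"
  shows "winding_number p z = (\<Sum>i<n. winding_number (linepath (f i) (f (Suc i))) z)"
proof -
  have path: "path p" using p by (simp add: polygonal_def)
  have pt: "p (t i) = f i" if "i \<le> n" for i
    using that p by (cases "i = n") (auto simp: polygonal_def)
  have piece: "winding_number (subpath (t i) (t (Suc i)) p) z = winding_number (linepath (f i) (f (Suc i))) z"
    if i: "i < n" for i
  proof (rule winding_number_homotopic_paths, rule homotopic_paths_linear)
    have im: "path_image (subpath (t i) (t (Suc i)) p) = closed_segment (f i) (f (Suc i))"
      using polygonalD(6,8)[OF p i] by (simp add: path_image_subpath)
    have zi: "z \<notin> closed_segment (f i) (f (Suc i))"
      using z i polygonal_path_image[OF p] by blast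
    show "path (subpath (t i) (t (Suc i)) p)"
      using path polygonal_times[OF p, of i] polygonal_times[OF p, of "Suc i"] i by (intro path_subpath) auto
    show "closed_segment (subpath (t i) (t (Suc i)) p s) (linepath (f i) (f (Suc i)) s) \<subseteq> - {z}"
      if "s \<in> {0..1}" for s
    proof -
      have "subpath (t i) (t (Suc i)) p s \<in> closed_segment (f i) (f (Suc i))"
        using im that by (auto simp: path_image_def)
      moreover have "linepath (f i) (f (Suc i)) s \<in> closed_segment (f i) (f (Suc i))"
        using that by (metis imageI path_image_def path_image_linepath)
      ultimately have "closed_segment (subpath (t i) (t (Suc i)) p s) (linepath (f i) (f (Suc i)) s)
          \<subseteq> closed_segment (f i) (f (Suc i))"
        by (intro closed_segment_subset) auto
      then show ?thesis using zi by blast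
    qed
  qed (use pt i in auto)
  have "winding_number (subpath 0 (t k) p) z = (\<Sum>i<k. winding_number (linepath (f i) (f (Suc i))) z)"
    if "k \<le> n" for k
    using that
  proof (induction k)
    case 0
    have "t 0 = 0" using p by (simp add: polygonal_def)
    moreover have "z \<noteq> p 0" using z path_image_def by fastforce
    ultimately show ?case by (simp add: winding_number_subpath_trivial)
  next
    case (Suc k)
    have "winding_number (subpath 0 (t k) p) z + winding_number (subpath (t k) (t (Suc k)) p) z
        = winding_number (subpath 0 (t (Suc k)) p) z"
      using Suc polygonal_times[OF p, of k] polygonal_times[OF p, of "Suc k"]
      by (intro winding_number_subpath_combine path z) auto
    then show ?case using Suc piece[of k] by simp
  qed
  from this[of n] show ?thesis using p by (simp add: polygonal_def)
qed

lemma polygonal_extend: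
  assumes p: "polygonal f n p t"
  shows "\<exists>t'. polygonal f (Suc n) (p +++ linepath (f n) (f (Suc n))) t'"
proof -
  let ?l = "linepath (f n) (f (Suc n))"
  \<comment> \<open>Joining runs the old path on the first half of the unit interval, so its times
    are halved; the new segment takes the second half.\<close>
  let ?t = "\<lambda>i. if i \<le> n then t i / 2 else (1::real)"
  have t1: "t n = 1" using p by (auto simp: polygonal_def)
  have "pathfinish p = f n" using p by (simp add: polygonal_def pathfinish_def)
  then have "path (p +++ ?l)" using p by (simp add: polygonal_def)
  moreover have "?t i < ?t (Suc i) \<and> (p +++ ?l) (?t i) = f i \<and>
      (p +++ ?l) ` {?t i..?t (Suc i)} = closed_segment (f i) (f (Suc i))" if i: "i < Suc n" for i
  proof (cases "i = n")
    case True
    have "(p +++ ?l) s = ?l (2 * s - 1)" if "s \<in> {1/2..1}" for s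
    proof (cases "s = 1/2")
      case True
      show ?thesis unfolding True using polygonalD(4)[OF p] by (simp add: joinpaths_def linepath_def)
    qed (use that in \<open>auto simp: joinpaths_def\<close>)
    then have "(p +++ ?l) ` {1/2..1} = ?l ` (\<lambda>s. 2 * s - 1) ` {1/2..1}"
      unfolding image_image by (rule image_cong[OF refl])
    also have "(\<lambda>s. 2 * s - 1) ` {1/2..1::real} = {0..1}"
      using image_affinity_atLeastAtMost[of "2::real" "-1" "1/2" 1] by simp
    finally have "(p +++ ?l) ` {1/2..1} = closed_segment (f n) (f (Suc n))"
      by (simp add: linepath_image_01)
    moreover have "(p +++ ?l) (1/2) = f n" using p by (auto simp: joinpaths_def polygonal_def)
    ultimately show ?thesis using True t1 by simp
  next
    case False
    then have i: "i < n" using that by simp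
    have le: "t (Suc i) \<le> 1" using polygonal_times[OF p, of "Suc i"] i by simp
    have tt: "t i < t (Suc i)" "p (t i) = f i" using p i by (auto simp: polygonal_def)
    have "(p +++ ?l) s = p (2 * s)" if "s \<in> {t i / 2..t (Suc i) / 2}" for s
      using that le by (auto simp: joinpaths_def)
    then have "(p +++ ?l) ` {t i / 2..t (Suc i) / 2} = p ` (\<lambda>s. 2 * s) ` {t i / 2..t (Suc i) / 2}"
      unfolding image_image by (rule image_cong[OF refl])
    also have "(\<lambda>s. 2 * s) ` {t i / 2..t (Suc i) / 2} = {t i..t (Suc i)}"
      using tt by (simp add: image_mult_atLeastAtMost)
    also have "p ` {t i..t (Suc i)} = closed_segment (f i) (f (Suc i))"
      using p i by (simp add: polygonal_def)
    finally show ?thesis using i tt le by (simp add: joinpaths_def)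
  qed
  moreover have "?t 0 = 0" "?t (Suc n) = 1" using p by (auto simp: polygonal_def)
  moreover have "(p +++ ?l) 1 = f (Suc n)" by (simp add: joinpaths_def linepath_def)
  ultimately have "polygonal f (Suc n) (p +++ ?l) ?t" unfolding polygonal_def by blast
  then show ?thesis by blast
qed

lemma polygonal_arc_exists:
  assumes "0 < n" "inj_on f {..n}"
    and "\<And>i j. i < j \<Longrightarrow> j < n \<Longrightarrow>
      closed_segment (f i) (f (Suc i)) \<inter> closed_segment (f j) (f (Suc j)) \<subseteq> {f j}"
  shows "\<exists>p t. arc p \<and> polygonal f n p t"
  using assms
proof (induction n)
  case (Suc n)
  show ?case
  proof (cases "n = 0")
    case True
    have "f 0 \<noteq> f 1" using Suc.prems(2) True by (auto simp: inj_on_def)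
    moreover have "polygonal f 1 (linepath (f 0) (f 1)) real"
      unfolding polygonal_def by (auto simp: linepath_image_01 linepath_0' linepath_1')
    ultimately show ?thesis using True by (metis One_nat_def arc_linepath)
  next
    case False
    have "inj_on f {..n}" using Suc.prems(2) by (rule inj_on_subset) auto
    then obtain p t where p: "arc p" "polygonal f n p t"
      using Suc.IH Suc.prems False by (metis gr0I less_SucI)
    let ?l = "linepath (f n) (f (Suc n))"
    have "f n \<noteq> f (Suc n)" using inj_onD[OF Suc.prems(2), of n "Suc n"] by auto
    then have "arc ?l" by simp
    moreover have "path_image p \<inter> path_image ?l \<subseteq> {f n}"
      using Suc.prems(3)[of _ n] polygonal_path_image[OF p(2)] by fastforce
    moreover have "pathfinish p = f n" using p(2) by (simp add: polygonal_def pathfinish_def)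
    ultimately have "arc (p +++ ?l)" using p(1) by (intro arc_join) auto
    then show ?thesis using polygonal_extend[OF p(2)] by blast
  qed
qed simp

text \<open>All segments but the last form an arc, which the last one closes. For the arc,
  distinctness of the vertices shrinks the common ends of two segments to
  \<open>f j\<close>.\<close>

lemma polygonal_loop_exists:
  assumes n: "2 \<le> n" and inj: "inj_on f {..<n}" and closed: "f n = f 0"
    and seg: "\<And>i j. i < j \<Longrightarrow> j < n \<Longrightarrow>
      closed_segment (f i) (f (Suc i)) \<inter> closed_segment (f j) (f (Suc j))
        \<subseteq> {f i, f (Suc i)} \<inter> {f j, f (Suc j)}"
  shows "\<exists>p t. simple_path p \<and> pathfinish p = pathstart p \<and> polygonal f n p t"
proof -
  obtain m where m: "n = Suc m" "0 < m" using n by (cases n) auto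
  have neq: "f i \<noteq> f j" if "i < n" "j < n" "i \<noteq> j" for i j
    using inj that by (auto simp: inj_on_def)
  have "\<exists>p t. arc p \<and> polygonal f m p t"
  proof (rule polygonal_arc_exists[OF m(2)])
    show "inj_on f {..m}" using inj m(1) by (simp add: lessThan_Suc_atMost)
    fix i j assume "i < j" "j < m"
    then show "closed_segment (f i) (f (Suc i)) \<inter> closed_segment (f j) (f (Suc j)) \<subseteq> {f j}"
      using seg[of i j] neq[of i "Suc j"] neq[of "Suc i" "Suc j"] m(1) by auto
  qed
  then obtain p t where p: "arc p" "polygonal f m p t" by blast
  let ?l = "linepath (f m) (f (Suc m))"
  have ends: "pathfinish p = f m" "pathstart p = f 0"
    using polygonalD(2,4)[OF p(2)] polygonalD(7)[OF p(2) m(2)] by (auto simp: pathfinish_def pathstart_def)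
  have "f m \<noteq> f (Suc m)" using neq[of m 0] m closed by simp
  then have "arc ?l" by simp
  moreover have "path_image p \<inter> path_image ?l \<subseteq> {f 0, f m}"
    using seg[of _ m] m closed polygonal_path_image[OF p(2)] by fastforce
  ultimately have "simple_path (p +++ ?l)" using p(1) ends m(1) closed
    by (intro simple_path_join_loop) auto
  moreover have "pathfinish (p +++ ?l) = pathstart (p +++ ?l)" using ends m(1) closed by simp
  ultimately show ?thesis using polygonal_extend[OF p(2)] m(1) by blast
qed

text \<open>The index modulo the length makes the list a closed sequence, so
  \<open>polygonal\<close> asks that the curve end at the first vertex; \<open>clockwise\<close>
  says this through \<open>pathfinish\<close>, and \<open>p1\<close> mediates.\<close>

lemma clockwise_iff_polygonal:
  assumes "vs \<noteq> []"
  shows "clockwise (\<lambda>e. convex hull e) vs \<longleftrightarrow>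
    (\<exists>p t. simple_path p \<and> pathfinish p = pathstart p \<and>
       polygonal (\<lambda>i. vs ! (i mod length vs)) (length vs) p t \<and>
       (\<forall>z\<in>inside (path_image p). winding_number p z = -1))"
proof -
  have hull: "convex hull (cyc_edge vs i) =
      closed_segment (vs ! (i mod length vs)) (vs ! (Suc i mod length vs))" for i
    by (simp add: cyc_edge_def segment_convex_hull)
  have p1: "p 1 = vs ! 0" if "pathfinish p = pathstart p" "t 0 = 0"
      "\<forall>i<length vs. t i < t (Suc i) \<and> p (t i) = vs ! i \<and> p ` {t i..t (Suc i)} = S i"
    for p :: "real \<Rightarrow> complex" and t :: "nat \<Rightarrow> real" and S
    using that assms by (auto simp: pathfinish_def pathstart_def)
  have "(simple_path p \<and> pathfinish p = pathstart p \<and> t 0 = 0 \<and> t (length vs) = 1 \<and>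
        (\<forall>i<length vs. t i < t (Suc i) \<and> p (t i) = vs ! i \<and>
           p ` {t i..t (Suc i)} = convex hull (cyc_edge vs i)) \<and> R)
      = (simple_path p \<and> pathfinish p = pathstart p \<and>
         polygonal (\<lambda>i. vs ! (i mod length vs)) (length vs) p t \<and> R)"
    for p and t :: "nat \<Rightarrow> real" and R
    unfolding polygonal_def mod_self hull
    by (intro iffI conjI; elim conjE; (assumption | rule simple_path_imp_path | rule p1 | simp))
  then show ?thesis unfolding clockwise_def by presburger
qed

section \<open>Straight-line drawings on a parabola\<close>

text \<open>A repeated edge would make \<open>i\<close> and \<open>j\<close> cyclic successors of
  each other, which happens only for length two.\<close>

lemma cyc_edge_inj:
  assumes "distinct vs" "3 \<le> length vs"
  shows "inj_on (cyc_edge vs) {..<length vs}"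
proof -
  let ?n = "length vs"
  have neq: "cyc_edge vs i \<noteq> cyc_edge vs j" if ij: "i < j" "j < ?n" for i j
  proof
    assume "cyc_edge vs i = cyc_edge vs j"
    moreover have idx: "vs ! k = vs ! l \<longleftrightarrow> k = l" if "k < ?n" "l < ?n" for k l
      using assms that by (simp add: nth_eq_iff_index_eq)
    moreover have "Suc i mod ?n = Suc i" using ij by simp
    moreover have "Suc j mod ?n < ?n" using ij by (intro mod_less_divisor) linarith
    ultimately have "i = Suc j mod ?n" "Suc i = j"
      using ij by (auto simp: cyc_edge_def doubleton_eq_iff)
    then show False using ij assms by (cases "Suc j = ?n") auto
  qed
  show ?thesis
  proof (rule inj_onI)
    fix i j assume "i \<in> {..<?n}" "j \<in> {..<?n}" "cyc_edge vs i = cyc_edge vs j"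
    then show "i = j" using neq[of i j] neq[of j i] by (cases i j rule: linorder_cases) auto
  qed
qed

lemma plane_graph_meet_at_ends:
  "\<lbrakk>plane_graph V E D; e \<in> E; e' \<in> E; e \<noteq> e'\<rbrakk> \<Longrightarrow> D e \<inter> D e' \<subseteq> e \<inter> e'"
  unfolding plane_graph_def by blast

text \<open>Distinct edges of a plane graph meet only in shared ends, which is what makes the closed
  polygon of a cycle a simple curve.\<close>

lemma straight_plane_cycle_curve:
  assumes plane: "plane_graph V E (\<lambda>e. convex hull e)" and cycle: "is_cycle E vs"
  shows "\<exists>p t. simple_path p \<and> pathfinish p = pathstart p \<and>
    polygonal (\<lambda>i. vs ! (i mod length vs)) (length vs) p t"
proof (rule polygonal_loop_exists)
  let ?n = "length vs"
  have dist: "distinct vs" and n: "3 \<le> ?n" and E: "cyc_edges vs \<subseteq> E"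
    using cycle by (auto simp: is_cycle_def)
  show "2 \<le> ?n" using n by simp
  show "inj_on (\<lambda>i. vs ! (i mod ?n)) {..<?n}" using dist by (auto simp: inj_on_def nth_eq_iff_index_eq)
  fix i j assume ij: "i < j" "j < ?n"
  then have "cyc_edge vs i \<in> E" "cyc_edge vs j \<in> E" "cyc_edge vs i \<noteq> cyc_edge vs j"
    using E inj_onD[OF cyc_edge_inj[OF dist n], of i j] by (auto simp: cyc_edges_def)
  then have "convex hull (cyc_edge vs i) \<inter> convex hull (cyc_edge vs j) \<subseteq> cyc_edge vs i \<inter> cyc_edge vs j"
    by (rule plane_graph_meet_at_ends[OF plane])
  then show "closed_segment (vs ! (i mod ?n)) (vs ! (Suc i mod ?n)) \<inter>
      closed_segment (vs ! (j mod ?n)) (vs ! (Suc j mod ?n))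
      \<subseteq> {vs ! (i mod ?n), vs ! (Suc i mod ?n)} \<inter> {vs ! (j mod ?n), vs ! (Suc j mod ?n)}"
    by (simp add: cyc_edge_def segment_convex_hull)
qed simp

lemma path_image_polygonal_cycle:
  assumes "polygonal (\<lambda>i. vs ! (i mod length vs)) (length vs) p t"
  shows "path_image p = \<Union> ((\<lambda>e. convex hull e) ` cyc_edges vs)"
  unfolding polygonal_path_image[OF assms] cyc_edges_def
  by (simp add: cyc_edge_def segment_convex_hull)

section \<open>Points and chords of the parabola\<close>

definition pt :: "real \<Rightarrow> complex" where
  "pt x = Complex x (x\<^sup>2)"

definition ed :: "real \<times> real \<Rightarrow> complex set" where
  "ed e = {pt (fst e), pt (snd e)}"

text \<open>The height of a point above the line through \<open>pt a\<close> and \<open>pt b\<close>.\<close>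

definition lev :: "real \<Rightarrow> real \<Rightarrow> complex \<Rightarrow> real" where
  "lev a b z = Im z - (a + b) * Re z + a * b"

lemma pt_eq_iff [simp]: "pt x = pt y \<longleftrightarrow> x = y"
  by (auto simp: pt_def)

lemma Re_pt [simp]: "Re (pt x) = x" and Im_pt [simp]: "Im (pt x) = x\<^sup>2" by (auto simp: pt_def)

text \<open>All questions about sides reduce to this product: on the parabola the line is met
  exactly at \<open>a\<close> and \<open>b\<close>, and the points between them lie below
  it.\<close>

lemma lev_pt: "lev a b (pt x) = (x - a) * (x - b)"
  by (simp add: lev_def pt_def power2_eq_square algebra_simps)

lemma lev_commute: "lev a b z = lev b a z"
  by (simp add: lev_def algebra_simps)

lemma lev_inner: "lev a b z = Complex (- (a + b)) 1 \<bullet> z + a * b"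
  by (simp add: lev_def inner_complex_def algebra_simps)

lemma Complex_normal_nonzero: "Complex x 1 \<noteq> 0" by (simp add: complex_eq_iff)

lemma lev_ge_halfspace: "{z. 0 \<le> lev a b z} = {z. - (a * b) \<le> Complex (- (a + b)) 1 \<bullet> z}"
  by (auto simp: lev_inner)

lemma lev_le_halfspace: "{z. lev a b z \<le> 0} = {z. Complex (- (a + b)) 1 \<bullet> z \<le> - (a * b)}"
  by (auto simp: lev_inner)

lemma convex_lev_ge: "convex {z. 0 \<le> lev a b z}"
  unfolding lev_ge_halfspace by (rule convex_halfspace_ge)

lemma convex_lev_le: "convex {z. lev a b z \<le> 0}"
  unfolding lev_le_halfspace by (rule convex_halfspace_le)

lemma interior_lev_ge: "interior {z. 0 \<le> lev a b z} = {z. 0 < lev a b z}"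
  unfolding lev_ge_halfspace interior_halfspace_ge[OF Complex_normal_nonzero]
  by (auto simp: lev_inner)

lemma interior_lev_le: "interior {z. lev a b z \<le> 0} = {z. lev a b z < 0}"
  unfolding lev_le_halfspace interior_halfspace_le[OF Complex_normal_nonzero]
  by (auto simp: lev_inner)

text \<open>A point off a convex set can escape to infinity without meeting it, so it is outside.
  Openness of the inside improves the set to its interior.\<close>

lemma inside_subset_interior_convex:
  fixes S T :: "complex set"
  assumes "convex T" "S \<subseteq> T" "open (inside S)"
  shows "inside S \<subseteq> interior T"
proof (rule interior_maximal[OF _ assms(3)], rule subsetI, rule ccontr)
  fix z assume "z \<in> inside S" "z \<notin> T"
  then have "z \<in> outside S" using convex_in_outside[OF assms(1)] outside_mono[OF assms(2)] by blast
  then show False using \<open>z \<in> inside S\<close> inside_Int_outside[of S] by blast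
qed

lemma lev_zero_on_segment:
  assumes "z \<in> closed_segment (pt a) (pt b)"
  shows "lev a b z = 0"
proof -
  have "closed_segment (pt a) (pt b) \<subseteq> {z. 0 \<le> lev a b z} \<inter> {z. lev a b z \<le> 0}"
    by (intro closed_segment_subset convex_Int convex_lev_ge convex_lev_le) (auto simp: lev_pt)
  then show ?thesis using assms by force
qed

text \<open>The cross product that decides the turning direction around \<open>z\<close> is the
  signed width of the chord times the height of \<open>z\<close>.\<close>

lemma winding_number_chord_pos:
  assumes "0 < (b - a) * lev a b z"
  shows "0 < Re (winding_number (linepath (pt a) (pt b)) z)"
proof (rule winding_number_linepath_pos_lt)
  have "Im ((pt b - pt a) * cnj (pt b - z)) = (b - a) * lev a b z"
    by (simp add: pt_def lev_def power2_eq_square algebra_simps)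
  then show "0 < Im ((pt b - pt a) * cnj (pt b - z))" using assms by simp
qed

lemma winding_number_chord_neg:
  assumes "(b - a) * lev a b z < 0"
  shows "Re (winding_number (linepath (pt a) (pt b)) z) < 0"
proof -
  have "0 < (a - b) * lev b a z" using assms lev_commute[of a b z]
    by (metis minus_diff_eq mult_minus_left neg_0_less_iff_less)
  then have "0 < Re (winding_number (linepath (pt b) (pt a)) z)" by (rule winding_number_chord_pos)
  moreover have "z \<notin> path_image (linepath (pt b) (pt a))"
    using assms lev_zero_on_segment[of z b a] lev_commute[of a b z] by auto
  then have "winding_number (reversepath (linepath (pt b) (pt a))) z = - winding_number (linepath (pt b) (pt a)) z"
    by (intro winding_number_reversepath) auto
  ultimately show ?thesis by simp
qed

section \<open>Convex polygons over finite sets of abscissae\<close>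

definition consec :: "real set \<Rightarrow> (real \<times> real) set" where
  "consec Q = {(a, b). a \<in> Q \<and> b \<in> Q \<and> a < b \<and> (\<forall>c\<in>Q. c \<le> a \<or> b \<le> c)}"

text \<open>For three or more points these are the sides of the convex hull: the lower chain and the
  chord that closes it on top.\<close>

definition polygon_edges :: "real set \<Rightarrow> (real \<times> real) set" where
  "polygon_edges Q = insert (Min Q, Max Q) (consec Q)"

text \<open>Read cyclically, this order is clockwise: leftwards along the lower chain, then back to
  the right along the top chord.\<close>

definition descending :: "real set \<Rightarrow> real list" where
  "descending Q = rev (sorted_list_of_set Q)"

lemma
  assumes "finite Q"
  shows set_descending: "set (descending Q) = Q"
    and length_descending: "length (descending Q) = card Q"
    and distinct_descending: "distinct (descending Q)"
    and nth_descending_less: "\<And>i j. \<lbrakk>i < j; j < card Q\<rbrakk> \<Longrightarrow> descending Q ! j < descending Q ! i"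
proof -
  show "set (descending Q) = Q" "length (descending Q) = card Q" "distinct (descending Q)"
    using assms by (auto simp: descending_def)
  fix i j assume "i < j" "j < card Q"
  moreover have "sorted_wrt (<) (sorted_list_of_set Q)"
    by (rule strict_sorted_list_of_set)
  ultimately show "descending Q ! j < descending Q ! i"
    using assms by (auto simp: descending_def rev_nth sorted_wrt_iff_nth_less)
qed

lemma descending_consec:
  assumes "finite Q"
  shows "Suc i < card Q \<Longrightarrow> (descending Q ! Suc i, descending Q ! i) \<in> consec Q"
    and "(a, b) \<in> consec Q \<Longrightarrow> \<exists>i. Suc i < card Q \<and> descending Q ! i = b \<and> descending Q ! Suc i = a"
proof -
  let ?xs = "descending Q"
  have mem: "c \<in> Q \<longleftrightarrow> (\<exists>k<card Q. ?xs ! k = c)" for c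
    using set_descending[OF assms] length_descending[OF assms] by (metis in_set_conv_nth)
  have le: "?xs ! j \<le> ?xs ! i" if "i \<le> j" "j < card Q" for i j
    using nth_descending_less[OF assms, of i j] that by (cases "i = j") auto
  show "(?xs ! Suc i, ?xs ! i) \<in> consec Q" if i: "Suc i < card Q"
  proof -
    have "c \<le> ?xs ! Suc i \<or> ?xs ! i \<le> c" if "c \<in> Q" for c
    proof -
      obtain k where k: "k < card Q" "?xs ! k = c" using mem \<open>c \<in> Q\<close> by blast
      then show ?thesis using le[of k i] le[of "Suc i" k] i by (cases "k \<le> i") auto
    qed
    moreover have "?xs ! i \<in> Q" "?xs ! Suc i \<in> Q" using i mem Suc_lessD by blast+
    ultimately show ?thesis using i nth_descending_less[OF assms, of i "Suc i"]
      by (auto simp: consec_def)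
  qed
  assume ab: "(a, b) \<in> consec Q"
  then obtain i j where ij: "i < card Q" "?xs ! i = b" "j < card Q" "?xs ! j = a"
    using mem unfolding consec_def by blast
  have lt: "a < b" using ab by (auto simp: consec_def)
  then have "i < j" using ij le[of j i] by (cases "i < j") auto
  moreover have "\<not> Suc i < j"
  proof
    assume "Suc i < j"
    moreover from this have "Suc i < card Q" using ij by simp
    ultimately have "?xs ! Suc i \<in> Q" "?xs ! j < ?xs ! Suc i" "?xs ! Suc i < ?xs ! i"
      using mem ij nth_descending_less[OF assms, of "Suc i" j] nth_descending_less[OF assms, of i "Suc i"]
      by blast+
    then show False using ab ij by (auto simp: consec_def)
  qed
  ultimately have "j = Suc i" by simp
  then show "\<exists>i. Suc i < card Q \<and> ?xs ! i = b \<and> ?xs ! Suc i = a" using ij by blast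
qed

lemma descending_ends:
  assumes "finite Q" "Q \<noteq> {}"
  shows "descending Q ! 0 = Max Q" "descending Q ! (card Q - 1) = Min Q"
proof -
  let ?xs = "descending Q"
  have mem: "c \<in> Q \<longleftrightarrow> (\<exists>k<card Q. ?xs ! k = c)" for c
    using set_descending[OF assms(1)] length_descending[OF assms(1)] by (metis in_set_conv_nth)
  have le: "?xs ! j \<le> ?xs ! i" if "i \<le> j" "j < card Q" for i j
    using nth_descending_less[OF assms(1), of i j] that by (cases "i = j") auto
  have card: "0 < card Q" using assms by (simp add: card_gt_0_iff)
  show "?xs ! 0 = Max Q"
  proof (rule Max_eqI[symmetric, OF assms(1)])
    show "c \<le> ?xs ! 0" if "c \<in> Q" for c
    proof -
      obtain k where "k < card Q" "?xs ! k = c" using mem[of c] \<open>c \<in> Q\<close> by blast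
      then show ?thesis using le[of 0 k] by auto
    qed
    show "?xs ! 0 \<in> Q" using mem[of "?xs ! 0"] card by blast
  qed
  show "?xs ! (card Q - 1) = Min Q"
  proof (rule Min_eqI[symmetric, OF assms(1)])
    show "?xs ! (card Q - 1) \<le> c" if "c \<in> Q" for c
    proof -
      obtain k where "k < card Q" "?xs ! k = c" using mem \<open>c \<in> Q\<close> by blast
      then show ?thesis using le[of k "card Q - 1"] by auto
    qed
    show "?xs ! (card Q - 1) \<in> Q" 
      using mem[of "?xs ! (card Q - 1)"] card by (metis diff_less zero_less_one)
  qed
qed

lemma chord_Re:
  assumes "z \<in> closed_segment (pt a) (pt b)" "a \<le> b"
  shows "a \<le> Re z" "Re z \<le> b"
proof -
  have "closed_segment (pt a) (pt b) \<subseteq> {z. a \<le> Re z} \<inter> {z. Re z \<le> b}"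
    using assms(2) by (intro closed_segment_subset convex_Int convex_halfspace_Re_ge convex_halfspace_Re_le) auto
  then show "a \<le> Re z" "Re z \<le> b" using assms by auto
qed

lemma chord_point_eqI:
  assumes "lev a b z = 0" "lev a b w = 0" "Re z = Re w"
  shows "z = w"
  using assms by (auto simp: lev_def complex_eq_iff)

text \<open>Along the inner chord the height above the outer one is affine and nonpositive at both
  ends. Unless the chords coincide, it vanishes only at a shared end.\<close>

lemma nested_chords:
  assumes z: "z \<in> closed_segment (pt a) (pt b)" "z \<in> closed_segment (pt c) (pt d)"
    and "a < b" "c < d" "a \<le> c" "d \<le> b" "(a, b) \<noteq> (c, d)"
  shows "z \<in> {pt a, pt b} \<inter> {pt c, pt d}"
proof -
  have l: "lev a b z = 0" "lev c d z = 0" using z lev_zero_on_segment by auto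
  have r: "c \<le> Re z" "Re z \<le> d" using chord_Re[OF z(2)] assms by auto
  have "lev a b z - lev c d z = (c + d - a - b) * Re z + a * b - c * d"
    by (simp add: lev_def algebra_simps)
  then have eq: "(c + d - a - b) * Re z + a * b - c * d = 0" using l by simp
  \<comment> \<open>Interpolation of this affine function between its values at \<open>c\<close> and
    \<open>d\<close>, with the denominator \<open>d - c\<close> cleared. Both summands are
    nonpositive and add up to zero.\<close>
  have conv: "(d - c) * ((c + d - a - b) * Re z + a * b - c * d)
      = (d - Re z) * ((c - a) * (c - b)) + (Re z - c) * ((d - a) * (d - b))"
    by (simp add: algebra_simps)
  have n1: "(d - Re z) * ((c - a) * (c - b)) \<le> 0"
    using r assms by (intro mult_nonneg_nonpos) auto
  have n2: "(Re z - c) * ((d - a) * (d - b)) \<le> 0"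
    using r assms by (intro mult_nonneg_nonpos) auto
  have "(d - Re z) * ((c - a) * (c - b)) = 0" "(Re z - c) * ((d - a) * (d - b)) = 0"
    using conv n1 n2 unfolding eq by linarith+
  then have "(Re z = d \<or> c = a) \<and> (Re z = c \<or> d = b)" using assms by auto
  then have "(Re z = d \<and> d = b) \<or> (Re z = c \<and> c = a)" using assms by auto
  moreover have "z = pt x" if "Re z = x" "x = c \<or> x = d" for x
    using chord_point_eqI[OF l(2), of "pt x"] that by (auto simp: lev_pt)
  ultimately show ?thesis by auto
qed

text \<open>For points in convex position two chords fail to cross exactly when their intervals are
  nested or do not overlap, so planarity can be stated on abscissae.\<close>

locale parabola_graph =
  fixes X :: "real set" and P :: "(real \<times> real) set"
  assumes finite_X: "finite X"
    and P_ends: "(a, b) \<in> P \<Longrightarrow> a \<in> X \<and> b \<in> X \<and> a < b"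
    and P_noncrossing: "\<lbrakk>(a, b) \<in> P; (c, d) \<in> P\<rbrakk> \<Longrightarrow>
      b \<le> c \<or> d \<le> a \<or> (a \<le> c \<and> d \<le> b) \<or> (c \<le> a \<and> b \<le> d)"
begin

lemma inj_ed: "inj_on ed P"
proof (rule inj_onI)
  fix e e' assume "e \<in> P" "e' \<in> P" "ed e = ed e'"
  then show "e = e'" using P_ends[of "fst e" "snd e"] P_ends[of "fst e'" "snd e'"]
    by (auto simp: ed_def doubleton_eq_iff prod_eq_iff)
qed

lemma chords_meet_at_ends:
  assumes "(a, b) \<in> P" "(c, d) \<in> P" "(a, b) \<noteq> (c, d)"
    and z: "z \<in> closed_segment (pt a) (pt b)" "z \<in> closed_segment (pt c) (pt d)"
  shows "z \<in> {pt a, pt b} \<inter> {pt c, pt d}"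
proof -
  have ab: "a < b" and cd: "c < d" using assms P_ends by auto
  have touch: "z = pt x" if "x = a \<or> x = b" "Re z = x" for x
    using chord_point_eqI[of a b z "pt x"] lev_zero_on_segment[OF z(1)] that by (auto simp: lev_pt)
  have R: "a \<le> Re z" "Re z \<le> b" "c \<le> Re z" "Re z \<le> d"
    using chord_Re[OF z(1)] chord_Re[OF z(2)] ab cd by auto
  consider "b \<le> c" | "d \<le> a" | "a \<le> c" "d \<le> b" | "c \<le> a" "b \<le> d"
    using P_noncrossing assms by blast
  then show ?thesis
  proof cases
    case 1
    then have "Re z = b" "c = b" using R by auto
    then show ?thesis using touch[of b] by auto
  next
    case 2
    then have "Re z = a" "d = a" using R by auto
    then show ?thesis using touch[of a] by auto
  next
    case 3
    then show ?thesis using nested_chords[OF z ab cd] assms by auto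
  next
    case 4
    then show ?thesis using nested_chords[OF z(2,1) cd ab] assms by auto
  qed
qed

lemma plane_graph: "plane_graph (pt ` X) (ed ` P) (\<lambda>e. convex hull e)"
  unfolding plane_graph_def
proof (intro conjI ballI impI)
  have card: "card (ed e) = 2" if "e \<in> P" for e
    using P_ends[of "fst e" "snd e"] that by (auto simp: ed_def)
  then show "finite_graph (pt ` X) (ed ` P)"
    using finite_X P_ends unfolding finite_graph_def by (fastforce simp: ed_def)
  fix e assume "e \<in> ed ` P"
  then obtain a b where ab: "(a, b) \<in> P" "e = {pt a, pt b}" by (auto simp: ed_def)
  then have lt: "a < b" "a \<in> X" "b \<in> X" using P_ends by auto
  show "\<exists>g. arc g \<and> path_image g = convex hull e \<and> {pathstart g, pathfinish g} = e"
    unfolding ab(2) using lt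
    by (intro exI[of _ "linepath (pt a) (pt b)"]) (simp add: segment_convex_hull)
  show "convex hull e \<inter> pt ` X = e"
  proof (intro equalityI subsetI)
    fix z assume "z \<in> convex hull e \<inter> pt ` X"
    then obtain x where x: "z = pt x" "pt x \<in> closed_segment (pt a) (pt b)"
      unfolding ab(2) segment_convex_hull by blast
    from lev_zero_on_segment[OF x(2)] show "z \<in> e" using x(1) ab(2) by (auto simp: lev_pt)
  next
    fix z assume "z \<in> e"
    then show "z \<in> convex hull e \<inter> pt ` X" using ab lt by (auto intro: hull_inc)
  qed
  fix e' assume "e' \<in> ed ` P" and neq: "e \<noteq> e'"
  from this(1) obtain c d where cd: "(c, d) \<in> P" "e' = {pt c, pt d}" by (auto simp: ed_def)
  have "(a, b) \<noteq> (c, d)" using ab cd neq by blast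
  from chords_meet_at_ends[OF ab(1) cd(1) this] show "convex hull e \<inter> convex hull e' \<subseteq> e \<inter> e'"
    unfolding ab(2) cd(2) segment_convex_hull by blast
qed

end

lemma winding_number_triangle_sum:
  assumes "z \<notin> closed_segment a b" "z \<notin> closed_segment b c" "z \<notin> closed_segment c a"
  shows "winding_number (linepath a b +++ linepath b c +++ linepath c a) z =
    winding_number (linepath a b) z + winding_number (linepath b c) z + winding_number (linepath c a) z"
  using assms by (simp add: winding_number_join path_image_join)

section \<open>Polygons as cycles and as inner faces\<close>

context parabola_graph
begin

text \<open>The last two claims keep the direction of traversal, which the set of edges forgets. The
  winding number and the properness of the cycle depend on it.\<close>

lemma polygon_cycle:
  assumes Q: "finite Q" "3 \<le> card Q" "polygon_edges Q \<subseteq> P"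
  defines "vs \<equiv> map pt (descending Q)"
  shows "is_cycle (ed ` P) vs" "cyc_edges vs = ed ` polygon_edges Q"
    and "\<And>i. i < length vs \<Longrightarrow>
      (\<exists>a b. (a, b) \<in> consec Q \<and> vs ! (i mod length vs) = pt b \<and> vs ! (Suc i mod length vs) = pt a) \<or>
      (vs ! (i mod length vs) = pt (Min Q) \<and> vs ! (Suc i mod length vs) = pt (Max Q))"
    and "\<And>a b. (a, b) \<in> consec Q \<Longrightarrow>
      \<exists>i<length vs. vs ! (i mod length vs) = pt b \<and> vs ! (Suc i mod length vs) = pt a"
proof -
  let ?n = "length vs" and ?xs = "descending Q"
  have ne: "Q \<noteq> {}" using Q by auto
  have n: "?n = card Q" and len: "length ?xs = card Q" using Q by (auto simp: vs_def length_descending)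
  have lower: "(?xs ! Suc i, ?xs ! i) \<in> consec Q \<and> vs ! (i mod ?n) = pt (?xs ! i) \<and>
      vs ! (Suc i mod ?n) = pt (?xs ! Suc i)" if "Suc i < ?n" for i
    using that descending_consec(1)[OF Q(1), of i] n by (simp add: vs_def)
  have top: "vs ! (i mod ?n) = pt (Min Q) \<and> vs ! (Suc i mod ?n) = pt (Max Q)" if "Suc i = ?n" for i
  proof -
    have "i = card Q - 1" "i < card Q" "0 < card Q" using that n by auto
    then show ?thesis using that descending_ends[OF Q(1) ne] n len by (simp add: vs_def)
  qed
  show step: "(\<exists>a b. (a, b) \<in> consec Q \<and> vs ! (i mod ?n) = pt b \<and> vs ! (Suc i mod ?n) = pt a) \<or>
      (vs ! (i mod ?n) = pt (Min Q) \<and> vs ! (Suc i mod ?n) = pt (Max Q))" if "i < ?n" for i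
    using lower[of i] top[of i] that by (cases "Suc i = ?n") auto
  show conv: "\<exists>i<?n. vs ! (i mod ?n) = pt b \<and> vs ! (Suc i mod ?n) = pt a" if "(a, b) \<in> consec Q" for a b
  proof -
    obtain i where i: "Suc i < card Q" "?xs ! i = b" "?xs ! Suc i = a"
      using descending_consec(2)[OF Q(1) \<open>(a, b) \<in> consec Q\<close>] by blast
    then show ?thesis using lower[of i] n by (intro exI[of _ i]) auto
  qed
  show edges: "cyc_edges vs = ed ` polygon_edges Q"
  proof (intro equalityI subsetI)
    fix e assume "e \<in> cyc_edges vs"
    then obtain i where i: "i < ?n" "e = cyc_edge vs i" by (auto simp: cyc_edges_def)
    from step[OF i(1)] show "e \<in> ed ` polygon_edges Q"
    proof
      assume "\<exists>a b. (a, b) \<in> consec Q \<and> vs ! (i mod ?n) = pt b \<and> vs ! (Suc i mod ?n) = pt a"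
      then obtain a b where "(a, b) \<in> consec Q" "e = ed (a, b)"
        using i(2) by (auto simp: cyc_edge_def ed_def insert_commute)
      then show ?thesis by (auto simp: polygon_edges_def)
    next
      assume "vs ! (i mod ?n) = pt (Min Q) \<and> vs ! (Suc i mod ?n) = pt (Max Q)"
      then have "e = ed (Min Q, Max Q)" using i(2) by (auto simp: cyc_edge_def ed_def)
      then show ?thesis by (auto simp: polygon_edges_def)
    qed
  next
    fix e assume "e \<in> ed ` polygon_edges Q"
    then consider a b where "(a, b) \<in> consec Q" "e = ed (a, b)" | "e = ed (Min Q, Max Q)"
      by (auto simp: polygon_edges_def)
    then show "e \<in> cyc_edges vs"
    proof cases
      case 1
      from conv[OF 1(1)] obtain i where "i < ?n" "vs ! (i mod ?n) = pt b" "vs ! (Suc i mod ?n) = pt a"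
        by blast
      then have "i < ?n" "e = cyc_edge vs i" using 1(2) by (auto simp: ed_def cyc_edge_def insert_commute)
      then show ?thesis by (auto simp: cyc_edges_def)
    next
      case 2
      have "?n \<noteq> 0" using n Q by linarith
      then obtain i where i: "Suc i = ?n" by (metis not0_implies_Suc)
      then have "e = cyc_edge vs i" "i < ?n" using 2 top[OF i] by (auto simp: ed_def cyc_edge_def)
      then show ?thesis by (auto simp: cyc_edges_def)
    qed
  qed
  have "distinct vs" using Q(1) distinct_descending by (simp add: vs_def distinct_map inj_on_def)
  then show "is_cycle (ed ` P) vs"
    using Q n edges unfolding is_cycle_def by (metis image_mono)
qed

text \<open>The inside lies strictly on one side of each side line, so every piece of the curve
  turns negatively around it, and among the possible values 1 and -1 the sum must be -1. The
  assumption \<open>beyond\<close> places each chord weakly beyond one of these lines, hence off the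
  inside.\<close>

lemma convex_polygon_face:
  assumes Q: "finite Q" "3 \<le> card Q" "polygon_edges Q \<subseteq> P"
    and beyond: "\<And>c d. (c, d) \<in> P \<Longrightarrow> Max Q \<le> c \<or> d \<le> Min Q \<or> (c \<le> Min Q \<and> Max Q \<le> d) \<or>
      (\<exists>(a, b)\<in>consec Q. a \<le> c \<and> d \<le> b)"
  defines "vs \<equiv> map pt (descending Q)"
  shows "clockwise (\<lambda>e. convex hull e) vs"
    and "\<exists>F\<in>inner_faces (pt ` X) (ed ` P) (\<lambda>e. convex hull e).
      frontier F = \<Union> ((\<lambda>e. convex hull e) ` cyc_edges vs)"
proof -
  let ?n = "length vs"
  define f where "f = (\<lambda>i. vs ! (i mod ?n))"
  note cyc = polygon_cycle[OF Q, folded vs_def]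
  obtain p t where p: "simple_path p" "pathfinish p = pathstart p" "polygonal f ?n p t"
    using straight_plane_cycle_curve[OF plane_graph cyc(1)] unfolding f_def by blast
  note jordan = Jordan_inside_outside[OF p(1,2)]
  let ?S = "inside (path_image p)"
  have ne: "Q \<noteq> {}" using Q by auto
  have mm: "Min Q \<in> Q" "Max Q \<in> Q" "\<And>x. x \<in> Q \<Longrightarrow> Min Q \<le> x \<and> x \<le> Max Q"
    using Q(1) ne by auto
  have lt: "Min Q < Max Q" using Q(3) P_ends by (auto simp: polygon_edges_def)
  have im: "path_image p = \<Union> ((\<lambda>e. convex hull e) ` cyc_edges vs)"
    using path_image_polygonal_cycle p(3) unfolding f_def by blast
  have im_sub: "path_image p \<subseteq> T" if T: "convex T" "\<And>x. x \<in> Q \<Longrightarrow> pt x \<in> T" for T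
  proof -
    have "convex hull e \<subseteq> T" if "e \<in> cyc_edges vs" for e
    proof (rule hull_minimal[where S=convex, OF _ T(1)])
      show "e \<subseteq> T" using that T(2) mm unfolding cyc(2)
        by (auto simp: ed_def polygon_edges_def consec_def)
    qed
    then show ?thesis unfolding im by blast
  qed
  have above: "0 < lev a b z" if ab: "(a, b) \<in> consec Q" and z: "z \<in> ?S" for a b z
  proof -
    have "pt x \<in> {z. 0 \<le> lev a b z}" if "x \<in> Q" for x
      using ab that by (force simp: lev_pt consec_def zero_le_mult_iff)
    then have "?S \<subseteq> interior {z. 0 \<le> lev a b z}"
      using im_sub[OF convex_lev_ge] jordan by (intro inside_subset_interior_convex convex_lev_ge) auto
    then show ?thesis using z by (auto simp: interior_lev_ge)
  qed
  have below: "lev (Min Q) (Max Q) z < 0" if z: "z \<in> ?S" for z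
  proof -
    have "pt x \<in> {z. lev (Min Q) (Max Q) z \<le> 0}" if "x \<in> Q" for x
      using mm(3)[OF that] by (simp add: lev_pt mult_le_0_iff)
    then have "?S \<subseteq> interior {z. lev (Min Q) (Max Q) z \<le> 0}"
      using im_sub[OF convex_lev_le] jordan by (intro inside_subset_interior_convex convex_lev_le) auto
    then show ?thesis using z by (auto simp: interior_lev_le)
  qed
  have neg: "winding_number p z = -1" if z: "z \<in> ?S" for z
  proof -
    have zp: "z \<notin> path_image p" using z inside_no_overlap by blast
    have "Re (winding_number (linepath (f i) (f (Suc i))) z) < 0" if "i < ?n" for i
      using cyc(3)[OF that]
    proof
      assume "\<exists>a b. (a, b) \<in> consec Q \<and> vs ! (i mod ?n) = pt b \<and> vs ! (Suc i mod ?n) = pt a"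
      then obtain a b where ab: "(a, b) \<in> consec Q" "f i = pt b" "f (Suc i) = pt a"
        by (auto simp: f_def)
      have "(a - b) * lev b a z < 0" using above[OF ab(1) z] ab(1) lev_commute[of a b z]
        by (auto simp: consec_def mult_less_0_iff)
      then show ?thesis using winding_number_chord_neg ab by simp
    next
      assume "vs ! (i mod ?n) = pt (Min Q) \<and> vs ! (Suc i mod ?n) = pt (Max Q)"
      moreover have "(Max Q - Min Q) * lev (Min Q) (Max Q) z < 0"
        using below[OF z] lt by (simp add: mult_less_0_iff)
      ultimately show ?thesis using winding_number_chord_neg by (simp add: f_def)
    qed
    moreover have "{..<?n} \<noteq> {}" using cyc(1) by (force simp: is_cycle_def lessThan_empty_iff)
    ultimately have "(\<Sum>i<?n. Re (winding_number (linepath (f i) (f (Suc i))) z)) < (\<Sum>i<?n. 0)"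
      by (intro sum_strict_mono) auto
    then have "Re (winding_number p z) < 0"
      unfolding winding_number_polygonal[OF p(3) zp] Re_sum by simp
    then show ?thesis
      using simple_closed_path_winding_number_inside[OF p(1)] z by (metis one_complex.simps(1) not_one_less_zero)
  qed
  have "vs \<noteq> []" using cyc(1) by (auto simp: is_cycle_def)
  then show "clockwise (\<lambda>e. convex hull e) vs"
    unfolding clockwise_iff_polygonal[OF \<open>vs \<noteq> []\<close>] using p neg unfolding f_def by blast
  let ?G = "pt ` X \<union> \<Union> ((\<lambda>e. convex hull e) ` ed ` P)"
  have avoid: "z \<notin> ?S" if "lev (Min Q) (Max Q) z \<ge> 0 \<or> (\<exists>(a, b)\<in>consec Q. lev a b z \<le> 0)" for z
    using that above below by force
  have S_chord: "z \<notin> ?S" if cd: "(c, d) \<in> P" and z: "z \<in> closed_segment (pt c) (pt d)" for c d z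
  proof -
    have c_d: "c < d" using P_ends[OF cd] by simp
    have "(\<exists>(a, b)\<in>consec Q. a \<le> c \<and> d \<le> b) \<or>
        (0 \<le> (c - Min Q) * (c - Max Q) \<and> 0 \<le> (d - Min Q) * (d - Max Q))"
      using beyond[OF cd] c_d lt by (auto simp: zero_le_mult_iff)
    then show ?thesis
    proof
      assume "\<exists>(a, b)\<in>consec Q. a \<le> c \<and> d \<le> b"
      then obtain a b where ab: "(a, b) \<in> consec Q" "a \<le> c" "d \<le> b" by blast
      have "closed_segment (pt c) (pt d) \<subseteq> {z. lev a b z \<le> 0}"
        using ab c_d by (intro closed_segment_subset convex_lev_le) (auto simp: lev_pt mult_le_0_iff)
      then show ?thesis using avoid ab(1) z by blast
    next
      assume "0 \<le> (c - Min Q) * (c - Max Q) \<and> 0 \<le> (d - Min Q) * (d - Max Q)"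
      then have "closed_segment (pt c) (pt d) \<subseteq> {z. 0 \<le> lev (Min Q) (Max Q) z}"
        by (intro closed_segment_subset convex_lev_ge) (auto simp: lev_pt)
      then show ?thesis using avoid z by blast
    qed
  qed
  \<comment> \<open>This holds for every real \<open>x\<close>: beyond the range of \<open>Q\<close>
    the point is above the top line, and within the range it is on or below the chord over its
    gap.\<close>
  have S_vertex: "pt x \<notin> ?S" for x
  proof (cases "Min Q \<le> x \<and> x \<le> Max Q")
    case False
    then show ?thesis using lt by (intro avoid) (auto simp: lev_pt zero_le_mult_iff)
  next
    case True
    define a where "a = Max {y \<in> Q. y \<le> x}"
    have fa: "finite {y \<in> Q. y \<le> x}" "{y \<in> Q. y \<le> x} \<noteq> {}" using Q(1) mm True by auto
    have a: "a \<in> Q" "a \<le> x" and amax: "\<And>y. y \<in> Q \<Longrightarrow> y \<le> x \<Longrightarrow> y \<le> a"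
      using Max_in[OF fa] Max_ge[OF fa(1)] by (auto simp: a_def)
    show ?thesis
    proof (cases "a = Max Q")
      case True
      then have "x = Max Q" using a \<open>Min Q \<le> x \<and> x \<le> Max Q\<close> by simp
      then show ?thesis by (intro avoid) (auto simp: lev_pt)
    next
      case False
      define b where "b = Min {y \<in> Q. a < y}"
      have "a < Max Q" using False mm(3)[OF a(1)] by simp
      then have fb: "finite {y \<in> Q. a < y}" "{y \<in> Q. a < y} \<noteq> {}" using Q(1) mm by auto
      have b: "b \<in> Q" "a < b" and bmin: "\<And>y. y \<in> Q \<Longrightarrow> a < y \<Longrightarrow> b \<le> y"
        using Min_in[OF fb] Min_le[OF fb(1)] by (auto simp: b_def)
      have "(a, b) \<in> consec Q" using a b bmin by (force simp: consec_def)
      moreover have "x \<le> b" using amax[OF b(1)] b(2) by linarith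
      then have "lev a b (pt x) \<le> 0" using a by (auto simp: lev_pt mult_le_0_iff)
      ultimately show ?thesis by (intro avoid) blast
    qed
  qed
  have disj: "?S \<inter> ?G = {}"
  proof -
    have "z \<notin> ?S" if "e \<in> P" "z \<in> convex hull (ed e)" for e z
      using S_chord[of "fst e" "snd e" z] that by (simp add: ed_def segment_convex_hull)
    then show ?thesis using S_vertex by blast
  qed
  have disjoint: "D \<inter> A = {}" if "A \<subseteq> G" "D \<subseteq> - G" for A D G :: "complex set"
    using that by blast
  have front: "frontier ?S = path_image p" using jordan by simp
  \<comment> \<open>A connected set that extended the inside would meet its frontier, which belongs
    to the graph.\<close>
  have "?S \<in> components (- ?G)"
    unfolding in_components_maximal
  proof (intro conjI allI impI)
    show "?S \<noteq> {}" "connected ?S" using jordan by auto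
    show "?S \<subseteq> - ?G" using disj by blast
    fix D assume D: "D \<noteq> {} \<and> ?S \<subseteq> D \<and> D \<subseteq> - ?G \<and> connected D"
    have "path_image p \<subseteq> ?G" unfolding im cyc(2) using Q(3) by blast
    moreover have "D \<subseteq> - ?G" using D by simp
    ultimately have "D \<inter> frontier ?S = {}" unfolding front by (rule disjoint)
    moreover have "D \<inter> ?S \<noteq> {}" using D jordan by (simp add: Int_absorb1)
    ultimately have "D - ?S = {}" using connected_Int_frontier[of D ?S] D by argo
    then show "D = ?S" using D by blast
  qed
  moreover have "bounded ?S" using jordan by simp
  ultimately have "?S \<in> inner_faces (pt ` X) (ed ` P) (\<lambda>e. convex hull e)"
    by (simp add: inner_faces_def)
  then show "\<exists>F\<in>inner_faces (pt ` X) (ed ` P) (\<lambda>e. convex hull e).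
      frontier F = \<Union> ((\<lambda>e. convex hull e) ` cyc_edges vs)"
    using front unfolding im[symmetric] by blast
qed

end

section \<open>Lower boundary edges on clockwise cycles\<close>

context parabola_graph
begin

text \<open>The winding number jumps by one when the argument crosses the edge upwards, and it
  vanishes below the edge because the whole graph lies above the line through the edge.\<close>

lemma clockwise_hull_edge:
  assumes cycle: "is_cycle (ed ` P) vs" and cw: "clockwise (\<lambda>e. convex hull e) vs"
    and ab: "(a, b) \<in> P" and hull: "\<And>x. x \<in> X \<Longrightarrow> x \<le> a \<or> b \<le> x"
    and i: "i < length vs" and edge: "cyc_edge vs i = ed (a, b)"
  shows "vs ! i = pt b \<and> vs ! (Suc i mod length vs) = pt a"
proof (rule ccontr)
  let ?n = "length vs"
  define f where "f = (\<lambda>i. vs ! (i mod ?n))"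
  assume "\<not> ?thesis"
  then have fi: "f i = pt a" "f (Suc i) = pt b"
    using edge i by (auto simp: f_def cyc_edge_def ed_def doubleton_eq_iff)
  have lt: "a < b" using P_ends[OF ab] by simp
  have "vs \<noteq> []" using i by auto
  from cw[unfolded clockwise_iff_polygonal[OF this]] obtain p t
    where p: "simple_path p" "pathfinish p = pathstart p" "polygonal f ?n p t"
      and inside: "\<And>z. z \<in> inside (path_image p) \<Longrightarrow> winding_number p z = -1"
    unfolding f_def by blast
  have path: "path p" using p(1) by (rule simple_path_imp_path)
  let ?H = "{z. 0 \<le> lev a b z}"
  have im: "path_image p = (\<Union>k<?n. closed_segment (f k) (f (Suc k)))"
    by (rule polygonal_path_image[OF p(3)])
  have cE: "cyc_edge vs k \<in> ed ` P" if "k < ?n" for k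
    using cycle that by (auto simp: is_cycle_def cyc_edges_def)
  have seg: "closed_segment (f k) (f (Suc k)) = convex hull (cyc_edge vs k)" for k
    by (simp add: f_def cyc_edge_def segment_convex_hull)
  have imH: "path_image p \<subseteq> ?H"
  proof -
    have "convex hull (cyc_edge vs k) \<subseteq> ?H" if k: "k < ?n" for k
    proof (rule hull_minimal[where S=convex, OF _ convex_lev_ge])
      obtain c d where cd: "(c, d) \<in> P" "cyc_edge vs k = {pt c, pt d}" using cE[OF k] by (auto simp: ed_def)
      then show "cyc_edge vs k \<subseteq> ?H" using P_ends[OF cd(1)] hull[of c] hull[of d] lt
        by (auto simp: lev_pt zero_le_mult_iff)
    qed
    then show ?thesis unfolding im seg by blast
  qed
  \<comment> \<open>\<open>m\<close> is the midpoint of the edge, and \<open>up\<close> runs along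
    the vertical line through it, with \<open>s\<close> as the height above the edge. The apex
    \<open>c\<close> completes the edge to a triangle that contains \<open>up s\<close> for
    \<open>s\<close> strictly between 0 and 1.\<close>
  define m where "m = Complex ((a + b) / 2) ((a\<^sup>2 + b\<^sup>2) / 2)"
  define up where "up = (\<lambda>s. Complex ((a + b) / 2) ((a\<^sup>2 + b\<^sup>2) / 2 + s))"
  define c where "c = up 1"
  have up0: "up 0 = m" by (simp add: up_def m_def)
  have lev_up: "lev a b (up s) = s" for s
    by (simp add: lev_def up_def power2_eq_square field_simps)
  have m_seg: "m \<in> closed_segment (pt a) (pt b)"
    unfolding in_segment
    by (rule exI[of _ "1/2"]) (auto simp: m_def pt_def complex_eq_iff field_simps)
  have m_ends: "m \<noteq> pt a" "m \<noteq> pt b" using lt by (auto simp: m_def pt_def)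
  have m_other: "m \<notin> closed_segment (f k) (f (Suc k))" if k: "k < ?n" "k \<noteq> i" for k
  proof
    assume mk: "m \<in> closed_segment (f k) (f (Suc k))"
    have "cyc_edge vs k \<noteq> cyc_edge vs i"
      using inj_onD[OF cyc_edge_inj, of vs k i] cycle k i by (auto simp: is_cycle_def)
    then have "convex hull (cyc_edge vs k) \<inter> convex hull (cyc_edge vs i) \<subseteq> cyc_edge vs k \<inter> cyc_edge vs i"
      by (rule plane_graph_meet_at_ends[OF plane_graph cE[OF k(1)] cE[OF i]])
    moreover have "m \<in> convex hull (cyc_edge vs i)" using m_seg fi seg[of i] by simp
    ultimately have "m \<in> cyc_edge vs i" using mk seg[of k] by blast
    then show False using m_ends edge by (auto simp: ed_def)
  qed
  \<comment> \<open>The two other sides of the triangle are added to the edge and subtracted from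
    the rest. Thus \<open>T\<close> belongs to a closed curve and is known on both sides of the edge
    without computing limits, while \<open>S\<close> is continuous at \<open>m\<close>.\<close>
  define T where "T = (\<lambda>z. winding_number (linepath (pt a) (pt b)) z
      + winding_number (linepath (pt b) c) z + winding_number (linepath c (pt a)) z)"
  define S where "S = (\<lambda>z. (\<Sum>k\<in>{..<?n} - {i}. winding_number (linepath (f k) (f (Suc k))) z)
      - winding_number (linepath (pt b) c) z - winding_number (linepath c (pt a)) z)"
  have W: "winding_number p z = T z + S z" if "z \<notin> path_image p" for z
    unfolding winding_number_polygonal[OF p(3) that] using i fi
    by (subst sum.remove[of _ i]) (auto simp: T_def S_def)
  have side: "up s \<notin> closed_segment (pt x) c" if "x = a \<or> x = b" "s \<noteq> 1" for x s
  proof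
    assume "up s \<in> closed_segment (pt x) c"
    then obtain u where u: "up s = (1 - u) *\<^sub>R pt x + u *\<^sub>R c" by (auto simp: in_segment)
    have "h = (1 - u) * x + u * h \<Longrightarrow> (1 - u) * (x - h) = 0" for h :: real
      by (simp add: algebra_simps)
    from this[of "(a + b) / 2"] arg_cong[OF u, of Re] have "(1 - u) * (x - (a + b) / 2) = 0"
      by (simp add: c_def up_def)
    then have "u = 1" using that lt by auto
    then have "up s = c" using u by simp
    then show False using that by (simp add: c_def up_def)
  qed
  have base: "up s \<notin> closed_segment (pt a) (pt b)" if "s \<noteq> 0" for s
    using lev_zero_on_segment[of "up s" a b] lev_up that by auto
  have triangle: "T (up s) = winding_number (linepath (pt a) (pt b) +++ linepath (pt b) c +++ linepath c (pt a)) (up s)"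
    if "s \<noteq> 0" "s \<noteq> 1" for s
    unfolding T_def using base[OF that(1)] side[of a s] side[of b s] that
    by (subst winding_number_triangle_sum) (auto simp: closed_segment_commute)
  \<comment> \<open>Triangle and cycle both lie in the half plane above the line, and
    \<open>up s\<close> does not.\<close>
  have S_below: "S (up s) = 0" if "s < 0" for s
  proof -
    have notH: "up s \<notin> ?H" using lev_up that by simp
    have "c \<in> ?H" using lev_up by (simp add: c_def)
    then have "path_image (linepath (pt a) (pt b) +++ linepath (pt b) c +++ linepath c (pt a)) \<subseteq> ?H"
      by (simp add: path_image_join closed_segment_subset convex_lev_ge lev_pt)
    then have "T (up s) = 0"
      using that triangle[of s] winding_number_zero_outside[OF _ convex_lev_ge _ notH] by simp
    moreover have "winding_number p (up s) = 0"
      by (rule winding_number_zero_outside[OF path convex_lev_ge p(2) notH imH])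
    moreover have "up s \<notin> path_image p" using notH imH by blast
    ultimately show ?thesis using W by simp
  qed
  \<comment> \<open>With the assumed wrong direction of the edge the triangle runs counterclockwise:
    all three sides contribute positively, and the sum is an integer.\<close>
  have T_above: "1 \<le> Re (T (up s))" if s: "0 < s" "s < 1" for s
  proof -
    have "0 < (b - a) * lev a b (up s)" using lt lev_up s by simp
    then have 1: "0 < Re (winding_number (linepath (pt a) (pt b)) (up s))" by (rule winding_number_chord_pos)
    have pos: "0 < (1 - s) * ((b - a) / 2)" using s lt by simp
    have "Im ((c - pt b) * cnj (c - up s)) = (1 - s) * ((b - a) / 2)"
      by (simp add: c_def up_def pt_def field_simps)
    then have 2: "0 < Re (winding_number (linepath (pt b) c) (up s))"
      using pos by (intro winding_number_linepath_pos_lt) (simp only:)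
    have "Im ((pt a - c) * cnj (pt a - up s)) = (1 - s) * ((b - a) / 2)"
      by (simp add: c_def up_def pt_def field_simps)
    then have 3: "0 < Re (winding_number (linepath c (pt a)) (up s))"
      using pos by (intro winding_number_linepath_pos_lt) (simp only:)
    have "up s \<notin> path_image (linepath (pt a) (pt b) +++ linepath (pt b) c +++ linepath c (pt a))"
      using base[of s] side[of a s] side[of b s] s by (simp add: path_image_join closed_segment_commute)
    then have "T (up s) \<in> \<int>" using triangle[of s] s by (simp add: integer_winding_number)
    then obtain k :: int where k: "T (up s) = of_int k" by (elim Ints_cases)
    have "0 < Re (T (up s))" using 1 2 3 by (simp add: T_def)
    then show ?thesis unfolding k by simp
  qed
  have "isCont S m"
    unfolding S_def
    using m_other side[of a 0] side[of b 0] up0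
    by (intro continuous_intros continuous_at_winding_number) (auto simp: closed_segment_commute)
  moreover have up_cont: "isCont up 0" unfolding up_def isCont_def
    by (intro tendsto_Complex tendsto_intros)
  ultimately have "isCont (\<lambda>s. S (up s)) 0" by (intro isCont_o2[of 0 up S]) (simp_all add: up0)
  then have lim: "((\<lambda>s. S (up s)) \<longlongrightarrow> S (up 0)) (at 0)" by (simp add: isCont_def)
  have "((\<lambda>s. S (up s)) \<longlongrightarrow> S (up 0)) (at_left 0)"
    by (rule tendsto_mono[OF at_le[OF subset_UNIV] lim])
  moreover have "\<forall>\<^sub>F s in at_left 0. S (up s) = 0"
    using S_below by (auto simp: eventually_at_filter)
  ultimately have "((\<lambda>s. 0) \<longlongrightarrow> S (up 0)) (at_left (0::real))"
    using tendsto_cong[of "\<lambda>s. S (up s)" "\<lambda>s. 0"] by simp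
  then have S0: "S (up 0) = 0" using tendsto_const_iff[of "at_left (0::real)" "0::complex"] by simp
  have "\<forall>\<^sub>F s in at 0. up s \<in> - (\<Union>k\<in>{..<?n} - {i}. closed_segment (f k) (f (Suc k)))"
  proof (rule topological_tendstoD[OF up_cont[unfolded isCont_def]])
    show "open (- (\<Union>k\<in>{..<?n} - {i}. closed_segment (f k) (f (Suc k))))"
      by (intro open_Compl closed_UN) auto
    show "up 0 \<in> - (\<Union>k\<in>{..<?n} - {i}. closed_segment (f k) (f (Suc k)))"
      using m_other by (auto simp: up0)
  qed
  then have "\<forall>\<^sub>F s in at_right 0. up s \<in> - (\<Union>k\<in>{..<?n} - {i}. closed_segment (f k) (f (Suc k)))"
    by (rule filter_leD[OF at_le[OF subset_UNIV]])
  moreover have "\<forall>\<^sub>F s in at_right 0. s \<in> {0<..<1::real}"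
    by (rule eventually_at_right_real) simp
  \<comment> \<open>The winding number of the clockwise curve is 0 or -1 here and \<open>T\<close>
    is at least 1. So \<open>S\<close> stays away from the value 0 that continuity from below gives
    it at \<open>m\<close>.\<close>
  ultimately have "\<forall>\<^sub>F s in at_right 0. Re (S (up s)) \<le> -1"
  proof eventually_elim
    case (elim s)
    have "up s \<notin> path_image p" unfolding im using elim base[of s] fi by auto
    moreover from this have "winding_number p (up s) = -1 \<or> winding_number p (up s) = 0"
      using inside winding_number_zero_in_outside[OF path p(2)] inside_Un_outside[of "path_image p"] by blast
    ultimately show ?case using arg_cong[OF W[of "up s"], of Re] T_above[of s] elim by auto
  qed
  moreover have "((\<lambda>s. Re (S (up s))) \<longlongrightarrow> Re (S (up 0))) (at_right 0)"
    by (intro tendsto_Re tendsto_mono[OF at_le[OF subset_UNIV] lim])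
  ultimately have "Re (S (up 0)) \<le> -1" by (intro tendsto_upperbound) auto
  then show False using S0 by simp
qed

end

section \<open>Matchings and ears\<close>

text \<open>The order ideals of the reachability order, described by single arcs, so that a new leaf
  adds just one condition.\<close>

definition closed_sets :: "'v set \<Rightarrow> ('v \<times> 'v) set \<Rightarrow> 'v set set" where
  "closed_sets V A = {I. I \<subseteq> V \<and> (\<forall>(x, y)\<in>A. x \<in> I \<longrightarrow> y \<in> I)}"

definition incident :: "real \<Rightarrow> real \<times> real \<Rightarrow> bool" where
  "incident x e \<longleftrightarrow> x = fst e \<or> x = snd e"

text \<open>Perfect matchings on abscissae; \<open>ed\<close> carries them over to the plane
  graph.\<close>

definition matchings :: "real set \<Rightarrow> (real \<times> real) set \<Rightarrow> (real \<times> real) set set" where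
  "matchings X P = {M. M \<subseteq> P \<and> (\<forall>x\<in>X. \<exists>!e. e \<in> M \<and> incident x e)}"

text \<open>An ear is the path \<open>s, x1, x2, t\<close> added below the edge \<open>(s, t)\<close>. A matching of the old graph
  extends by the middle edge of the ear, or it trades \<open>(s, t)\<close> for the two outer ones.\<close>

definition ear :: "real \<times> real \<Rightarrow> real \<Rightarrow> real \<Rightarrow> (real \<times> real) set" where
  "ear e x1 x2 = {(fst e, x1), (x1, x2), (x2, snd e)}"

definition ear_off :: "real \<Rightarrow> real \<Rightarrow> (real \<times> real) set \<Rightarrow> (real \<times> real) set" where
  "ear_off x1 x2 M = insert (x1, x2) M"

definition ear_on :: "real \<times> real \<Rightarrow> real \<Rightarrow> real \<Rightarrow> (real \<times> real) set \<Rightarrow> (real \<times> real) set" where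
  "ear_on e x1 x2 M = M - {e} \<union> {(fst e, x1), (x2, snd e)}"

locale ear_graph = parabola_graph +
  fixes e :: "real \<times> real" and x1 x2 :: real
  assumes e: "e \<in> P" and e_hull: "\<And>x. x \<in> X \<Longrightarrow> x \<le> fst e \<or> snd e \<le> x"
    and x12: "fst e < x1" "x1 < x2" "x2 < snd e"
begin

lemma x_new: "x1 \<notin> X" "x2 \<notin> X"
  using e_hull[of x1] e_hull[of x2] x12 by auto

lemma P_X: "f \<in> P \<Longrightarrow> fst f \<in> X \<and> snd f \<in> X \<and> fst f < snd f"
  using P_ends[of "fst f" "snd f"] by simp

lemma ear_new: "ear e x1 x2 \<inter> P = {}"
  using P_X x_new by (force simp: ear_def)

lemma ear_off_matching:
  assumes "M \<in> matchings X P"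
  shows "ear_off x1 x2 M \<in> matchings (X \<union> {x1, x2}) (P \<union> ear e x1 x2)"
proof -
  have M: "M \<subseteq> P" and cover: "\<And>x. x \<in> X \<Longrightarrow> \<exists>!f. f \<in> M \<and> incident x f"
    using assms by (auto simp: matchings_def)
  have "\<exists>!f. f \<in> ear_off x1 x2 M \<and> incident x f" if "x \<in> X \<union> {x1, x2}" for x
  proof (cases "x \<in> X")
    case True
    then have "f \<in> ear_off x1 x2 M \<and> incident x f \<longleftrightarrow> f \<in> M \<and> incident x f" for f
      using x_new by (auto simp: ear_off_def incident_def)
    then show ?thesis using cover[OF True] by simp
  next
    case False
    have "f \<notin> M" if "incident x f" for f
      using that False M P_X[of f] by (auto simp: incident_def)
    moreover have "incident x (x1, x2)" using that False by (auto simp: incident_def)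
    ultimately have "f \<in> ear_off x1 x2 M \<and> incident x f \<longleftrightarrow> f = (x1, x2)" for f
      unfolding ear_off_def by blast
    then show ?thesis by simp
  qed
  then show ?thesis using M by (auto simp: matchings_def ear_off_def ear_def)
qed

lemma ear_on_matching:
  assumes "M \<in> matchings X P" "e \<in> M"
  shows "ear_on e x1 x2 M \<in> matchings (X \<union> {x1, x2}) (P \<union> ear e x1 x2)"
proof -
  have M: "M \<subseteq> P" and cover: "\<And>x. x \<in> X \<Longrightarrow> \<exists>!f. f \<in> M \<and> incident x f"
    using assms by (auto simp: matchings_def)
  let ?M = "ear_on e x1 x2 M"
  have e_unique: "f = e" if "f \<in> M" "x \<in> X" "incident x f" "incident x e" for f x
    using cover[OF that(2)] that assms(2) by blast
  have eX: "fst e \<in> X" "snd e \<in> X" using P_X[OF e] by auto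
  have "\<exists>!f. f \<in> ?M \<and> incident x f" if "x \<in> X \<union> {x1, x2}" for x
  proof (cases "x \<in> X")
    case True
    then have nx: "x \<noteq> x1" "x \<noteq> x2" using x_new by auto
    show ?thesis
    proof (cases "incident x e")
      case inc: True
      have "f \<notin> M - {e}" if "incident x f" for f using e_unique inc True that by blast
      moreover have "incident x (fst e, x1) \<longleftrightarrow> x = fst e" "incident x (x2, snd e) \<longleftrightarrow> x \<noteq> fst e"
        using inc nx x12 by (auto simp: incident_def)
      ultimately have "f \<in> ?M \<and> incident x f \<longleftrightarrow>
          x = fst e \<and> f = (fst e, x1) \<or> x \<noteq> fst e \<and> f = (x2, snd e)" for f
        unfolding ear_on_def by blast
      then show ?thesis by (cases "x = fst e") simp_all
    next
      case False
      then have "f \<in> ?M \<and> incident x f \<longleftrightarrow> f \<in> M \<and> incident x f" for f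
        using nx by (auto simp: ear_on_def incident_def)
      then show ?thesis using cover[OF True] by simp
    qed
  next
    case False
    have "f \<notin> M" if "incident x f" for f
      using that False M P_X[of f] by (auto simp: incident_def)
    moreover have "incident x (fst e, x1) \<longleftrightarrow> x = x1" "incident x (x2, snd e) \<longleftrightarrow> x \<noteq> x1"
      using that False eX x12 by (auto simp: incident_def)
    ultimately have "f \<in> ?M \<and> incident x f \<longleftrightarrow>
        x = x1 \<and> f = (fst e, x1) \<or> x \<noteq> x1 \<and> f = (x2, snd e)" for f
      unfolding ear_on_def by blast
    then show ?thesis by (cases "x = x1") simp_all
  qed
  then show ?thesis using M by (auto simp: matchings_def ear_on_def ear_def)
qed

text \<open>The new vertices have degree two, so they are matched with each other or both with the
  ends of \<open>e\<close>. In the second case no old edge covers these ends, and \<open>e\<close>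
  can be put back.\<close>

lemma ear_matching_cases:
  assumes "M' \<in> matchings (X \<union> {x1, x2}) (P \<union> ear e x1 x2)"
  shows "(\<exists>M\<in>matchings X P. M' = ear_off x1 x2 M) \<or>
    (\<exists>M\<in>matchings X P. e \<in> M \<and> M' = ear_on e x1 x2 M)"
proof -
  have M': "M' \<subseteq> P \<union> ear e x1 x2"
    and cover: "\<And>x. x \<in> X \<union> {x1, x2} \<Longrightarrow> \<exists>!f. f \<in> M' \<and> incident x f"
    using assms by (auto simp: matchings_def)
  have inc_new: "f \<in> ear e x1 x2" if "f \<in> M'" "incident x1 f \<or> incident x2 f" for f
    using that M' P_X[of f] x_new by (auto simp: incident_def)
  have eX: "fst e \<in> X" "snd e \<in> X" using P_X[OF e] by auto
  let ?N1 = "(fst e, x1)" and ?N2 = "(x1, x2)" and ?N3 = "(x2, snd e)"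
  have unique: "f = g" if "x \<in> X \<union> {x1, x2}" "f \<in> M'" "g \<in> M'" "incident x f" "incident x g" for f g x
    using cover[OF that(1)] that by blast
  have x1_cover: "?N1 \<in> M' \<or> ?N2 \<in> M'"
  proof -
    obtain f where f: "f \<in> M'" "incident x1 f" using cover[of x1] by blast
    then have "f \<in> ear e x1 x2" using inc_new by blast
    then show ?thesis using f x12 by (auto simp: ear_def incident_def)
  qed
  have x2_cover: "?N3 \<in> M' \<or> ?N2 \<in> M'"
  proof -
    obtain f where f: "f \<in> M'" "incident x2 f" using cover[of x2] by blast
    then have "f \<in> ear e x1 x2" using inc_new by blast
    then show ?thesis using f x12 by (auto simp: ear_def incident_def)
  qed
  have N12: "\<not> (?N1 \<in> M' \<and> ?N2 \<in> M')"
    using unique[of x1 ?N1 ?N2] x12 by (auto simp: incident_def)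
  have N23: "\<not> (?N3 \<in> M' \<and> ?N2 \<in> M')"
    using unique[of x2 ?N3 ?N2] x12 by (auto simp: incident_def)
  show ?thesis
  proof (cases "?N2 \<in> M'")
    case True
    then have no: "?N1 \<notin> M'" "?N3 \<notin> M'" using N12 N23 by auto
    let ?M = "M' - {?N2}"
    have sub: "?M \<subseteq> P" using M' no by (auto simp: ear_def)
    have "\<exists>!f. f \<in> ?M \<and> incident x f" if "x \<in> X" for x
    proof -
      have "f \<in> ?M \<and> incident x f \<longleftrightarrow> f \<in> M' \<and> incident x f" for f
        using that x_new by (auto simp: incident_def)
      then show ?thesis using cover[of x] that by simp
    qed
    then have "?M \<in> matchings X P" using sub by (simp add: matchings_def)
    moreover have "M' = ear_off x1 x2 ?M" using True by (auto simp: ear_off_def)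
    ultimately show ?thesis by blast
  next
    case False
    then have N: "?N1 \<in> M'" "?N3 \<in> M'" using x1_cover x2_cover by auto
    have "e \<noteq> ?N1" using x12 by (metis less_irrefl prod.sel(2) order_less_trans)
    then have eM': "e \<notin> M'" using unique[of "fst e" e ?N1] N eX by (auto simp: incident_def)
    let ?M = "insert e (M' - {?N1, ?N3})"
    have sub: "?M \<subseteq> P" using M' False e by (auto simp: ear_def)
    have "\<exists>!f. f \<in> ?M \<and> incident x f" if x: "x \<in> X" for x
    proof (cases "incident x e")
      case True
      have "f = e" if f: "f \<in> ?M" "incident x f" for f
      proof (rule ccontr)
        assume "f \<noteq> e"
        then have "f \<in> M'" "f \<noteq> ?N1" "f \<noteq> ?N3" using f by auto
        then show False
          using True unique[of x f ?N1] unique[of x f ?N3] N x f by (auto simp: incident_def)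
      qed
      then show ?thesis using True by blast
    next
      case False
      then have "f \<in> ?M \<and> incident x f \<longleftrightarrow> f \<in> M' \<and> incident x f" for f
        using x x_new by (auto simp: incident_def)
      then show ?thesis using cover[of x] x by simp
    qed
    then have "?M \<in> matchings X P" using sub by (simp add: matchings_def)
    moreover have "M' = ear_on e x1 x2 ?M" using N eM' by (auto simp: ear_on_def)
    ultimately show ?thesis by blast
  qed
qed

text \<open>The ear edges betray the kind of extension, and intersecting with the old edges recovers
  the matching up to \<open>e\<close>. Injectivity of the extended \<open>\<Phi>\<close> rests on
  this.\<close>

lemma
  assumes "M \<subseteq> P"
  shows ear_in_off: "(fst e, x1) \<notin> ear_off x1 x2 M" "(x1, x2) \<in> ear_off x1 x2 M"
    and ear_in_on: "(fst e, x1) \<in> ear_on e x1 x2 M" "(x1, x2) \<notin> ear_on e x1 x2 M" "e \<notin> ear_on e x1 x2 M"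
    and off_P: "ear_off x1 x2 M \<inter> P = M"
    and on_P: "ear_on e x1 x2 M \<inter> P = M - {e}"
proof -
  have new: "f \<notin> P" if "f \<in> ear e x1 x2" for f using ear_new that by blast
  then have N: "(fst e, x1) \<notin> P" "(x1, x2) \<notin> P" "(x2, snd e) \<notin> P" by (auto simp: ear_def)
  have ne: "e \<noteq> (fst e, x1)" "e \<noteq> (x2, snd e)" using e N by metis+
  show "(fst e, x1) \<notin> ear_off x1 x2 M" "(x1, x2) \<in> ear_off x1 x2 M"
    "(fst e, x1) \<in> ear_on e x1 x2 M" "(x1, x2) \<notin> ear_on e x1 x2 M" "e \<notin> ear_on e x1 x2 M"
    "ear_off x1 x2 M \<inter> P = M" "ear_on e x1 x2 M \<inter> P = M - {e}"
    using assms N x12 ne by (auto simp: ear_off_def ear_on_def)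
qed

lemma parabola_graph_ear: "parabola_graph (X \<union> {x1, x2}) (P \<union> ear e x1 x2)"
proof
  show "finite (X \<union> {x1, x2})" using finite_X by simp
  have ends: "(a \<in> X \<and> b \<in> X \<and> a < b \<and> (a, b) \<in> P) \<or>
      ((a, b) \<in> ear e x1 x2 \<and> fst e \<le> a \<and> a < b \<and> b \<le> snd e)"
    if "(a, b) \<in> P \<union> ear e x1 x2" for a b
    using that P_ends x12 by (auto simp: ear_def)
  fix a b assume ab: "(a, b) \<in> P \<union> ear e x1 x2"
  then show "a \<in> X \<union> {x1, x2} \<and> b \<in> X \<union> {x1, x2} \<and> a < b"
    using P_ends P_X[OF e] x12 by (auto simp: ear_def)
  fix c d assume cd: "(c, d) \<in> P \<union> ear e x1 x2"
  have old_new: "b \<le> c \<or> d \<le> a \<or> (a \<le> c \<and> d \<le> b)"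
    if "a \<in> X" "b \<in> X" "a < b" "fst e \<le> c" "d \<le> snd e" for a b c d
    using e_hull[OF that(1)] e_hull[OF that(2)] that by auto
  show "b \<le> c \<or> d \<le> a \<or> (a \<le> c \<and> d \<le> b) \<or> (c \<le> a \<and> b \<le> d)"
    using ends[OF ab] ends[OF cd]
  proof (elim disjE)
    assume "a \<in> X \<and> b \<in> X \<and> a < b \<and> (a, b) \<in> P" "c \<in> X \<and> d \<in> X \<and> c < d \<and> (c, d) \<in> P"
    then show ?thesis using P_noncrossing by blast
  next
    assume "(a, b) \<in> ear e x1 x2 \<and> fst e \<le> a \<and> a < b \<and> b \<le> snd e"
      "(c, d) \<in> ear e x1 x2 \<and> fst e \<le> c \<and> c < d \<and> d \<le> snd e"
    then show ?thesis using x12 by (auto simp: ear_def)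
  qed (use old_new in auto)
qed

text \<open>The new vertices lie in the open gap of \<open>e\<close>, and the gaps of distinct lower
  edges are disjoint.\<close>

lemma hull_edge_persists:
  assumes "f \<in> P" "f \<noteq> e" "\<And>x. x \<in> X \<Longrightarrow> x \<le> fst f \<or> snd f \<le> x" "x \<in> X \<union> {x1, x2}"
  shows "x \<le> fst f \<or> snd f \<le> x"
proof (cases "x \<in> X")
  case False
  then have x: "fst e < x" "x < snd e" using assms(4) x12 by auto
  have "f \<noteq> e \<Longrightarrow> fst f \<noteq> fst e \<or> snd f \<noteq> snd e" by (simp add: prod_eq_iff)
  then show ?thesis
    using x assms(2) assms(3)[of "fst e"] assms(3)[of "snd e"] e_hull[of "fst f"] e_hull[of "snd f"]
      P_X[OF e] P_X[OF assms(1)] by linarith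
qed (use assms in auto)

end

section \<open>Drawings of trees\<close>

lemma consec_insert2:
  assumes "e \<in> consec Q" "fst e < x1" "x1 < x2" "x2 < snd e"
  shows "consec (Q \<union> {x1, x2}) = consec Q - {e} \<union> ear e x1 x2"
proof -
  obtain s t where e: "e = (s, t)" by fastforce
  have st: "s \<in> Q" "t \<in> Q" "s < x1" "x1 < x2" "x2 < t" and gap: "\<And>c. c \<in> Q \<Longrightarrow> c \<le> s \<or> t \<le> c"
    using assms by (auto simp: e consec_def)
  have no: "x1 \<notin> Q" "x2 \<notin> Q" using gap st by force+
  show ?thesis
  proof (intro equalityI subsetI)
    fix f assume "f \<in> consec (Q \<union> {x1, x2})"
    moreover obtain a b where f: "f = (a, b)" by fastforce
    ultimately have ab: "a \<in> Q \<union> {x1, x2}" "b \<in> Q \<union> {x1, x2}" "a < b"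
      and g: "\<And>c. c \<in> Q \<union> {x1, x2} \<Longrightarrow> c \<le> a \<or> b \<le> c" by (auto simp: consec_def)
    note gs = g[of s] g[of t] g[of x1] g[of x2]
    show "f \<in> consec Q - {e} \<union> ear e x1 x2"
    proof (cases "a \<in> Q \<and> b \<in> Q")
      case True
      moreover have "(a, b) \<noteq> (s, t)" using gs(3) st by auto
      ultimately show ?thesis using ab(3) g unfolding f e by (simp add: consec_def)
    next
      case False
      then consider "a = x1" | "a = x2" | "b = x1" "a \<in> Q" | "b = x2" "a \<in> Q" using ab by blast
      then show ?thesis
      proof cases
        case 1
        then have "b = x2" using gs ab gap[of b] st by force
        then show ?thesis using 1 by (simp add: f ear_def)
      next
        case 2
        then have "b = t" using gs ab gap[of b] st by force
        then show ?thesis using 2 by (simp add: f e ear_def)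
      next
        case 3
        then have "a = s" using gs ab gap[of a] st by force
        then show ?thesis using 3 by (simp add: f e ear_def)
      next
        case 4
        then show ?thesis using gs ab gap[of a] st by force
      qed
    qed
  next
    fix f assume "f \<in> consec Q - {e} \<union> ear e x1 x2"
    then show "f \<in> consec (Q \<union> {x1, x2})"
    proof
      assume f: "f \<in> consec Q - {e}"
      obtain a b where ab: "f = (a, b)" by fastforce
      have "a \<in> Q" "b \<in> Q" "a < b" and g: "\<And>c. c \<in> Q \<Longrightarrow> c \<le> a \<or> b \<le> c" and ne: "a \<noteq> s \<or> b \<noteq> t"
        using f by (auto simp: ab e consec_def)
      moreover from this have "b \<le> s \<or> t \<le> a"
        using gap[of a] gap[of b] g[of s] g[of t] st by force
      ultimately show ?thesis using st by (auto simp: ab consec_def)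
    next
      assume "f \<in> ear e x1 x2"
      then show ?thesis using st gap by (force simp: ear_def e consec_def)
    qed
  qed
qed

text \<open>A third point would lie strictly between the ends. Hence subdividing a lower edge leaves
  the top chord alone.\<close>

lemma consec_ne_ends:
  assumes "finite Q" "3 \<le> card Q" "e \<in> consec Q"
  shows "e \<noteq> (Min Q, Max Q)"
proof
  assume "e = (Min Q, Max Q)"
  then have "c \<le> Min Q \<or> Max Q \<le> c" if "c \<in> Q" for c using assms(3) that by (auto simp: consec_def)
  then have "Q \<subseteq> {Min Q, Max Q}" using assms(1) by (force intro: antisym)
  then have "card Q \<le> card {Min Q, Max Q}" by (intro card_mono) auto
  also have "\<dots> \<le> 2" by (simp add: card_insert_if)
  finally show False using assms(2) by simp
qed

lemma
  assumes "finite Q" "3 \<le> card Q" "e \<in> consec Q" "fst e < x1" "x1 < x2" "x2 < snd e"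
  shows Min_insert2: "Min (Q \<union> {x1, x2}) = Min Q" and Max_insert2: "Max (Q \<union> {x1, x2}) = Max Q"
    and polygon_edges_insert2: "polygon_edges (Q \<union> {x1, x2}) = polygon_edges Q - {e} \<union> ear e x1 x2"
proof -
  have ne: "Q \<noteq> {}" using assms by auto
  have "fst e \<in> Q" "snd e \<in> Q" using assms by (auto simp: consec_def)
  then have b: "Min Q \<le> fst e" "snd e \<le> Max Q" using assms(1) by auto
  show mi: "Min (Q \<union> {x1, x2}) = Min Q"
    by (rule Min_eqI) (use assms ne b in \<open>auto intro: order_trans[OF Min_le]\<close>)
  show ma: "Max (Q \<union> {x1, x2}) = Max Q"
    by (rule Max_eqI) (use assms ne b in \<open>auto intro: order_trans[OF _ Max_ge]\<close>)
  show "polygon_edges (Q \<union> {x1, x2}) = polygon_edges Q - {e} \<union> ear e x1 x2"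
    using consec_ne_ends[OF assms(1-3)] unfolding polygon_edges_def mi ma consec_insert2[OF assms(3-6)]
    by blast
qed

lemma sym_diff_exchange:
  assumes "n1 \<noteq> n2" "n2 \<noteq> n3" "{n1, n2, n3} \<inter> (M \<union> M') = {}" "e \<in> M" "e \<notin> M'"
  shows "((M - {e} \<union> {n1, n3}) - insert n2 M') \<union> (insert n2 M' - (M - {e} \<union> {n1, n3})) =
    (M - M') \<union> (M' - M) - {e} \<union> {n1, n2, n3}"
  using assms by auto

context ear_graph
begin

lemma ear_distinct: "(fst e, x1) \<noteq> (x1, x2)" "(x1, x2) \<noteq> (x2, snd e)"
  using x12 by auto

lemma ear_disjoint: "M \<subseteq> P \<Longrightarrow> M' \<subseteq> P \<Longrightarrow> {(fst e, x1), (x1, x2), (x2, snd e)} \<inter> (M \<union> M') = {}"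
  using ear_new unfolding ear_def by blast

text \<open>Serves the polygon whose edge \<open>e\<close> is subdivided: its rotation now passes
  through the ear in place of \<open>e\<close>.\<close>

lemma sym_diff_on_off:
  assumes "M \<subseteq> P" "M' \<subseteq> P" "e \<in> M" "e \<notin> M'"
  shows "(ear_on e x1 x2 M - ear_off x1 x2 M') \<union> (ear_off x1 x2 M' - ear_on e x1 x2 M) =
    (M - M') \<union> (M' - M) - {e} \<union> ear e x1 x2"
  unfolding ear_on_def ear_off_def ear_def
  by (rule sym_diff_exchange[OF ear_distinct ear_disjoint[OF assms(1,2)] assms(3,4)])

text \<open>Serves a new leaf: switching between the two extensions of one matching rotates exactly
  the new quadrilateral.\<close>

lemma sym_diff_on_off_same:
  assumes "M \<subseteq> P" "e \<in> M"
  shows "(ear_on e x1 x2 M - ear_off x1 x2 M) \<union> (ear_off x1 x2 M - ear_on e x1 x2 M) =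
    insert e (ear e x1 x2)"
proof -
  have "((M - {e} \<union> {n1, n3}) - insert n2 M) \<union> (insert n2 M - (M - {e} \<union> {n1, n3})) = {e, n1, n2, n3}"
    if "n1 \<noteq> n2" "n2 \<noteq> n3" "{n1, n2, n3} \<inter> (M \<union> M) = {}" for n1 n2 n3
    using that assms(2) by auto
  from this[OF ear_distinct ear_disjoint[OF assms(1) assms(1)]] show ?thesis
    by (simp add: ear_on_def ear_off_def ear_def)
qed

lemma sym_diff_on_on:
  assumes "M \<subseteq> P" "M' \<subseteq> P" "e \<in> M \<longleftrightarrow> e \<in> M'"
  shows "(ear_on e x1 x2 M - ear_on e x1 x2 M') \<union> (ear_on e x1 x2 M' - ear_on e x1 x2 M) =
    (M - M') \<union> (M' - M)"
  unfolding ear_on_def using assms(3) ear_disjoint[OF assms(1,2)] by blast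

lemma sym_diff_off_off:
  assumes "M \<subseteq> P" "M' \<subseteq> P"
  shows "(ear_off x1 x2 M - ear_off x1 x2 M') \<union> (ear_off x1 x2 M' - ear_off x1 x2 M) =
    (M - M') \<union> (M' - M)"
  unfolding ear_off_def using ear_disjoint[OF assms(1,2)] by blast

end

text \<open>The four positions of a chord that keeps out of the open polygon: to the right, to the
  left, over the top, or under one lower edge. The sides themselves are included.\<close>

definition beyond_polygon :: "real set \<Rightarrow> real \<times> real \<Rightarrow> bool" where
  "beyond_polygon Q f \<longleftrightarrow> Max Q \<le> fst f \<or> snd f \<le> Min Q \<or> (fst f \<le> Min Q \<and> Max Q \<le> snd f) \<or>
     (\<exists>(a, b)\<in>consec Q. a \<le> fst f \<and> snd f \<le> b)"

text \<open>A drawing whose inner faces are convex polygons with vertex sets \<open>Q v\<close>, one for every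
  vertex \<open>v\<close> of the tree; \<open>q v\<close> is an edge on the outer boundary that tells from a matching
  \<open>\<Phi> I\<close> whether \<open>v\<close> belongs to the ideal \<open>I\<close>.\<close>

locale tree_drawing = parabola_graph X P
  for X :: "real set" and P :: "(real \<times> real) set" +
  fixes V :: "'v set" and A :: "('v \<times> 'v) set" and W :: "real set"
    and Q :: "'v \<Rightarrow> real set" and q :: "'v \<Rightarrow> real \<times> real" and \<Phi> :: "'v set \<Rightarrow> (real \<times> real) set"
  assumes W_X: "W \<subseteq> X" and colour: "(a, b) \<in> P \<Longrightarrow> (a \<in> W) \<noteq> (b \<in> W)"
    and Q_X: "v \<in> V \<Longrightarrow> Q v \<subseteq> X" and Q_card: "v \<in> V \<Longrightarrow> 3 \<le> card (Q v)"
    and Q_P: "v \<in> V \<Longrightarrow> polygon_edges (Q v) \<subseteq> P"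
    and Q_beyond: "v \<in> V \<Longrightarrow> f \<in> P \<Longrightarrow> beyond_polygon (Q v) f"
    and q_consec: "v \<in> V \<Longrightarrow> q v \<in> consec (Q v)"
    and q_hull: "v \<in> V \<Longrightarrow> x \<in> X \<Longrightarrow> x \<le> fst (q v) \<or> snd (q v) \<le> x"
    and q_colour: "v \<in> V \<Longrightarrow> fst (q v) \<notin> W \<and> snd (q v) \<in> W"
    and q_private: "v \<in> V \<Longrightarrow> v' \<in> V \<Longrightarrow> q v \<in> polygon_edges (Q v') \<Longrightarrow> v = v'"
    and bij_\<Phi>: "bij_betw \<Phi> (closed_sets V A) (matchings X P)"
    and \<Phi>_flip: "\<lbrakk>v \<in> V; v \<notin> J; J \<in> closed_sets V A; insert v J \<in> closed_sets V A\<rbrakk> \<Longrightarrow>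
      (\<Phi> (insert v J) - \<Phi> J) \<union> (\<Phi> J - \<Phi> (insert v J)) = polygon_edges (Q v)"
    and \<Phi>_q: "\<lbrakk>v \<in> V; I \<in> closed_sets V A\<rbrakk> \<Longrightarrow> q v \<in> \<Phi> I \<longleftrightarrow> v \<in> I"
begin

lemma finite_Q: "v \<in> V \<Longrightarrow> finite (Q v)"
  using Q_X finite_X by (blast intro: finite_subset)

lemma q_P: "v \<in> V \<Longrightarrow> q v \<in> P"
  using q_consec Q_P by (force simp: polygon_edges_def)

lemma q_polygon: "v \<in> V \<Longrightarrow> q v \<in> polygon_edges (Q v)"
  using q_consec by (simp add: polygon_edges_def)

lemma \<Phi>_matching: "I \<in> closed_sets V A \<Longrightarrow> \<Phi> I \<in> matchings X P"
  using bij_\<Phi> by (auto simp: bij_betw_def)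

lemma \<Phi>_sub: "I \<in> closed_sets V A \<Longrightarrow> \<Phi> I \<subseteq> P"
  using \<Phi>_matching by (auto simp: matchings_def)

text \<open>The ear edges lie in the gap of \<open>e\<close> and inherit its position, unless
  \<open>e\<close> spans the polygon from above. In that case all vertices of the polygon would be
  ends of \<open>e\<close>, which are too few.\<close>

lemma ear_beyond:
  assumes g: "ear_graph X P e x1 x2" and v: "v \<in> V" and f: "f \<in> P \<union> ear e x1 x2"
  shows "beyond_polygon (Q v) f"
proof (cases "f \<in> P")
  case True
  then show ?thesis using Q_beyond v by blast
next
  case False
  interpret ear_graph X P e x1 x2 by (rule g)
  have fe: "fst e \<le> fst f" "snd f \<le> snd e" using f False x12 by (auto simp: ear_def)
  have "\<not> (fst e \<le> Min (Q v) \<and> Max (Q v) \<le> snd e)"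
  proof
    assume a: "fst e \<le> Min (Q v) \<and> Max (Q v) \<le> snd e"
    have "Q v \<subseteq> {fst e, snd e}"
    proof
      fix x assume x: "x \<in> Q v"
      then have "Min (Q v) \<le> x" "x \<le> Max (Q v)" using finite_Q[OF v] by auto
      then show "x \<in> {fst e, snd e}" using a e_hull[of x] Q_X[OF v] x by force
    qed
    then have "card (Q v) \<le> card {fst e, snd e}" by (intro card_mono) auto
    also have "\<dots> \<le> 2" by (simp add: card_insert_if)
    finally show False using Q_card[OF v] by simp
  qed
  then show ?thesis using Q_beyond[OF v e] fe unfolding beyond_polygon_def by force
qed

text \<open>Makes room for a leaf at \<open>u\<close>. Whether \<open>q u\<close> was matched
  dictates \<open>ear_on\<close> or \<open>ear_off\<close>, so matchings correspond one to one, and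
  the left third takes over the role of \<open>q u\<close>. Since \<open>q u\<close> is a side of no
  other polygon, the other rotations are unaffected.\<close>

lemma subdivide_q:
  assumes u: "u \<in> V" and x12: "fst (q u) < x1" "x1 < x2" "x2 < snd (q u)"
  defines "X' \<equiv> X \<union> {x1, x2}" and "P' \<equiv> P - {q u} \<union> ear (q u) x1 x2"
    and "\<Phi>' \<equiv> \<lambda>I. if q u \<in> \<Phi> I then ear_on (q u) x1 x2 (\<Phi> I) else ear_off x1 x2 (\<Phi> I)"
  shows "tree_drawing X' P' V A (insert x1 W) (Q(u := Q u \<union> {x1, x2})) (q(u := (fst (q u), x1))) \<Phi>'"
proof -
  let ?e = "q u"
  interpret ear: ear_graph X P ?e x1 x2
    using q_P[OF u] q_hull[OF u] x12 by unfold_locales auto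
  interpret G: parabola_graph X' "P \<union> ear ?e x1 x2"
    unfolding X'_def by (rule ear.parabola_graph_ear)
  have P'_sub: "P' \<subseteq> P \<union> ear ?e x1 x2" by (auto simp: P'_def)
  interpret G': parabola_graph X' P'
    using G.finite_X G.P_ends G.P_noncrossing P'_sub by unfold_locales blast+
  have e_other: "?e \<notin> polygon_edges (Q v)" if "v \<in> V" "v \<noteq> u" for v using q_private[OF u] that by blast
  have q_other: "q v \<noteq> ?e" if "v \<in> V" "v \<noteq> u" for v using e_other[OF that] q_polygon that by metis
  have N: "(fst ?e, x1) \<notin> P" "(x1, x2) \<notin> P" "(x2, snd ?e) \<notin> P" using ear.ear_new by (auto simp: ear_def)
  note ins = Min_insert2[OF finite_Q[OF u] Q_card[OF u] q_consec[OF u] x12]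
    Max_insert2[OF finite_Q[OF u] Q_card[OF u] q_consec[OF u] x12]
    polygon_edges_insert2[OF finite_Q[OF u] Q_card[OF u] q_consec[OF u] x12]
    consec_insert2[OF q_consec[OF u] x12]
  show ?thesis
  proof
    show "insert x1 W \<subseteq> X'" using W_X by (auto simp: X'_def)
    show "(a \<in> insert x1 W) \<noteq> (b \<in> insert x1 W)" if "(a, b) \<in> P'" for a b
    proof (cases "(a, b) \<in> P")
      case True
      then show ?thesis using colour ear.P_X ear.x_new by force
    next
      case False
      then show ?thesis using that q_colour[OF u] W_X ear.x_new x12 unfolding P'_def ear_def by auto
    qed
    fix v assume v: "v \<in> V"
    show "(Q(u := Q u \<union> {x1, x2})) v \<subseteq> X'" using Q_X[OF v] Q_X[OF u] by (auto simp: X'_def)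
    have "card (Q u) \<le> card (Q u \<union> {x1, x2})" using finite_Q[OF u] by (intro card_mono) auto
    then show "3 \<le> card ((Q(u := Q u \<union> {x1, x2})) v)" using Q_card[OF v] Q_card[OF u] by auto
    show "polygon_edges ((Q(u := Q u \<union> {x1, x2})) v) \<subseteq> P'"
      using ins(3) Q_P[OF v] Q_P[OF u] e_other[OF v] by (auto simp: P'_def)
    show "beyond_polygon ((Q(u := Q u \<union> {x1, x2})) v) f" if f: "f \<in> P'" for f
    proof (cases "v = u")
      case False
      then show ?thesis using ear_beyond[OF ear.ear_graph_axioms v subsetD[OF P'_sub f]] by simp
    next
      case True
      have "beyond_polygon (Q u \<union> {x1, x2}) f"
      proof (cases "f \<in> ear ?e x1 x2")
        case True
        then have "f \<in> consec (Q u \<union> {x1, x2})" using ins(4) by simp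
        then show ?thesis unfolding beyond_polygon_def by force
      next
        case False
        then have fP: "f \<in> P" "f \<noteq> ?e" using f by (auto simp: P'_def)
        have "(a, b) \<in> consec (Q u \<union> {x1, x2})" if "(a, b) \<in> consec (Q u)" "a \<le> fst f" "snd f \<le> b" for a b
        proof -
          \<comment> \<open>Only \<open>q u\<close> itself fits under \<open>q u\<close>, because
            its gap contains no vertex.\<close>
          have "(a, b) \<noteq> ?e"
          proof
            assume ab: "(a, b) = ?e"
            then have "fst ?e \<le> fst f" "snd f \<le> snd ?e" using that by (metis fst_conv, metis snd_conv)
            moreover have "fst f < snd f" "fst f \<in> X" "snd f \<in> X" using ear.P_X[OF fP(1)] by auto
            ultimately have "fst f = fst ?e" "snd f = snd ?e" using q_hull[OF u] by force+
            then show False using fP(2) by (simp add: prod_eq_iff)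
          qed
          then show ?thesis using that ins(4) by blast
        qed
        then show ?thesis using Q_beyond[OF u fP(1)] unfolding beyond_polygon_def ins(1,2) by blast
      qed
      then show ?thesis using True by simp
    qed
    show "(q(u := (fst ?e, x1))) v \<in> consec ((Q(u := Q u \<union> {x1, x2})) v)"
      using q_consec[OF v] ins(4) by (auto simp: ear_def)
    show "x \<le> fst ((q(u := (fst ?e, x1))) v) \<or> snd ((q(u := (fst ?e, x1))) v) \<le> x" if "x \<in> X'" for x
      using that ear.hull_edge_persists[OF q_P[OF v] q_other[OF v] q_hull[OF v], of x] q_hull[OF u, of x] x12
      by (auto simp: X'_def)
    show "fst ((q(u := (fst ?e, x1))) v) \<notin> insert x1 W \<and> snd ((q(u := (fst ?e, x1))) v) \<in> insert x1 W"
      using q_colour[OF v] ear.P_X[OF q_P[OF v]] ear.x_new by auto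
    show "v = v'" if "v' \<in> V" "(q(u := (fst ?e, x1))) v \<in> polygon_edges ((Q(u := Q u \<union> {x1, x2})) v')" for v'
    proof (cases "v = u")
      case True
      then show ?thesis using that N Q_P[of v'] by (auto split: if_splits)
    next
      case False
      have "q v \<notin> ear ?e x1 x2" using q_P[OF v] ear.ear_new by blast
      then show ?thesis using False that q_private[OF v, of v'] q_private[OF v u] ins(3) by (auto split: if_splits)
    qed
    show "(\<Phi>' (insert v J) - \<Phi>' J) \<union> (\<Phi>' J - \<Phi>' (insert v J)) = polygon_edges ((Q(u := Q u \<union> {x1, x2})) v)"
      if J: "v \<notin> J" "J \<in> closed_sets V A" "insert v J \<in> closed_sets V A" for J
    proof -
      note flip = \<Phi>_flip[OF v J]
      have sub: "\<Phi> J \<subseteq> P" "\<Phi> (insert v J) \<subseteq> P" using \<Phi>_sub J by auto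
      show ?thesis
      proof (cases "v = u")
        case True
        then have eJ: "?e \<in> \<Phi> (insert v J)" "?e \<notin> \<Phi> J" using \<Phi>_q[OF u] J by auto
        then have "(\<Phi>' (insert v J) - \<Phi>' J) \<union> (\<Phi>' J - \<Phi>' (insert v J)) =
          ((\<Phi> (insert v J) - \<Phi> J) \<union> (\<Phi> J - \<Phi> (insert v J))) - {?e} \<union> ear ?e x1 x2"
          using ear.sym_diff_on_off[OF sub(2,1) eJ] by (simp add: \<Phi>'_def)
        then show ?thesis unfolding flip using True ins(3) by simp
      next
        case False
        then have eJ: "?e \<in> \<Phi> (insert v J) \<longleftrightarrow> ?e \<in> \<Phi> J" using \<Phi>_q[OF u] J by auto
        then have "(\<Phi>' (insert v J) - \<Phi>' J) \<union> (\<Phi>' J - \<Phi>' (insert v J)) =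
          (\<Phi> (insert v J) - \<Phi> J) \<union> (\<Phi> J - \<Phi> (insert v J))"
          using ear.sym_diff_on_on[OF sub(2,1) eJ] ear.sym_diff_off_off[OF sub(2,1)] by (simp add: \<Phi>'_def)
        then show ?thesis unfolding flip using False by simp
      qed
    qed
    show "(q(u := (fst ?e, x1))) v \<in> \<Phi>' I \<longleftrightarrow> v \<in> I" if I: "I \<in> closed_sets V A" for I
    proof (cases "v = u")
      case True
      then show ?thesis
        using \<Phi>_q[OF u I] ear.ear_in_off(1)[OF \<Phi>_sub[OF I]] ear.ear_in_on(1)[OF \<Phi>_sub[OF I]]
        by (auto simp: \<Phi>'_def)
    next
      case False
      then have "q v \<in> \<Phi>' I \<longleftrightarrow> q v \<in> \<Phi> I"
        using q_P[OF v] N q_other[OF v] by (auto simp: \<Phi>'_def ear_on_def ear_off_def)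
      then show ?thesis using False \<Phi>_q[OF v I] by simp
    qed
  next
    let ?sub = "\<lambda>M. if ?e \<in> M then ear_on ?e x1 x2 M else ear_off x1 x2 M"
    have "inj_on ?sub (matchings X P)"
    proof (rule inj_onI)
      fix M1 M2 assume M: "M1 \<in> matchings X P" "M2 \<in> matchings X P" and eq: "?sub M1 = ?sub M2"
      then have sub: "M1 \<subseteq> P" "M2 \<subseteq> P" by (auto simp: matchings_def)
      have "?e \<in> M1 \<longleftrightarrow> ?e \<in> M2"
        using eq ear.ear_in_off(1)[OF sub(1)] ear.ear_in_on(1)[OF sub(1)]
          ear.ear_in_off(1)[OF sub(2)] ear.ear_in_on(1)[OF sub(2)] by (auto split: if_splits)
      moreover have "?sub M1 \<inter> P = ?sub M2 \<inter> P" using eq by simp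
      ultimately show "M1 = M2"
        using ear.off_P[OF sub(1)] ear.off_P[OF sub(2)] ear.on_P[OF sub(1)] ear.on_P[OF sub(2)]
        by (auto split: if_splits)
    qed
    moreover have "?sub ` matchings X P = matchings X' P'"
    proof (intro equalityI subsetI)
      fix M' assume "M' \<in> ?sub ` matchings X P"
      then obtain M where M: "M \<in> matchings X P" "M' = ?sub M" by blast
      then have sub: "M \<subseteq> P" by (auto simp: matchings_def)
      have "M' \<in> matchings X' (P \<union> ear ?e x1 x2)"
        using M ear.ear_on_matching ear.ear_off_matching by (auto simp: X'_def)
      moreover have "?e \<notin> M'"
        using M(2) ear.ear_in_on(3)[OF sub] N q_P[OF u] by (auto simp: ear_off_def)
      ultimately show "M' \<in> matchings X' P'" by (auto simp: matchings_def P'_def)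
    next
      fix M' assume M': "M' \<in> matchings X' P'"
      have "?e \<notin> P'" using N q_P[OF u] ear.ear_new by (auto simp: P'_def)
      then have "?e \<notin> M'" using M' by (auto simp: matchings_def)
      moreover have "M' \<in> matchings (X \<union> {x1, x2}) (P \<union> ear ?e x1 x2)"
        using M' P'_sub by (auto simp: matchings_def X'_def)
      then have "(\<exists>M\<in>matchings X P. M' = ear_off x1 x2 M) \<or>
          (\<exists>M\<in>matchings X P. ?e \<in> M \<and> M' = ear_on ?e x1 x2 M)" by (rule ear.ear_matching_cases)
      \<comment> \<open>If \<open>M'\<close> arises by \<open>ear_off\<close>, then \<open>M\<close>
        avoids the deleted edge as well, so the case distinction in \<open>?sub\<close>
        agrees.\<close>
      ultimately have "\<exists>M\<in>matchings X P. M' = ?sub M" by (fastforce simp: ear_off_def)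
      then show "M' \<in> ?sub ` matchings X P" by blast
    qed
    ultimately have "bij_betw ?sub (matchings X P) (matchings X' P')" by (simp add: bij_betw_def)
    from bij_betw_trans[OF bij_\<Phi> this] show "bij_betw \<Phi>' (closed_sets V A) (matchings X' P')"
      by (simp add: \<Phi>'_def comp_def)
  qed
qed

text \<open>The new quadrilateral can rotate only where \<open>e\<close> is matched. The flag
  \<open>\<sigma>\<close> says whether \<open>ear_on\<close> means that \<open>w\<close> is in or
  out of the ideal. It follows the colour of \<open>snd e\<close>, because the ear edge chosen as
  \<open>q w\<close> must be matched exactly when \<open>w\<close> is in and must have a white right
  end. Stating \<open>closed\<close> through \<open>e\<close> covers both directions of the arc and
  the very first vertex.\<close>

lemma attach_polygon:
  assumes w: "w \<notin> V" and g: "ear_graph X P e x1 x2" and e_q: "\<And>v. v \<in> V \<Longrightarrow> e \<noteq> q v"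
    and colour_e: "snd e \<in> W \<longleftrightarrow> \<sigma>"
    and closed: "\<And>I. I \<in> closed_sets (insert w V) A' \<longleftrightarrow>
      I \<subseteq> insert w V \<and> I - {w} \<in> closed_sets V A \<and> ((w \<in> I) = \<sigma> \<longrightarrow> e \<in> \<Phi> (I - {w}))"
  defines "\<Phi>' \<equiv> \<lambda>I. if (w \<in> I) = \<sigma> then ear_on e x1 x2 (\<Phi> (I - {w})) else ear_off x1 x2 (\<Phi> (I - {w}))"
  shows "tree_drawing (X \<union> {x1, x2}) (P \<union> ear e x1 x2) (insert w V) A'
    (insert (if \<sigma> then x1 else x2) W) (Q(w := {fst e, snd e} \<union> {x1, x2}))
    (q(w := (if \<sigma> then (fst e, x1) else (x1, x2)))) \<Phi>'"
proof -
  interpret ear: ear_graph X P e x1 x2 by (rule g)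
  interpret G: parabola_graph "X \<union> {x1, x2}" "P \<union> ear e x1 x2" by (rule ear.parabola_graph_ear)
  note x12 = ear.x12 and e = ear.e
  let ?Q = "Q(w := {fst e, snd e} \<union> {x1, x2})" and ?q = "q(w := (if \<sigma> then (fst e, x1) else (x1, x2)))"
  have N: "(fst e, x1) \<notin> P" "(x1, x2) \<notin> P" "(x2, snd e) \<notin> P" using ear.ear_new by (auto simp: ear_def)
  have lt: "fst e < snd e" using x12 by simp
  have "e \<in> consec {fst e, snd e}" "consec {fst e, snd e} - {e} = {}"
    using lt by (auto simp: consec_def)
  from consec_insert2[OF this(1) x12] this(2)
  have consec: "consec ({fst e, snd e} \<union> {x1, x2}) = ear e x1 x2" by simp
  have mi: "Min ({fst e, snd e} \<union> {x1, x2}) = fst e" and ma: "Max ({fst e, snd e} \<union> {x1, x2}) = snd e"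
    using x12 by (auto intro!: Min_eqI Max_eqI)
  have pe: "polygon_edges ({fst e, snd e} \<union> {x1, x2}) = insert e (ear e x1 x2)"
    unfolding polygon_edges_def mi ma consec by simp
  have \<Phi>': "\<Phi> (I - {w}) \<subseteq> P" "(w \<in> I) = \<sigma> \<Longrightarrow> e \<in> \<Phi> (I - {w})" if "I \<in> closed_sets (insert w V) A'" for I
    using that closed[of I] \<Phi>_sub by auto
  show ?thesis
  proof
    show "insert (if \<sigma> then x1 else x2) W \<subseteq> X \<union> {x1, x2}" using W_X by auto
    show "(a \<in> insert (if \<sigma> then x1 else x2) W) \<noteq> (b \<in> insert (if \<sigma> then x1 else x2) W)"
      if "(a, b) \<in> P \<union> ear e x1 x2" for a b
    proof (cases "(a, b) \<in> P")
      case True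
      then show ?thesis using colour ear.P_X[OF True] ear.x_new by auto
    next
      case False
      have "fst e \<in> W \<longleftrightarrow> \<not> \<sigma>" using colour[of "fst e" "snd e"] e colour_e by simp
      moreover have "fst e \<noteq> x1" "fst e \<noteq> x2" "snd e \<noteq> x1" "snd e \<noteq> x2" "x1 \<noteq> x2" "x1 \<notin> W" "x2 \<notin> W"
        using x12 ear.x_new W_X by auto
      ultimately show ?thesis using that False colour_e by (auto simp: ear_def)
    qed
    fix v assume v: "v \<in> insert w V"
    show "?Q v \<subseteq> X \<union> {x1, x2}" using v Q_X ear.P_X[OF e] by auto
    have "card ({fst e, snd e} \<union> {x1, x2}) = 4" using x12 by simp
    then show "3 \<le> card (?Q v)" using v Q_card by auto
    show "polygon_edges (?Q v) \<subseteq> P \<union> ear e x1 x2" using v Q_P pe e by auto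
    show "beyond_polygon (?Q v) f" if f: "f \<in> P \<union> ear e x1 x2" for f
    proof (cases "v = w")
      case False
      then show ?thesis using ear_beyond[OF g _ f, of v] v by simp
    next
      case True
      have "beyond_polygon ({fst e, snd e} \<union> {x1, x2}) f"
      proof (cases "f \<in> ear e x1 x2")
        case True
        then show ?thesis unfolding beyond_polygon_def consec by force
      next
        case False
        then have fX: "fst f \<in> X" "snd f \<in> X" "fst f < snd f" using f ear.P_X by auto
        show ?thesis unfolding beyond_polygon_def mi ma
          using ear.e_hull[OF fX(1)] ear.e_hull[OF fX(2)] fX(3) by auto
      qed
      then show ?thesis using True by simp
    qed
    show "?q v \<in> consec (?Q v)" using v q_consec consec by (auto simp: ear_def)
    show "x \<le> fst (?q v) \<or> snd (?q v) \<le> x" if x: "x \<in> X \<union> {x1, x2}" for x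
    proof (cases "v = w")
      case True
      then show ?thesis using x ear.e_hull[of x] x12 by auto
    next
      case False
      then have v: "v \<in> V" using v by simp
      show ?thesis
        using ear.hull_edge_persists[OF q_P[OF v] e_q[OF v, symmetric] q_hull[OF v] x] False by simp
    qed
    show "fst (?q v) \<notin> insert (if \<sigma> then x1 else x2) W \<and> snd (?q v) \<in> insert (if \<sigma> then x1 else x2) W"
    proof (cases "v = w")
      case True
      have "fst e \<in> W \<longleftrightarrow> \<not> \<sigma>" using colour[of "fst e" "snd e"] e colour_e by simp
      moreover have "x1 \<notin> W" using ear.x_new W_X by auto
      ultimately show ?thesis using True x12 by auto
    next
      case False
      then show ?thesis using v q_colour[of v] ear.P_X[OF q_P, of v] ear.x_new by auto
    qed
    show "v = v'" if v': "v' \<in> insert w V" "?q v \<in> polygon_edges (?Q v')" for v'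
    proof (cases "v = w"; cases "v' = w")
      assume "v \<noteq> w" "v' = w"
      then have "v \<in> V" "q v \<in> insert e (ear e x1 x2)" using v v' pe by auto
      then show ?thesis using e_q q_P ear.ear_new by blast
    next
      assume "v = w" "v' \<noteq> w"
      then have "?q w \<in> P" using v' Q_P[of v'] by auto
      then show ?thesis using N by (simp split: if_splits)
    next
      assume "v \<noteq> w" "v' \<noteq> w"
      then show ?thesis using q_private v v' by auto
    qed simp
    show "(\<Phi>' (insert v J) - \<Phi>' J) \<union> (\<Phi>' J - \<Phi>' (insert v J)) = polygon_edges (?Q v)"
      if J: "v \<notin> J" "J \<in> closed_sets (insert w V) A'" "insert v J \<in> closed_sets (insert w V) A'" for J
    proof (cases "v = w")
      case True
      then have J': "J - {w} = J" "insert v J - {w} = J" using J by auto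
      have mem: "w \<notin> J" "w \<in> insert v J" using True J by auto
      \<comment> \<open>One of the two ideals is in the \<open>ear_on\<close> state, and both have
        the same part in \<open>V\<close>.\<close>
      have "e \<in> \<Phi> J" using \<Phi>'(2)[OF J(2)] \<Phi>'(2)[OF J(3)] J' mem by (cases \<sigma>) auto
      from ear.sym_diff_on_off_same[OF _ this] \<Phi>'(1)[OF J(2)]
      have "(ear_on e x1 x2 (\<Phi> J) - ear_off x1 x2 (\<Phi> J)) \<union> (ear_off x1 x2 (\<Phi> J) - ear_on e x1 x2 (\<Phi> J))
          = insert e (ear e x1 x2)" unfolding J' by blast
      then have "(\<Phi>' (insert v J) - \<Phi>' J) \<union> (\<Phi>' J - \<Phi>' (insert v J)) = insert e (ear e x1 x2)"
        using mem unfolding \<Phi>'_def J' by (cases \<sigma>) (auto simp: Un_commute)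
      then show ?thesis using True pe by simp
    next
      case False
      then have vV: "v \<in> V" using v by simp
      have ins: "insert v J - {w} = insert v (J - {w})" using False by blast
      have "J - {w} \<in> closed_sets V A" "insert v (J - {w}) \<in> closed_sets V A"
        using closed[of J] closed[of "insert v J"] J ins by auto
      from \<Phi>_flip[OF vV _ this] J
      have flip: "(\<Phi> (insert v (J - {w})) - \<Phi> (J - {w})) \<union> (\<Phi> (J - {w}) - \<Phi> (insert v (J - {w}))) = polygon_edges (Q v)"
        by blast
      note sub = \<Phi>'(1)[OF J(2)] \<Phi>'(1)[OF J(3), unfolded ins]
      have iff: "w \<in> insert v J \<longleftrightarrow> w \<in> J" using False by simp
      show ?thesis
      proof (cases "(w \<in> J) = \<sigma>")
        case True
        then have "e \<in> \<Phi> (J - {w})" "e \<in> \<Phi> (insert v (J - {w}))"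
          using \<Phi>'(2)[OF J(2)] \<Phi>'(2)[OF J(3), unfolded ins] iff by auto
        then show ?thesis
          using ear.sym_diff_on_on[OF sub(2,1)] True False flip unfolding \<Phi>'_def ins iff by simp
      next
        case no: False
        then show ?thesis
          using ear.sym_diff_off_off[OF sub(2,1)] False flip unfolding \<Phi>'_def ins iff by simp
      qed
    qed
    show "?q v \<in> \<Phi>' I \<longleftrightarrow> v \<in> I" if I: "I \<in> closed_sets (insert w V) A'" for I
    proof (cases "v = w")
      case True
      note s = \<Phi>'(1)[OF I]
      show ?thesis
        using True ear.ear_in_off[OF s] ear.ear_in_on[OF s] by (auto simp: \<Phi>'_def)
    next
      case False
      then have vV: "v \<in> V" using v by simp
      have "I - {w} \<in> closed_sets V A" using closed I by blast
      from \<Phi>_q[OF vV this] have "q v \<in> \<Phi> (I - {w}) \<longleftrightarrow> v \<in> I" using False by blast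
      moreover have "q v \<in> \<Phi>' I \<longleftrightarrow> q v \<in> \<Phi> (I - {w})"
        using q_P[OF vV] N e_q[OF vV] by (auto simp: \<Phi>'_def ear_on_def ear_off_def)
      ultimately show ?thesis using False by simp
    qed
  next
    have "inj_on \<Phi>' (closed_sets (insert w V) A')"
    proof (rule inj_onI)
      fix I J assume I: "I \<in> closed_sets (insert w V) A'" and J: "J \<in> closed_sets (insert w V) A'"
        and eq: "\<Phi>' I = \<Phi>' J"
      note s = \<Phi>'(1)[OF I] \<Phi>'(1)[OF J]
      have "(x1, x2) \<in> \<Phi>' I \<longleftrightarrow> (w \<in> I) \<noteq> \<sigma>" "(x1, x2) \<in> \<Phi>' J \<longleftrightarrow> (w \<in> J) \<noteq> \<sigma>"
        using ear.ear_in_off(2)[OF s(1)] ear.ear_in_on(2)[OF s(1)]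
          ear.ear_in_off(2)[OF s(2)] ear.ear_in_on(2)[OF s(2)] by (auto simp: \<Phi>'_def)
      then have w: "w \<in> I \<longleftrightarrow> w \<in> J" using eq by auto
      have "\<Phi>' I \<inter> P = \<Phi>' J \<inter> P" using eq by simp
      then have "\<Phi> (I - {w}) = \<Phi> (J - {w})"
        using w \<Phi>'(2)[OF I] \<Phi>'(2)[OF J]
        by (auto simp: \<Phi>'_def ear.off_P[OF s(1)] ear.off_P[OF s(2)] ear.on_P[OF s(1)] ear.on_P[OF s(2)]
            split: if_splits)
      moreover have "I - {w} \<in> closed_sets V A" "J - {w} \<in> closed_sets V A" using closed I J by auto
      ultimately have "I - {w} = J - {w}" using bij_\<Phi> by (auto simp: bij_betw_def dest: inj_onD)
      then show "I = J" using w by blast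
    qed
    moreover have "\<Phi>' ` closed_sets (insert w V) A' = matchings (X \<union> {x1, x2}) (P \<union> ear e x1 x2)"
    proof (intro equalityI subsetI)
      fix M assume "M \<in> \<Phi>' ` closed_sets (insert w V) A'"
      then obtain I where I: "I \<in> closed_sets (insert w V) A'" "M = \<Phi>' I" by blast
      have "\<Phi> (I - {w}) \<in> matchings X P" using closed I \<Phi>_matching by blast
      then show "M \<in> matchings (X \<union> {x1, x2}) (P \<union> ear e x1 x2)"
        using I(2) \<Phi>'(2)[OF I(1)] ear.ear_on_matching ear.ear_off_matching by (auto simp: \<Phi>'_def)
    next
      have pre: "\<exists>I. I \<in> closed_sets V A \<and> \<Phi> I = M" if "M \<in> matchings X P" for M
        using bij_\<Phi> that by (metis bij_betw_def imageE)
      have lift: "(if b then insert w I else I) - {w} = I" "w \<in> (if b then insert w I else I) \<longleftrightarrow> b"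
        "(if b then insert w I else I) \<subseteq> insert w V" if "I \<in> closed_sets V A" for I b
        using that w by (auto simp: closed_sets_def)
      fix M' assume "M' \<in> matchings (X \<union> {x1, x2}) (P \<union> ear e x1 x2)"
      then consider M where "M \<in> matchings X P" "M' = ear_off x1 x2 M"
        | M where "M \<in> matchings X P" "e \<in> M" "M' = ear_on e x1 x2 M"
        using ear.ear_matching_cases by blast
      then show "M' \<in> \<Phi>' ` closed_sets (insert w V) A'"
      proof cases
        case 1
        then obtain I where I: "I \<in> closed_sets V A" "\<Phi> I = M" using pre by blast
        \<comment> \<open>Membership of \<open>w\<close> is set opposite to \<open>\<sigma>\<close>,
          which is the \<open>ear_off\<close> state.\<close>
        let ?I = "if \<not> \<sigma> then insert w I else I"
        have "?I \<in> closed_sets (insert w V) A'" using closed[of ?I] lift[OF I(1), of "\<not> \<sigma>"] I(1) by simp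
        moreover have "M' = \<Phi>' ?I"
          using 1 I lift(1,2)[OF I(1), of "\<not> \<sigma>"] by (simp add: \<Phi>'_def)
        ultimately show ?thesis by blast
      next
        case 2
        then obtain I where I: "I \<in> closed_sets V A" "\<Phi> I = M" using pre by blast
        let ?I = "if \<sigma> then insert w I else I"
        have "?I \<in> closed_sets (insert w V) A'" using closed[of ?I] lift[OF I(1), of \<sigma>] I 2(2) by simp
        moreover have "M' = \<Phi>' ?I"
          using 2 I lift(1,2)[OF I(1), of \<sigma>] by (simp add: \<Phi>'_def)
        ultimately show ?thesis by blast
      qed
    qed
    ultimately show "bij_betw \<Phi>' (closed_sets (insert w V) A') (matchings (X \<union> {x1, x2}) (P \<union> ear e x1 x2))"
      by (simp add: bij_betw_def)
  qed
qed

end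

section \<open>Growing the drawing along the tree\<close>

lemma (in tree_drawing) attach_leaf:
  assumes A: "A \<subseteq> V \<times> V" and u: "u \<in> V" and w: "w \<notin> V"
  shows "\<exists>X' P' W' Q' q' \<Phi>'. tree_drawing X' P' (insert w V)
    (insert (if \<sigma> then (w, u) else (u, w)) A) W' Q' q' \<Phi>'"
proof -
  let ?s = "fst (q u)" and ?t = "snd (q u)"
  have lt: "?s < ?t" using P_ends[of ?s ?t] q_P[OF u] by simp
  obtain x1 where "?s < x1" "x1 < ?t" using dense[OF lt] by blast
  moreover from this obtain x2 where "x1 < x2" "x2 < ?t" using dense by blast
  ultimately have x12: "?s < x1" "x1 < x2" "x2 < ?t" by auto
  let ?X = "X \<union> {x1, x2}" and ?P = "P - {q u} \<union> ear (q u) x1 x2"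
  let ?\<Phi> = "\<lambda>I. if q u \<in> \<Phi> I then ear_on (q u) x1 x2 (\<Phi> I) else ear_off x1 x2 (\<Phi> I)"
  let ?W = "insert x1 W" and ?q = "q(u := (?s, x1))"
  interpret D: tree_drawing ?X ?P V A ?W "Q(u := Q u \<union> {x1, x2})" ?q ?\<Phi>
    by (rule subdivide_q[OF u x12])
  interpret ear: ear_graph X P "q u" x1 x2
    using q_P[OF u] q_hull[OF u] x12 by unfold_locales auto
  \<comment> \<open>After the subdivision the right edge is matched when \<open>u\<close> is in the
    ideal and the middle one when it is not. An arc from \<open>w\<close> to \<open>u\<close>
    demands \<open>u\<close> before \<open>w\<close> may enter; an arc from \<open>u\<close> to
    \<open>w\<close> demands that \<open>u\<close> be out before \<open>w\<close> may leave.\<close>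
  define e where "e = (if \<sigma> then (x2, ?t) else (x1, x2))"
  have N: "(x1, x2) \<notin> P" "(x2, ?t) \<notin> P" using ear.ear_new by (auto simp: ear_def)
  have e_lt: "fst e < snd e" using x12 by (auto simp: e_def)
  obtain y1 where "fst e < y1" "y1 < snd e" using dense[OF e_lt] by blast
  moreover from this obtain y2 where "y1 < y2" "y2 < snd e" using dense by blast
  ultimately have y12: "fst e < y1" "y1 < y2" "y2 < snd e" by auto
  have g: "ear_graph ?X ?P e y1 y2"
  proof
    show "e \<in> ?P" by (simp add: e_def ear_def)
    show "x \<le> fst e \<or> snd e \<le> x" if "x \<in> ?X" for x
      using that q_hull[OF u, of x] x12 by (auto simp: e_def)
  qed (rule y12)+
  have e_q: "e \<noteq> ?q v" if "v \<in> V" for v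
    using q_P[OF that] N x12 by (auto simp: e_def)
  have slot: "e \<in> ?\<Phi> I \<longleftrightarrow> (u \<in> I) = \<sigma>" if I: "I \<in> closed_sets V A" for I
  proof -
    have "\<Phi> I \<subseteq> P" using \<Phi>_sub[OF I] .
    then show ?thesis using \<Phi>_q[OF u I] N x12 by (auto simp: e_def ear_on_def ear_off_def)
  qed
  have colour_e: "snd e \<in> ?W \<longleftrightarrow> \<sigma>"
    using q_colour[OF u] ear.x_new W_X x12 by (auto simp: e_def)
  let ?A = "insert (if \<sigma> then (w, u) else (u, w)) A"
  have "I \<in> closed_sets (insert w V) ?A \<longleftrightarrow>
      I \<subseteq> insert w V \<and> I - {w} \<in> closed_sets V A \<and> ((w \<in> I) = \<sigma> \<longrightarrow> e \<in> ?\<Phi> (I - {w}))" for I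
  proof -
    have "I \<in> closed_sets (insert w V) ?A \<longleftrightarrow>
      I \<subseteq> insert w V \<and> I - {w} \<in> closed_sets V A \<and> ((w \<in> I) = \<sigma> \<longrightarrow> (u \<in> I) = \<sigma>)"
      using A u w unfolding closed_sets_def by (cases \<sigma>) fastforce+
    moreover have "u \<in> I - {w} \<longleftrightarrow> u \<in> I" using u w by blast
    ultimately show ?thesis using slot[of "I - {w}"] by blast
  qed
  from D.attach_polygon[OF w g e_q colour_e this] show ?thesis by blast
qed

text \<open>The start has no tree vertex: one edge with its only matching stands for the empty
  ideal. The first vertex of the tree is then glued like any leaf.\<close>

lemma tree_drawing_single_edge:
  "tree_drawing {0, 3} {(0, 3)} ({} :: 'v set) {} {3} Q q (\<lambda>_. {(0, 3)})"
proof
  have "matchings {0, 3} {(0, 3)} = {{(0, 3)}}"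
    by (auto simp: matchings_def incident_def subset_singleton_iff)
  moreover have "closed_sets ({} :: 'v set) {} = {{}}" by (auto simp: closed_sets_def)
  ultimately show "bij_betw (\<lambda>_. {(0, 3)}) (closed_sets ({} :: 'v set) {}) (matchings {0, 3} {(0, 3)})"
    by (simp add: bij_betw_def)
qed auto

lemma grown_tree_drawing:
  assumes "grown_tree V A"
  shows "\<exists>X P W Q q \<Phi>. tree_drawing X P V A W Q q \<Phi>"
  using assms
proof (induction rule: grown_tree.induct)
  case (single r)
  interpret tree_drawing "{0, 3}" "{(0, 3)}" "{}" "{}" "{3}" "\<lambda>_. {}" "\<lambda>_. (0, 0)" "\<lambda>_. {(0, 3)}"
    by (rule tree_drawing_single_edge)
  have "ear_graph {0, 3} {(0, 3)} (0, 3) 1 2"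
    by unfold_locales auto
  \<comment> \<open>The edge \<open>(0, 3)\<close> is always matched, so \<open>r\<close> is free;
    \<open>\<sigma>\<close> is \<open>True\<close> because the right end \<open>3\<close> is
    white.\<close>
  moreover have "I \<in> closed_sets {r} {} \<longleftrightarrow> I \<subseteq> {r} \<and> I - {r} \<in> closed_sets {} {} \<and>
      ((r \<in> I) = True \<longrightarrow> (0::real, 3::real) \<in> {(0, 3)})" for I
    by (auto simp: closed_sets_def)
  ultimately show ?case
    by (intro exI) (rule attach_polygon[of r "(0, 3)" 1 2 True "{}"], auto)
next
  case (leaf V A u w down)
  then obtain X P W Q q \<Phi> where "tree_drawing X P V A W Q q \<Phi>" by blast
  then interpret tree_drawing X P V A W Q q \<Phi> .
  show ?case using attach_leaf[OF grown_tree_arcs[OF leaf.hyps(1)] leaf.hyps(2,3)] by blast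
qed

section \<open>The matching poset of a drawing\<close>

lemma cyc_edge_mod: "cyc_edge vs (k mod length vs) = cyc_edge vs k"
  by (simp add: cyc_edge_def mod_Suc_eq)

lemma cyc_edge_in:
  assumes "is_cycle E vs"
  shows "cyc_edge vs k \<in> E" "cyc_edge vs k \<in> cyc_edges vs"
proof -
  have "k mod length vs < length vs" using assms by (intro mod_less_divisor) (auto simp: is_cycle_def)
  then have "cyc_edge vs (k mod length vs) \<in> cyc_edges vs" by (auto simp: cyc_edges_def)
  then show "cyc_edge vs k \<in> cyc_edges vs" by (simp add: cyc_edge_mod)
  then show "cyc_edge vs k \<in> E" using assms by (auto simp: is_cycle_def)
qed

text \<open>Consecutive cycle edges share a vertex, at which each matching has only one edge. So one
  of them comes from \<open>M1\<close> and the other from \<open>M2\<close>.\<close>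

lemma sym_diff_cycle_alternating:
  assumes M: "M1 \<in> perfect_matchings V E" "M2 \<in> perfect_matchings V E"
    and E: "\<And>e. e \<in> E \<Longrightarrow> e \<subseteq> V" and cycle: "is_cycle E vs"
    and diff: "cyc_edges vs = (M1 - M2) \<union> (M2 - M1)"
  shows "alternating M1 vs"
  unfolding alternating_def
proof (intro allI impI)
  fix i assume i: "i < length vs"
  let ?n = "length vs" and ?x = "vs ! (Suc i mod length vs)"
  have x: "?x \<in> cyc_edge vs i" "?x \<in> cyc_edge vs (Suc i)" by (auto simp: cyc_edge_def)
  then have xV: "?x \<in> V" using E cyc_edge_in(1)[OF cycle] by blast
  have n: "3 \<le> ?n" and dist: "distinct vs" using cycle by (auto simp: is_cycle_def)
  have "i \<noteq> Suc i mod ?n" using n i by (cases "Suc i = ?n") auto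
  moreover have "Suc i mod ?n < ?n" using i by (intro mod_less_divisor) linarith
  ultimately have "cyc_edge vs i \<noteq> cyc_edge vs (Suc i mod ?n)"
    using inj_onD[OF cyc_edge_inj[OF dist n], of i "Suc i mod ?n"] i by auto
  then have ne: "cyc_edge vs i \<noteq> cyc_edge vs (Suc i)" unfolding cyc_edge_mod .
  have unique: "e = e'" if "M \<in> perfect_matchings V E" "e \<in> M" "e' \<in> M" "?x \<in> e" "?x \<in> e'" for M e e'
    using that xV unfolding perfect_matchings_def by blast
  have "cyc_edge vs k \<in> (M1 - M2) \<union> (M2 - M1)" for k
    using cyc_edge_in(2)[OF cycle] unfolding diff by blast
  from this[of i] this[of "Suc i"] show "(cyc_edge vs i \<in> M1) \<noteq> (cyc_edge vs (Suc i) \<in> M1)"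
    using ne x unique[OF M(1), of "cyc_edge vs i" "cyc_edge vs (Suc i)"]
      unique[OF M(2), of "cyc_edge vs i" "cyc_edge vs (Suc i)"] by blast
qed

lemma coloured_edge:
  assumes "proper_two_colouring V E W" "{x, y} \<in> E"
  shows "(x \<in> W) \<noteq> (y \<in> W)"
proof -
  obtain w b where "w \<in> W" "b \<notin> W" "{x, y} = {w, b}"
    using assms unfolding proper_two_colouring_def by blast
  then show ?thesis by (auto simp: doubleton_eq_iff)
qed

text \<open>Along the cycle, membership in \<open>M\<close> and the colour of the starting vertex
  both flip at every edge, so one matched edge with a white start settles all.\<close>

lemma alternating_imp_proper:
  assumes alt: "alternating M vs" and col: "proper_two_colouring V E W" and cycle: "is_cycle E vs"
    and i: "i < length vs" "cyc_edge vs i \<in> M" "vs ! i \<in> W"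
  shows "proper_cycle W M vs"
proof -
  let ?n = "length vs"
  have n: "0 < ?n" using i by linarith
  have flip: "(cyc_edge vs k \<in> M) \<noteq> (cyc_edge vs (Suc k) \<in> M)" for k
  proof -
    have "cyc_edge vs (Suc (k mod ?n)) = cyc_edge vs (Suc k)"
      by (metis cyc_edge_mod mod_Suc_eq)
    then show ?thesis using alt mod_less_divisor[OF n, of k] cyc_edge_mod[of vs k]
      unfolding alternating_def by metis
  qed
  have colour: "(vs ! (k mod ?n) \<in> W) \<noteq> (vs ! (Suc k mod ?n) \<in> W)" for k
    using coloured_edge[OF col, of "vs ! (k mod ?n)" "vs ! (Suc k mod ?n)"] cyc_edge_in(1)[OF cycle, of k]
    by (simp add: cyc_edge_def)
  have "((cyc_edge vs k \<in> M) = (vs ! (k mod ?n) \<in> W)) = ((cyc_edge vs 0 \<in> M) = (vs ! (0 mod ?n) \<in> W))" for k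
  proof (induction k)
    case (Suc k)
    then show ?case using flip[of k] colour[of k] by argo
  qed simp
  from this[of i] this have "(cyc_edge vs k \<in> M) = (vs ! (k mod ?n) \<in> W)" for k using i by simp
  then show ?thesis unfolding proper_cycle_def using colour by (metis mod_less)
qed

lemma pt_in_ed: "pt x \<in> ed e \<longleftrightarrow> incident x e"
  by (auto simp: ed_def incident_def)

section \<open>Perfect matchings and arcs of the plane graph\<close>

context tree_drawing
begin

lemma proper_two_colouring: "proper_two_colouring (pt ` X) (ed ` P) (pt ` W)"
  unfolding proper_two_colouring_def
proof (intro conjI ballI)
  show "pt ` W \<subseteq> pt ` X" using W_X by blast
  fix f assume "f \<in> ed ` P"
  then obtain a b where ab: "(a, b) \<in> P" "f = {pt a, pt b}" by (auto simp: ed_def)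
  then have X: "a \<in> X" "b \<in> X" and c: "(a \<in> W) \<noteq> (b \<in> W)" using P_ends colour by auto
  have W: "pt x \<in> pt ` W \<longleftrightarrow> x \<in> W" for x by auto
  show "\<exists>w\<in>pt ` W. \<exists>b\<in>pt ` X - pt ` W. f = {w, b}"
  proof (cases "a \<in> W")
    case True
    then have "pt a \<in> pt ` W" "pt b \<in> pt ` X - pt ` W" using X c W by auto
    then show ?thesis using ab(2) by blast
  next
    case False
    then have "pt b \<in> pt ` W" "pt a \<in> pt ` X - pt ` W" "f = {pt b, pt a}" using X c W ab(2) by auto
    then show ?thesis by blast
  qed
qed

lemma perfect_matching_iff:
  assumes "M \<subseteq> P"
  shows "ed ` M \<in> perfect_matchings (pt ` X) (ed ` P) \<longleftrightarrow> M \<in> matchings X P"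
proof -
  have inj: "inj_on ed M" using inj_ed assms by (rule inj_on_subset)
  have "(\<exists>!f. f \<in> ed ` M \<and> pt x \<in> f) \<longleftrightarrow> (\<exists>!e. e \<in> M \<and> incident x e)" for x
  proof
    assume "\<exists>!e. e \<in> M \<and> incident x e"
    then obtain e where "e \<in> M" "incident x e" "\<And>e'. e' \<in> M \<Longrightarrow> incident x e' \<Longrightarrow> e' = e" by blast
    then have "f \<in> ed ` M \<and> pt x \<in> f \<longleftrightarrow> f = ed e" for f using pt_in_ed[of x] by blast
    then show "\<exists>!f. f \<in> ed ` M \<and> pt x \<in> f" by simp
  next
    assume "\<exists>!f. f \<in> ed ` M \<and> pt x \<in> f"
    then obtain e where e: "e \<in> M" "incident x e"
      and u: "\<And>f. f \<in> ed ` M \<Longrightarrow> pt x \<in> f \<Longrightarrow> f = ed e" using pt_in_ed[of x] by (metis imageE)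
    show "\<exists>!e. e \<in> M \<and> incident x e"
    proof (rule ex1I[of _ e])
      fix e' assume "e' \<in> M \<and> incident x e'"
      then have "e' \<in> M" "ed e' = ed e" using u[of "ed e'"] pt_in_ed[of x e'] by auto
      then show "e' = e" using inj_onD[OF inj _ _ e(1)] by blast
    qed (use e in blast)
  qed
  then show ?thesis using assms unfolding perfect_matchings_def matchings_def by auto
qed

lemma bij_perfect_matchings:
  "bij_betw (\<lambda>I. ed ` \<Phi> I) (closed_sets V A) (perfect_matchings (pt ` X) (ed ` P))"
proof -
  have "inj_on (\<lambda>M. ed ` M) (matchings X P)"
  proof (rule inj_onI)
    fix M N assume "M \<in> matchings X P" "N \<in> matchings X P" "ed ` M = ed ` N"
    then show "M = N" using inj_on_image_eq_iff[OF inj_ed, of M N] by (auto simp: matchings_def)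
  qed
  moreover have "(\<lambda>M. ed ` M) ` matchings X P = perfect_matchings (pt ` X) (ed ` P)"
  proof (intro equalityI subsetI)
    fix N assume "N \<in> (\<lambda>M. ed ` M) ` matchings X P"
    then show "N \<in> perfect_matchings (pt ` X) (ed ` P)"
      using perfect_matching_iff by (auto simp: matchings_def)
  next
    fix N assume N: "N \<in> perfect_matchings (pt ` X) (ed ` P)"
    then have "N \<subseteq> ed ` P" by (auto simp: perfect_matchings_def)
    then obtain M where M: "M \<subseteq> P" "N = ed ` M" by (meson subset_imageE)
    then show "N \<in> (\<lambda>M. ed ` M) ` matchings X P" using N perfect_matching_iff[OF M(1)] by blast
  qed
  ultimately have "bij_betw (\<lambda>M. ed ` M) (matchings X P) (perfect_matchings (pt ` X) (ed ` P))"
    by (simp add: bij_betw_def)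
  from bij_betw_trans[OF bij_\<Phi> this] show ?thesis by (simp add: comp_def)
qed

lemma perfect_matchingE:
  assumes "N \<in> perfect_matchings (pt ` X) (ed ` P)"
  obtains I where "I \<in> closed_sets V A" "N = ed ` \<Phi> I"
  using assms that unfolding bij_betw_imp_surj_on[OF bij_perfect_matchings, symmetric] by (elim imageE)

abbreviation "arcs \<equiv> z_arcs (pt ` X) (ed ` P) (\<lambda>e. convex hull e) (pt ` W)"

lemma ed_edge_subset: "f \<in> ed ` P \<Longrightarrow> f \<subseteq> pt ` X"
  using P_ends by (auto simp: ed_def)

text \<open>The larger ideal matches \<open>q v\<close>, and the clockwise list enters this edge at
  its white right end, which makes the polygon proper for the larger ideal.\<close>

lemma flip_z_arc:
  assumes v: "v \<in> V" and J: "v \<notin> J" "J \<in> closed_sets V A" "insert v J \<in> closed_sets V A"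
  shows "(ed ` \<Phi> (insert v J), ed ` \<Phi> J) \<in> arcs"
proof -
  let ?vs = "map pt (descending (Q v))" and ?M1 = "ed ` \<Phi> (insert v J)" and ?M2 = "ed ` \<Phi> J"
  note Qv = finite_Q[OF v] Q_card[OF v] Q_P[OF v]
  note cyc = polygon_cycle[OF Qv]
  have beyond: "Max (Q v) \<le> c \<or> d \<le> Min (Q v) \<or> (c \<le> Min (Q v) \<and> Max (Q v) \<le> d) \<or>
      (\<exists>(a, b)\<in>consec (Q v). a \<le> c \<and> d \<le> b)" if "(c, d) \<in> P" for c d
    using Q_beyond[OF v that] by (simp add: beyond_polygon_def)
  note face = convex_polygon_face[OF Qv beyond]
  have M: "?M1 \<in> perfect_matchings (pt ` X) (ed ` P)" "?M2 \<in> perfect_matchings (pt ` X) (ed ` P)"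
    using bij_perfect_matchings J by (auto simp: bij_betw_def)
  have sub: "\<Phi> (insert v J) \<subseteq> P" "\<Phi> J \<subseteq> P" using \<Phi>_sub J by auto
  have ed_diff: "ed ` (M - N) = ed ` M - ed ` N" if "M \<subseteq> P" "N \<subseteq> P" for M N
    using inj_on_image_set_diff[OF inj_ed _ that(2), of M] that(1) by blast
  have diff: "cyc_edges ?vs = (?M1 - ?M2) \<union> (?M2 - ?M1)"
    unfolding cyc(2) \<Phi>_flip[OF v J, symmetric] image_Un
    by (simp only: ed_diff[OF sub] ed_diff[OF sub(2,1)])
  have alt: "alternating ?M1 ?vs"
    by (rule sym_diff_cycle_alternating[OF M ed_edge_subset cyc(1) diff])
  obtain a b where ab: "q v = (a, b)" by fastforce
  obtain i where i: "i < length ?vs" "?vs ! (i mod length ?vs) = pt b" "?vs ! (Suc i mod length ?vs) = pt a"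
    using cyc(4)[of a b] q_consec[OF v] ab by auto
  have "cyc_edge ?vs i = ed (q v)" using i(2,3) unfolding cyc_edge_def ab ed_def by auto
  moreover have "q v \<in> \<Phi> (insert v J)" using \<Phi>_q[OF v J(3)] by simp
  ultimately have "cyc_edge ?vs i \<in> ?M1" by simp
  moreover have "?vs ! i \<in> pt ` W" using i q_colour[OF v] ab by auto
  ultimately have "proper_cycle (pt ` W) ?M1 ?vs"
    using alternating_imp_proper[OF alt proper_two_colouring cyc(1) i(1)] by blast
  then show ?thesis unfolding z_arcs_def using M cyc(1) face diff alt by blast
qed

text \<open>If \<open>v\<close> entered along an arc, the cycle would traverse \<open>q v\<close>
  from its white right end to its black left end. The next edge would be matched in the source and
  start at the black vertex, against properness.\<close>

lemma z_arc_decreasing: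
  assumes arc: "(ed ` \<Phi> I, ed ` \<Phi> J) \<in> arcs" and I: "I \<in> closed_sets V A" and J: "J \<in> closed_sets V A"
  shows "J \<subseteq> I"
proof
  fix v assume vJ: "v \<in> J"
  then have v: "v \<in> V" using J by (auto simp: closed_sets_def)
  obtain vs where cycle: "is_cycle (ed ` P) vs" and cw: "clockwise (\<lambda>e. convex hull e) vs"
    and diff: "cyc_edges vs = (ed ` \<Phi> I - ed ` \<Phi> J) \<union> (ed ` \<Phi> J - ed ` \<Phi> I)"
    and alt: "alternating (ed ` \<Phi> I) vs" and proper: "proper_cycle (pt ` W) (ed ` \<Phi> I) vs"
    using arc unfolding z_arcs_def by blast
  show "v \<in> I"
  proof (rule ccontr)
    assume "v \<notin> I"
    then have "q v \<notin> \<Phi> I" "q v \<in> \<Phi> J" using \<Phi>_q[OF v] I J vJ by auto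
    moreover have "ed (q v) \<in> ed ` \<Phi> I \<longleftrightarrow> q v \<in> \<Phi> I"
      using inj_on_image_mem_iff[OF inj_ed q_P[OF v] \<Phi>_sub[OF I]] .
    ultimately have "ed (q v) \<in> cyc_edges vs" and no: "ed (q v) \<notin> ed ` \<Phi> I" using diff by auto
    then obtain i where i: "i < length vs" "cyc_edge vs i = ed (q v)" by (auto simp: cyc_edges_def)
    obtain a b where ab: "q v = (a, b)" by fastforce
    have abP: "(a, b) \<in> P" using q_P[OF v] ab by simp
    have hull: "x \<le> a \<or> b \<le> x" if "x \<in> X" for x using q_hull[OF v that] ab by simp
    have "vs ! i = pt b \<and> vs ! (Suc i mod length vs) = pt a"
      using clockwise_hull_edge[OF cycle cw abP hull i(1)] i(2) ab by simp
    moreover have "(cyc_edge vs i \<in> ed ` \<Phi> I) \<noteq> (cyc_edge vs (Suc i) \<in> ed ` \<Phi> I)"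
      using alt i(1) unfolding alternating_def by blast
    then have "cyc_edge vs (Suc i) \<in> ed ` \<Phi> I" using no unfolding i(2) by argo
    then have "cyc_edge vs (Suc i mod length vs) \<in> ed ` \<Phi> I" by (simp only: cyc_edge_mod)
    moreover have "Suc i mod length vs < length vs" using i by (intro mod_less_divisor) linarith
    ultimately have "pt a \<in> pt ` W" using proper unfolding proper_cycle_def by metis
    then show False using q_colour[OF v] ab by auto
  qed
qed

lemma z_reachable_iff:
  assumes acyclic: "acyclic A" and fin: "finite V" "A \<subseteq> V \<times> V"
    and I: "I \<in> closed_sets V A" and J: "J \<in> closed_sets V A"
  shows "(ed ` \<Phi> I, ed ` \<Phi> J) \<in> arcs\<^sup>* \<longleftrightarrow> J \<subseteq> I"
proof
  assume "(ed ` \<Phi> I, ed ` \<Phi> J) \<in> arcs\<^sup>*"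
  then have "\<exists>K\<in>closed_sets V A. ed ` \<Phi> J = ed ` \<Phi> K \<and> K \<subseteq> I"
  proof (induction rule: rtrancl_induct)
    case base
    then show ?case using I by blast
  next
    case (step M N)
    then obtain K where K: "K \<in> closed_sets V A" "M = ed ` \<Phi> K" "K \<subseteq> I" by blast
    have "N \<in> perfect_matchings (pt ` X) (ed ` P)" using step.hyps(2) by (auto simp: z_arcs_def)
    then obtain L where L: "L \<in> closed_sets V A" "N = ed ` \<Phi> L"
      by (rule perfect_matchingE)
    then show ?case using z_arc_decreasing[of K L] step.hyps(2) K by blast
  qed
  then obtain K where "K \<in> closed_sets V A" "ed ` \<Phi> J = ed ` \<Phi> K" "K \<subseteq> I" by blast
  then show "J \<subseteq> I" using inj_onD[OF bij_betw_imp_inj_on[OF bij_perfect_matchings]] J by blast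
next
  have "finite A" using fin by (meson finite_SigmaI finite_subset)
  then have wf: "wf (A\<inverse>)" using acyclic by (rule finite_acyclic_wf_converse)
  have "finite I" using I fin by (auto simp: closed_sets_def intro: finite_subset)
  assume "J \<subseteq> I"
  then show "(ed ` \<Phi> I, ed ` \<Phi> J) \<in> arcs\<^sup>*" using J
  proof (induction "card (I - J)" arbitrary: J)
    case 0
    then have "I = J" using \<open>finite I\<close> by auto
    then show ?case by simp
  next
    case (Suc n)
    then have "I - J \<noteq> {}" by auto
    \<comment> \<open>An element with no arc into \<open>I - J\<close> can join \<open>J\<close>:
      its arcs end in \<open>I\<close>, hence in \<open>J\<close>.\<close>
    then obtain v where v: "v \<in> I - J" and min: "\<And>y. (y, v) \<in> A\<inverse> \<Longrightarrow> y \<notin> I - J"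
      using wf by (metis wfE_min ex_in_conv)
    have closed: "insert v J \<in> closed_sets V A"
      using v min I Suc.prems(2) unfolding closed_sets_def by fastforce
    have "I - J = insert v (I - insert v J)" using v by blast
    then have "n = card (I - insert v J)"
      using Suc.hyps(2) \<open>finite I\<close> by (metis DiffD2 card_insert_disjoint finite_Diff insertI1 nat.inject)
    moreover have "insert v J \<subseteq> I" using v Suc.prems by blast
    ultimately have "(ed ` \<Phi> I, ed ` \<Phi> (insert v J)) \<in> arcs\<^sup>*" using Suc.hyps(1) closed by blast
    moreover have "v \<in> V" using v I by (auto simp: closed_sets_def)
    then have "(ed ` \<Phi> (insert v J), ed ` \<Phi> J) \<in> arcs" using flip_z_arc v Suc.prems(2) closed by blast
    ultimately show ?case by (rule rtrancl_into_rtrancl)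
  qed
qed

lemma ideal_lattice_isomorphic_matching_poset:
  assumes "acyclic A" "finite V" "A \<subseteq> V \<times> V"
  shows "order_isomorphic (ideal_lattice (reach_poset V A))
    (matching_poset (pt ` X) (ed ` P) (\<lambda>e. convex hull e) (pt ` W))"
proof -
  let ?f = "\<lambda>I. ed ` \<Phi> I" and ?PM = "perfect_matchings (pt ` X) (ed ` P)"
  let ?L = "ideal_lattice (reach_poset V A)"
    and ?K = "matching_poset (pt ` X) (ed ` P) (\<lambda>e. convex hull e) (pt ` W)"
  have cL: "carrier ?L = closed_sets V A"
    using order_ideals_reach_poset[OF assms(3)] by (simp add: ideal_lattice_def closed_sets_def)
  have cK: "carrier ?K = ?PM" by (simp add: matching_poset_def reach_poset_def)
  note le = z_reachable_iff[OF assms]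
  \<comment> \<open>Antisymmetry of reachability is not built into the digraph; it is read off from
    the comparison with inclusion.\<close>
  have "weak_partial_order ?K"
  proof
    fix M N assume MN: "M \<sqsubseteq>\<^bsub>?K\<^esub> N" "N \<sqsubseteq>\<^bsub>?K\<^esub> M" "M \<in> carrier ?K" "N \<in> carrier ?K"
    obtain I where I: "I \<in> closed_sets V A" "M = ?f I" using MN(3) unfolding cK by (rule perfect_matchingE)
    obtain J where J: "J \<in> closed_sets V A" "N = ?f J" using MN(4) unfolding cK by (rule perfect_matchingE)
    note IJ = I J
    then have "I \<subseteq> J" "J \<subseteq> I" using MN le[OF IJ(1,3)] le[OF IJ(3,1)]
      by (auto simp: matching_poset_def reach_poset_def)
    then show "M .=\<^bsub>?K\<^esub> N" using IJ by (simp add: matching_poset_def reach_poset_def)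
  qed (auto simp: matching_poset_def reach_poset_def)
  moreover have "weak_partial_order ?L"
    using partial_order_ideal_lattice by (rule partial_order.axioms)
  moreover have "?f I \<sqsubseteq>\<^bsub>?K\<^esub> ?f J \<longleftrightarrow> I \<sqsubseteq>\<^bsub>?L\<^esub> J" if "I \<in> carrier ?L" "J \<in> carrier ?L" for I J
    using that le[of J I] unfolding cL by (simp add: matching_poset_def reach_poset_def ideal_lattice_def)
  ultimately have "order_emb ?L ?K ?f" by (simp add: order_emb_def)
  then show ?thesis unfolding order_isomorphic_def cL cK using bij_perfect_matchings by blast
qed

end

theorem theorem5p5:
  fixes V :: "'a set" and E :: "'a set set" and A :: "('a \<times> 'a) set"
  assumes "finite_tree V E" and "is_orientation E A"
  shows "matchable_distributive_lattice (ideal_lattice (reach_poset V A)) \<and>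
         irreducible_lattice TYPE('b) (ideal_lattice (reach_poset V A))"
proof
  have grown: "grown_tree V A" using assms by (rule finite_tree_grown)
  then obtain X P W Q q \<Phi> where "tree_drawing X P V A W Q q \<Phi>" using grown_tree_drawing by blast
  then interpret tree_drawing X P V A W Q q \<Phi> .
  have fin: "finite V" using assms(1) by (simp add: finite_tree_def finite_graph_def)
  have "acyclic A" using orientation_acyclic[OF assms] by (simp add: acyclic_def)
  from ideal_lattice_isomorphic_matching_poset[OF this fin grown_tree_arcs[OF grown]]
  show "matchable_distributive_lattice (ideal_lattice (reach_poset V A))"
    unfolding matchable_distributive_lattice_def
    using finite_distributive_ideal_lattice[of "reach_poset V A"] fin plane_graph proper_two_colouring
    by (auto simp: reach_poset_def)
  show "irreducible_lattice TYPE('b) (ideal_lattice (reach_poset V A))"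
    using grown by (rule irreducible_ideal_lattice_grown_tree)
qed

end
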